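(* Let $k,r\geq2$ be integers and let $D$ be a constant with $D\geq 2^{r+1}rk^r(16)^k$. There exists $n_0$ such that the following holds for every real $\lambda\geq1$, with some $\alpha=\alpha(k,r,\lambda)>0$: if $G$ is a linear $r$-partite $r$-graph with $r$-partition $A_1,\dots,A_r$ such that $|A_1\cup A_2|=n\geq n_0$ and for every $v\in A_1\cup A_2$, $$Dn^{1/k}\leq|L_G(v)|\leq\lambda Dn^{1/k},$$ then $t_{C^{(r)}_{2k}}(G)\geq\alpha n^2$.
   Context: An $r$-graph is an $r$-uniform hypergraph; it is linear if any two edges share at most one vertex; it is $r$-partite with $r$-partition $A_1,\dots,A_r$ if every edge contains exactly one vertex of each $A_i$. The link of $v$ is $L_G(v)=\{I: |I|=r-1,\ I\cup\{v\}\in E(G)\}$. The linear cycle $C^{(r)}_{2k}$ is obtained from a $2$-uniform cycle of length $2k$ by enlarging each edge with its own $(r-2)$-set of new vertices, these sets being pairwise disjoint. $t_H(G)$ is the number of copies of $H$ in $G$. *)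

theory Defs
  imports Complex_Main "HOL-Library.Disjoint_Sets"
begin

type_synonym 'a hypergraph = "'a set \<times> 'a set set"

abbreviation verts :: "'a hypergraph \<Rightarrow> 'a set" where
  "verts G \<equiv> fst G"

abbreviation edges :: "'a hypergraph \<Rightarrow> 'a set set" where
  "edges G \<equiv> snd G"

definition uniform_hypergraph :: "nat \<Rightarrow> 'a hypergraph \<Rightarrow> bool" where
  "uniform_hypergraph r G \<longleftrightarrow>
     finite (verts G) \<and> (\<forall>e\<in>edges G. e \<subseteq> verts G \<and> card e = r)"

definition linear_hypergraph :: "'a hypergraph \<Rightarrow> bool" where
  "linear_hypergraph G \<longleftrightarrow>
     (\<forall>e\<in>edges G. \<forall>f\<in>edges G. e \<noteq> f \<longrightarrow> card (e \<inter> f) \<le> 1)"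

definition r_partition :: "nat \<Rightarrow> 'a hypergraph \<Rightarrow> (nat \<Rightarrow> 'a set) \<Rightarrow> bool" where
  "r_partition r G A \<longleftrightarrow>
     disjoint_family_on A {1..r} \<and> (\<Union>i\<in>{1..r}. A i) = verts G \<and>
     (\<forall>e\<in>edges G. \<forall>i\<in>{1..r}. card (e \<inter> A i) = 1)"

definition link :: "nat \<Rightarrow> 'a hypergraph \<Rightarrow> 'a \<Rightarrow> 'a set set" where
  "link r G v = {I. card I = r - 1 \<and> I \<union> {v} \<in> edges G}"

text \<open>The vertices of the underlying 2-uniform cycle of length \<open>m\<close> are the pairs \<open>(i, 0)\<close>
  with \<open>i < m\<close>; the \<open>r - 2\<close> new vertices enlarging its \<open>i\<close>-th edge are the pairs \<open>(i, j)\<close>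
  with \<open>1 \<le> j \<le> r - 2\<close>. This is the intended object for \<open>m \<ge> 3\<close> and \<open>r \<ge> 2\<close>.\<close>

definition linear_cycle :: "nat \<Rightarrow> nat \<Rightarrow> (nat \<times> nat) hypergraph" where
  "linear_cycle r m =
     ({..<m} \<times> {0..r - 2},
      (\<lambda>i. {(i, 0), (Suc i mod m, 0)} \<union> {i} \<times> {1..r - 2}) ` {..<m})"

definition hypergraph_iso :: "'b hypergraph \<Rightarrow> 'a hypergraph \<Rightarrow> bool" where
  "hypergraph_iso H K \<longleftrightarrow>
     (\<exists>f. bij_betw f (verts H) (verts K) \<and> edges K = (\<lambda>e. f ` e) ` edges H)"

text \<open>A copy of \<open>H\<close> in \<open>G\<close> is a (not necessarily induced) subhypergraph of \<open>G\<close> isomorphic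
  to \<open>H\<close>; copies are unlabelled.\<close>

definition copies :: "'b hypergraph \<Rightarrow> 'a hypergraph \<Rightarrow> 'a hypergraph set" where
  "copies H G = {K. verts K \<subseteq> verts G \<and> edges K \<subseteq> edges G \<and> hypergraph_iso H K}"

definition num_copies :: "'b hypergraph \<Rightarrow> 'a hypergraph \<Rightarrow> nat" where
  "num_copies H G = card (copies H G)"

end

theory Submission
  imports Defs "HOL-Library.FuncSet"
begin

text \<open>
  Let \<open>U = A 1 \<union> A 2\<close> and let \<open>d\<close> be the lower bound on the degrees in \<open>U\<close>. A random labelling of the vertices by \<open>{1..k}\<close> leaves every
  vertex of \<open>U\<close>, for every label \<open>t\<close>, at least \<open>d / (2k)\<^sup>r\<close> edges whose other vertices all have label \<open>t\<close>.
  From a root \<open>x\<close> grow levels \<open>L 0 = {x}, L 1, L 2, \<dots>\<close> inside \<open>U\<close>, using for the step to \<open>L t\<close> only \<open>\<delta>\<close>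
  edges of label \<open>t\<close> at each vertex. Since \<open>d / (2k)\<^sup>r\<close> exceeds a large
  multiple of the \<open>k\<close>-th root of \<open>|U|\<close>, some step \<open>i < k\<close> does not expand fully, so a typical
  \<open>y\<close> in the next level has many neighbours in \<open>L i\<close>. Every \<open>u\<close> in \<open>L i\<close> carries the hyperpath \<open>T 0 u,
  T 1 u, \<dots>\<close> of its ancestors; by pigeonhole the neighbours of \<open>y\<close> split, up to \<open>k\<^sup>2r\<close> of them, into
  stars of \<open>k\<close> vertices whose hyperpaths all pass through one vertex \<open>z\<close> at the same height \<open>n\<close>, the
  first one of which meets the others at \<open>z\<close> for the first time.

  Consecutive stars sharing a leaf form a walk; a walk through \<open>m = k - 1 - n\<close> stars, closed up through
  the two hyperpaths to \<open>z\<close>, has \<open>2m + 2(n + 1) = 2k\<close> edges. To make it a linear cycle, pass to a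
  positive proportion of the stars in which each vertex attached to a star is either determined by a
  given leaf of the star or takes every value rarely. A greedy choice then avoids all coincidences
  between different stars of the walk except those already present inside a single star, and these
  are excluded by construction. Each root thus yields of the order of \<open>\<delta>\<close> to the power \<open>k + g\<close> cycles,
  where \<open>g = i - n - 1\<close>, and each cycle is met from at most a constant times \<open>(\<lambda>d)\<close> to the power \<open>g\<close> roots.
\<close>

section \<open>Subfamilies with determined or spread attributes\<close>

lemma max_subset_exists:
  fixes f :: "'a set \<Rightarrow> real"
  assumes "finite Y"
  shows "\<exists>S\<subseteq>Y. \<forall>S'\<subseteq>Y. f S' \<le> f S"
proof -
  have fin: "finite (f ` Pow Y)" and ne: "f ` Pow Y \<noteq> {}" using assms by auto
  obtain S where "S \<in> Pow Y" "f S = Max (f ` Pow Y)" using Max_in[OF fin ne] by auto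
  then show ?thesis using Max_ge[OF fin] by (intro exI[of _ S]) auto
qed

text \<open>Take a subset maximising its size minus \<open>c\<close> times the total number of
  nonempty fibres of the maps \<open>\<sigma> j\<close>. Dropping a fibre with fewer than
  \<open>c\<close> elements would raise this value, so no such fibre is left; comparison with
  \<open>Y\<close> itself bounds the loss.\<close>

lemma min_degree_subfamily:
  fixes \<sigma> :: "'j \<Rightarrow> 'y \<Rightarrow> 'u" and c :: real
  assumes "finite Y" "finite L" "finite J" "c \<ge> 0"
    and "\<And>j y. j \<in> J \<Longrightarrow> y \<in> Y \<Longrightarrow> \<sigma> j y \<in> L"
  shows "\<exists>Z\<subseteq>Y. card Z \<ge> card Y - c * card J * card L \<and>
           (\<forall>j\<in>J. \<forall>y\<in>Z. card {y'\<in>Z. \<sigma> j y' = \<sigma> j y} \<ge> c)"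
proof -
  define f where "f S = real (card S) - c * (\<Sum>j\<in>J. real (card (\<sigma> j ` S)))" for S
  obtain Z where Z: "Z \<subseteq> Y" and mx: "\<And>S'. S' \<subseteq> Y \<Longrightarrow> f S' \<le> f Z"
    using max_subset_exists[OF assms(1), of f] by auto
  have finZ: "finite Z" using Z assms(1) finite_subset by blast
  have "(\<Sum>j\<in>J. real (card (\<sigma> j ` Y))) \<le> (\<Sum>j\<in>J. real (card L))"
    using assms by (intro sum_mono of_nat_mono card_mono) auto
  then have "c * (\<Sum>j\<in>J. real (card (\<sigma> j ` Y))) \<le> c * (card J * card L)"
    using assms(4) by (intro mult_left_mono) auto
  then have "f Y \<ge> card Y - c * card J * card L" unfolding f_def by (simp add: mult.assoc)
  moreover have "f Z \<le> card Z"
    unfolding f_def using assms(4) by (simp add: sum_nonneg)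
  ultimately have 1: "card Z \<ge> card Y - c * card J * card L" using mx[of Y] by simp
  have 2: "card {y'\<in>Z. \<sigma> j y' = \<sigma> j y} \<ge> c" if j: "j \<in> J" and y: "y \<in> Z" for j y
  proof -
    let ?D = "{y'\<in>Z. \<sigma> j y' = \<sigma> j y}"
    let ?S = "Z - ?D"
    have cS: "real (card ?S) = card Z - card ?D"
    proof -
      have "card ?S = card Z - card ?D" using finZ by (intro card_Diff_subset) auto
      moreover have "card ?D \<le> card Z" using finZ by (intro card_mono) auto
      ultimately show ?thesis by simp
    qed
    have "\<sigma> j ` ?S = \<sigma> j ` Z - {\<sigma> j y}" by auto
    then have ej: "real (card (\<sigma> j ` ?S)) = real (card (\<sigma> j ` Z)) - 1"
    proof -
      assume e: "\<sigma> j ` ?S = \<sigma> j ` Z - {\<sigma> j y}"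
      have "card (\<sigma> j ` Z) = Suc (card (\<sigma> j ` Z - {\<sigma> j y}))"
        using finZ y by (intro card.remove) auto
      then show ?thesis unfolding e by simp
    qed
    have "(\<Sum>j'\<in>J. real (card (\<sigma> j' ` ?S))) \<le>
          (\<Sum>j'\<in>J. real (card (\<sigma> j' ` Z)) - (if j' = j then 1 else 0))"
      using ej finZ by (intro sum_mono) (auto intro!: card_mono)
    also have "\<dots> = (\<Sum>j'\<in>J. real (card (\<sigma> j' ` Z))) - 1"
      using j assms(3) by (simp add: sum_subtractf)
    finally have "c * (\<Sum>j'\<in>J. real (card (\<sigma> j' ` ?S))) \<le> c * ((\<Sum>j'\<in>J. real (card (\<sigma> j' ` Z))) - 1)"
      using assms(4) by (rule mult_left_mono)
    moreover have "f ?S \<le> f Z" using Z by (intro mx) auto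
    ultimately show ?thesis using cS unfolding f_def by (simp add: algebra_simps)
  qed
  show ?thesis using Z 1 2 by blast
qed

text \<open>The two extreme ways in which an attribute \<open>V\<close> can behave on the fibres of
  \<open>s\<close>. In a walk the next star is picked inside a fibre of \<open>s\<close>: a
  determined attribute is then inherited from the previous star, while a spread one can be steered
  away from any bounded number of values.\<close>

definition det_by :: "('y \<Rightarrow> 'u) \<Rightarrow> ('y \<Rightarrow> 'v) \<Rightarrow> 'y set \<Rightarrow> bool" where
  "det_by s V Z \<longleftrightarrow> (\<forall>y\<in>Z. \<forall>y'\<in>Z. s y = s y' \<longrightarrow> V y = V y')"

definition spread_by :: "real \<Rightarrow> ('y \<Rightarrow> 'u) \<Rightarrow> ('y \<Rightarrow> 'v) \<Rightarrow> 'y set \<Rightarrow> bool" where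
  "spread_by c s V Z \<longleftrightarrow> (\<forall>y\<in>Z. \<forall>v. real (card {y'\<in>Z. s y' = s y \<and> V y' = v}) \<le> c)"

lemma det_by_mono: "det_by s V Y \<Longrightarrow> Z \<subseteq> Y \<Longrightarrow> det_by s V Z"
  unfolding det_by_def by blast

lemma spread_by_mono:
  assumes "spread_by c s V Y" "Z \<subseteq> Y" "finite Y"
  shows "spread_by c s V Z"
  unfolding spread_by_def
proof (intro ballI allI)
  fix y v assume "y \<in> Z"
  have "card {y'\<in>Z. s y' = s y \<and> V y' = v} \<le> card {y'\<in>Y. s y' = s y \<and> V y' = v}"
    using assms by (intro card_mono) auto
  then show "real (card {y'\<in>Z. s y' = s y \<and> V y' = v}) \<le> c"
    using assms(1,2) \<open>y \<in> Z\<close> unfolding spread_by_def by (meson of_nat_mono order_trans subsetD)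
qed

text \<open>\<open>P\<close> collects the elements whose value of \<open>V\<close> is popular in
  their fibre of \<open>s\<close>. In every fibre that meets \<open>P\<close>, keep one popular
  value only. The class kept has more than \<open>\<eta> * \<delta>\<close> elements and the fibre
  at most \<open>\<delta>\<close>, so a proportion \<open>\<eta>\<close> of \<open>P\<close>
  survives.\<close>

lemma popular_det:
  fixes s :: "'y \<Rightarrow> 'u" and V :: "'y \<Rightarrow> 'v" and \<eta> \<delta> :: real
  assumes "finite Y" "\<eta> \<ge> 0"
    and deg: "\<And>y. y \<in> Y \<Longrightarrow> card {y'\<in>Y. s y' = s y} \<le> \<delta>"
    and P: "P = {y\<in>Y. card {y'\<in>Y. s y' = s y \<and> V y' = V y} > \<eta> * \<delta>}"
  shows "\<exists>Z\<subseteq>Y. det_by s V Z \<and> card Z \<ge> \<eta> * card P"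
proof -
  define w where "w u = (SOME y. y \<in> P \<and> s y = u)" for u
  have w: "w (s y) \<in> P \<and> s (w (s y)) = s y" if "y \<in> P" for y
    unfolding w_def by (rule someI[of _ y]) (use that in simp)
  define Z where "Z = {y\<in>P. V y = V (w (s y))}"
  have finP: "finite P" using P assms(1) by simp
  have sub: "P \<subseteq> Y" using P by auto
  have "det_by s V Z" unfolding det_by_def Z_def by simp
  moreover have "card Z \<ge> \<eta> * card P"
  proof -
    have fib: "card W = (\<Sum>u\<in>s ` P. card {y\<in>W. s y = u})" if "W \<subseteq> P" for W
    proof -
      have "(\<Sum>u\<in>s ` P. \<Sum>y\<in>{y\<in>W. s y = u}. 1) = (\<Sum>y\<in>W. (1::nat))"
        using finP that by (intro sum.group) (auto intro: finite_subset)
      then show ?thesis by simp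
    qed
    have "card Z = (\<Sum>u\<in>s ` P. card {y\<in>Z. s y = u})" by (rule fib) (auto simp: Z_def)
    moreover have "real (card {y\<in>Z. s y = u}) \<ge> \<eta> * card {y\<in>P. s y = u}" if u: "u \<in> s ` P" for u
    proof -
      obtain y where y: "y \<in> P" "u = s y" using u by auto
      have wP: "w u \<in> P" "s (w u) = u" using w[OF y(1)] y(2) by auto
      have "{y\<in>Z. s y = u} = {y'\<in>Y. s y' = s (w u) \<and> V y' = V (w u)}"
        using wP unfolding Z_def P by auto
      then have "card {y\<in>Z. s y = u} > \<eta> * \<delta>" using wP P by auto
      moreover have "card {y\<in>P. s y = u} \<le> \<delta>"
      proof -
        have "card {y\<in>P. s y = u} \<le> card {y'\<in>Y. s y' = s (w u)}"
          using wP sub assms(1) by (intro card_mono) auto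
        moreover have "card {y'\<in>Y. s y' = s (w u)} \<le> \<delta>" using deg[of "w u"] wP(1) sub by blast
        ultimately show ?thesis by linarith
      qed
      ultimately show ?thesis using assms(2) mult_left_mono[of "real (card {y\<in>P. s y = u})" \<delta> \<eta>] by linarith
    qed
    ultimately show ?thesis unfolding fib[OF order_refl] by (simp add: sum_distrib_left sum_mono)
  qed
  moreover have "Z \<subseteq> Y" using sub unfolding Z_def by auto
  ultimately show ?thesis by blast
qed

text \<open>Either some undetermined pair \<open>(j, q)\<close> has many popular elements, and
  \<open>popular_det\<close> turns it into a determined one on a smaller family; or all popular
  elements can be deleted at the cost of half of \<open>Y\<close>, which makes the undetermined
  pairs spread, and pruning restores the minimum degree. The threshold for popularity is the final
  degree bound \<open>g * \<delta>\<close> divided by \<open>B\<close>.\<close>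

lemma canonical_step:
  fixes \<sigma> :: "'j \<Rightarrow> 'y \<Rightarrow> 'u" and V :: "'q \<Rightarrow> 'y \<Rightarrow> 'v" and B \<beta> \<delta> :: real
  assumes fin: "finite Y" "finite L" "finite J" "finite Q" and "J \<noteq> {}" "B > 0" "\<beta> > 0" "\<delta> \<ge> 0"
    and L: "\<And>j y. j \<in> J \<Longrightarrow> y \<in> Y \<Longrightarrow> \<sigma> j y \<in> L"
    and deg: "\<And>j u. j \<in> J \<Longrightarrow> u \<in> L \<Longrightarrow> card {y\<in>Y. \<sigma> j y = u} \<le> \<delta>"
    and big: "card Y \<ge> \<beta> * \<delta> * card L"
    and g: "g = \<beta> / (4 * card J)" and K: "K = 2 * (card J * card Q + 1)"
  shows "(\<exists>j\<in>J. \<exists>q\<in>Q. \<exists>Z\<subseteq>Y. \<not> det_by (\<sigma> j) (V q) Y \<and> det_by (\<sigma> j) (V q) Z \<and>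
             card Z \<ge> g / B * \<beta> / K * \<delta> * card L) \<or>
         (\<exists>Z\<subseteq>Y. card Z \<ge> g * \<delta> * card L \<and>
            (\<forall>j\<in>J. \<forall>y\<in>Z. card {y'\<in>Z. \<sigma> j y' = \<sigma> j y} \<ge> g * \<delta>) \<and>
            (\<forall>j\<in>J. \<forall>q\<in>Q. det_by (\<sigma> j) (V q) Z \<or> spread_by (g / B * \<delta>) (\<sigma> j) (V q) Z))"
proof -
  define \<eta> where "\<eta> = g / B"
  have cJ: "card J \<ge> 1" using fin assms(5) by (simp add: Suc_leI card_gt_0_iff)
  have gpos: "g > 0" using g cJ assms(7) by simp
  have \<eta>: "\<eta> > 0" unfolding \<eta>_def using gpos assms(6) by simp
  have Kpos: "K > 0" using K by (simp add: add_nonneg_pos)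
  define P where "P j q = {y\<in>Y. card {y'\<in>Y. \<sigma> j y' = \<sigma> j y \<and> V q y' = V q y} > \<eta> * \<delta>}" for j q
  \<comment> \<open>Determined pairs stay determined on subfamilies, so popular elements are deleted
    for the other pairs only.\<close>
  define N where "N = {(j,q) \<in> J \<times> Q. \<not> det_by (\<sigma> j) (V q) Y}"
  show ?thesis
  proof (cases "\<exists>(j,q)\<in>N. card (P j q) \<ge> card Y / K")
    case True
    then obtain j q where jq: "j \<in> J" "q \<in> Q" "\<not> det_by (\<sigma> j) (V q) Y" "card (P j q) \<ge> card Y / K"
      unfolding N_def by auto
    obtain Z where Z: "Z \<subseteq> Y" "det_by (\<sigma> j) (V q) Z" "card Z \<ge> \<eta> * card (P j q)"
      using popular_det[OF fin(1) less_imp_le[OF \<eta>] _ P_def[of j q]] deg L jq by blast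
    have "\<beta> * \<delta> * card L / K \<le> card Y / K" using big Kpos by (intro divide_right_mono) auto
    then have "\<eta> * (\<beta> * \<delta> * card L / K) \<le> \<eta> * card (P j q)" using jq(4) \<eta> by (intro mult_left_mono) auto
    then have "card Z \<ge> g / B * \<beta> / K * \<delta> * card L" using Z(3) unfolding \<eta>_def by (simp add: mult.assoc)
    then show ?thesis using jq Z by blast
  next
    case False
    define Y2 where "Y2 = Y - (\<Union>(j,q)\<in>N. P j q)"
    have finN: "finite N" unfolding N_def using fin by (auto intro: finite_subset[of _ "J \<times> Q"])
    have cN: "card N \<le> card J * card Q"
      unfolding N_def card_cartesian_product[symmetric] using fin by (intro card_mono) auto
    have sm: "card (P j q) \<le> card Y / K" if "(j,q) \<in> N" for j q using False that by force
    have "card (\<Union>(j,q)\<in>N. P j q) \<le> (\<Sum>(j,q)\<in>N. card (P j q))"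
      using card_UN_le[OF finN, of "\<lambda>(j,q). P j q"] by (simp add: case_prod_unfold)
    then have "real (card (\<Union>(j,q)\<in>N. P j q)) \<le> (\<Sum>(j,q)\<in>N. real (card (P j q)))"
      by (simp add: case_prod_unfold flip: of_nat_sum)
    also have "\<dots> \<le> (\<Sum>(j,q)\<in>N. card Y / K)" using sm by (intro sum_mono) auto
    also have "\<dots> = card N * (card Y / K)" by (simp add: case_prod_unfold)
    also have "\<dots> \<le> (K / 2) * (card Y / K)"
    proof (intro mult_right_mono)
      have "real (card N) \<le> real (card J * card Q)" using cN by (simp only: of_nat_le_iff)
      then show "real (card N) \<le> K / 2" unfolding K by simp
    qed (use Kpos in simp)
    also have "\<dots> = card Y / 2" using Kpos by simp
    finally have un: "card (\<Union>(j,q)\<in>N. P j q) \<le> card Y / 2" .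
    have "real (card Y2) \<ge> card Y - card (\<Union>(j,q)\<in>N. P j q)"
    proof -
      have "card Y \<le> card Y2 + card (\<Union>(j,q)\<in>N. P j q)"
        using card_Un_le[of Y2 "\<Union>(j,q)\<in>N. P j q"] fin(1) finN card_mono[of "Y2 \<union> (\<Union>(j,q)\<in>N. P j q)" Y]
        unfolding Y2_def P_def by fastforce
      then show ?thesis by linarith
    qed
    then have Y2: "card Y2 \<ge> card Y / 2" using un by linarith
    have Y2s: "Y2 \<subseteq> Y" "finite Y2" unfolding Y2_def using fin by auto
    obtain Z where Z: "Z \<subseteq> Y2" "card Z \<ge> card Y2 - g * \<delta> * card J * card L"
       "\<forall>j\<in>J. \<forall>y\<in>Z. card {y'\<in>Z. \<sigma> j y' = \<sigma> j y} \<ge> g * \<delta>"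
      using min_degree_subfamily[OF Y2s(2) fin(2) fin(3), of "g * \<delta>" \<sigma>] gpos assms(8) L Y2s by auto
    \<comment> \<open>Pruning costs a quarter of \<open>\<beta> * \<delta> * card L\<close>, while
      the deletions left at least half of it.\<close>
    have "g * card J = \<beta> / 4" using g cJ by simp
    then have "g * \<delta> * card J * card L = \<beta> * \<delta> * card L / 4"
      by (metis (no_types, opaque_lifting) mult.assoc mult.commute times_divide_eq_left)
    then have "card Z \<ge> \<beta> * \<delta> * card L / 4" using Z(2) Y2 big by linarith
    moreover have "g \<le> \<beta> / 4" unfolding g using cJ assms(7) by (simp add: field_simps)
    then have "g * (\<delta> * card L) \<le> \<beta> / 4 * (\<delta> * card L)" using assms(8) by (intro mult_right_mono) auto
    ultimately have c1: "card Z \<ge> g * \<delta> * card L" by (simp add: mult.assoc)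
    have c2: "det_by (\<sigma> j) (V q) Z \<or> spread_by (g / B * \<delta>) (\<sigma> j) (V q) Z" if jq: "j \<in> J" "q \<in> Q" for j q
    proof (cases "det_by (\<sigma> j) (V q) Y")
      case True
      then show ?thesis using det_by_mono Z(1) Y2s(1) by (metis order_trans)
    next
      case False
      then have inN: "(j,q) \<in> N" using jq N_def by simp
      have "spread_by (\<eta> * \<delta>) (\<sigma> j) (V q) Y2"
        unfolding spread_by_def
      proof (intro ballI allI)
        fix y v assume y: "y \<in> Y2"
        show "card {y'\<in>Y2. \<sigma> j y' = \<sigma> j y \<and> V q y' = v} \<le> \<eta> * \<delta>"
        proof (cases "{y'\<in>Y2. \<sigma> j y' = \<sigma> j y \<and> V q y' = v} = {}")
          case True then show ?thesis using \<eta> assms(8) by (simp only: True) simp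
        next
          case False
          \<comment> \<open>Popularity depends on the class alone, so one surviving member shows
            that its whole class was unpopular already in \<open>Y\<close>.\<close>
          then obtain y0 where y0: "y0 \<in> Y2" "\<sigma> j y0 = \<sigma> j y" "V q y0 = v" by auto
          then have "y0 \<notin> P j q" unfolding Y2_def using inN by auto
          then have "card {y'\<in>Y. \<sigma> j y' = \<sigma> j y0 \<and> V q y' = V q y0} \<le> \<eta> * \<delta>"
            using y0(1) Y2s(1) unfolding P_def by auto
          moreover have "card {y'\<in>Y2. \<sigma> j y' = \<sigma> j y \<and> V q y' = v} \<le>
              card {y'\<in>Y. \<sigma> j y' = \<sigma> j y0 \<and> V q y' = V q y0}"
            using y0 Y2s fin(1) by (intro card_mono) auto
          ultimately show ?thesis by linarith
        qed
      qed
      then show ?thesis using spread_by_mono[OF _ Z(1) Y2s(2)] \<eta>_def by auto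
    qed
    show ?thesis using Z Y2s(1) c1 c2 by (intro disjI2 exI[of _ Z]) auto
  qed
qed

text \<open>Iterate \<open>canonical_step\<close>. Each outcome of the first kind lowers the number
  of undetermined pairs, so the second kind is reached after at most \<open>card J * card Q\<close>
  rounds, and the density lost per round depends on the current density, \<open>J\<close>,
  \<open>Q\<close> and \<open>B\<close> only. Hence \<open>\<beta>'\<close> is uniform in the
  family. The actual \<open>g\<close> is returned because the degree bound and the spread bound must
  keep the exact ratio \<open>B\<close>.\<close>

lemma canonical_subfamily:
  fixes J :: "'j set" and Q :: "'q set" and B \<beta> :: real
  assumes fin: "finite J" "finite Q" and J: "J \<noteq> {}" and "B > 0" "\<beta> > 0"
  shows "\<exists>\<beta>'>0. \<forall>(\<sigma> :: 'j \<Rightarrow> 'y \<Rightarrow> 'u) (V :: 'q \<Rightarrow> 'y \<Rightarrow> 'v) Y L \<delta>.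
     finite Y \<longrightarrow> finite L \<longrightarrow> \<delta> \<ge> 0 \<longrightarrow> (\<forall>j\<in>J. \<forall>y\<in>Y. \<sigma> j y \<in> L) \<longrightarrow>
     (\<forall>j\<in>J. \<forall>u\<in>L. real (card {y\<in>Y. \<sigma> j y = u}) \<le> \<delta>) \<longrightarrow>
     real (card Y) \<ge> \<beta> * \<delta> * real (card L) \<longrightarrow>
     (\<exists>Z\<subseteq>Y. \<exists>g\<ge>\<beta>'. real (card Z) \<ge> g * \<delta> * real (card L) \<and>
       (\<forall>j\<in>J. \<forall>y\<in>Z. real (card {y'\<in>Z. \<sigma> j y' = \<sigma> j y}) \<ge> g * \<delta>) \<and>
       (\<forall>j\<in>J. \<forall>q\<in>Q. det_by (\<sigma> j) (V q) Z \<or> spread_by (g / B * \<delta>) (\<sigma> j) (V q) Z))"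
proof -
  define nd where "nd \<sigma> V Y = {(j,q) \<in> J \<times> Q. \<not> det_by (\<sigma> j) (V q) Y}"
    for \<sigma> :: "'j \<Rightarrow> 'y \<Rightarrow> 'u" and V :: "'q \<Rightarrow> 'y \<Rightarrow> 'v" and Y
  define hyp where "hyp b \<sigma> Y L \<delta> \<longleftrightarrow> finite Y \<and> finite L \<and> \<delta> \<ge> 0 \<and> (\<forall>j\<in>J. \<forall>y\<in>Y. \<sigma> j y \<in> L) \<and>
     (\<forall>j\<in>J. \<forall>u\<in>L. real (card {y\<in>Y. \<sigma> j y = u}) \<le> \<delta>) \<and> real (card Y) \<ge> b * \<delta> * real (card L)"
    for \<sigma> :: "'j \<Rightarrow> 'y \<Rightarrow> 'u" and Y L b \<delta>
  define con where "con g \<sigma> V L \<delta> Z \<longleftrightarrow> real (card Z) \<ge> g * \<delta> * real (card L) \<and>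
       (\<forall>j\<in>J. \<forall>y\<in>Z. real (card {y'\<in>Z. \<sigma> j y' = \<sigma> j y}) \<ge> g * \<delta>) \<and>
       (\<forall>j\<in>J. \<forall>q\<in>Q. det_by (\<sigma> j) (V q) Z \<or> spread_by (g / B * \<delta>) (\<sigma> j) (V q) Z)"
    for g and \<sigma> :: "'j \<Rightarrow> 'y \<Rightarrow> 'u" and V :: "'q \<Rightarrow> 'y \<Rightarrow> 'v" and L :: "'u set" and \<delta> Z
  have finnd: "finite (nd \<sigma> V Y)" for \<sigma> V Y
    unfolding nd_def using fin by (auto intro: finite_subset[of _ "J \<times> Q"])
  have cJ: "card J \<ge> 1" using fin J by (simp add: Suc_leI card_gt_0_iff)
  define K where "K = 2 * (card J * card Q + 1)"
  have Kpos: "K > 0" unfolding K_def by simp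
  have step: "(\<exists>j\<in>J. \<exists>q\<in>Q. \<exists>Z\<subseteq>Y. \<not> det_by (\<sigma> j) (V q) Y \<and> det_by (\<sigma> j) (V q) Z \<and>
      hyp (b / (4 * card J) / B * b / K) \<sigma> Z L \<delta>) \<or> (\<exists>Z\<subseteq>Y. con (b / (4 * card J)) \<sigma> V L \<delta> Z)"
    if h: "hyp b \<sigma> Y L \<delta>" and b: "b > 0" for b \<sigma> V Y L \<delta>
  proof -
    have *: "finite Y" "finite L" "\<delta> \<ge> 0" "\<forall>j\<in>J. \<forall>y\<in>Y. \<sigma> j y \<in> L"
        "\<forall>j\<in>J. \<forall>u\<in>L. real (card {y\<in>Y. \<sigma> j y = u}) \<le> \<delta>" "real (card Y) \<ge> b * \<delta> * real (card L)"
      using h unfolding hyp_def by auto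
    consider (A) j q Z where "j \<in> J" "q \<in> Q" "Z \<subseteq> Y" "\<not> det_by (\<sigma> j) (V q) Y" "det_by (\<sigma> j) (V q) Z"
             "card Z \<ge> b / (4 * card J) / B * b / K * \<delta> * card L"
      | (B) "\<exists>Z\<subseteq>Y. con (b / (4 * card J)) \<sigma> V L \<delta> Z"
      using canonical_step[where \<sigma>=\<sigma> and V=V, OF *(1,2) fin J assms(4) b *(3) _ _ *(6) refl K_def] *(4,5)
      unfolding con_def by blast
    then show ?thesis
    proof cases
      case A
      have "real (card {y\<in>Z. \<sigma> j' y = u}) \<le> \<delta>" if "j' \<in> J" "u \<in> L" for j' u
      proof -
        have "card {y\<in>Z. \<sigma> j' y = u} \<le> card {y\<in>Y. \<sigma> j' y = u}"
          using A(3) *(1) by (intro card_mono) auto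
        moreover have "real (card {y\<in>Y. \<sigma> j' y = u}) \<le> \<delta>" using *(5) that by blast
        ultimately show ?thesis by linarith
      qed
      then have "hyp (b / (4 * card J) / B * b / K) \<sigma> Z L \<delta>"
        unfolding hyp_def using *(1-4) A(3,6) finite_subset[OF A(3)] by blast
      then show ?thesis using A by blast
    qed blast
  qed
  \<comment> \<open>The induction is on a bound \<open>N\<close> for the number of undetermined
    pairs, with the density \<open>b\<close> arbitrary, since it drops in every round.\<close>
  have main: "\<exists>b'>0. \<forall>\<sigma> V Y L \<delta>. card (nd \<sigma> V Y) \<le> N \<longrightarrow> hyp b \<sigma> Y L \<delta> \<longrightarrow>
     (\<exists>Z\<subseteq>Y. \<exists>g\<ge>b'. con g \<sigma> V L \<delta> Z)" if "b > 0" for N b using that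
  proof (induction N arbitrary: b)
    case 0
    have "\<exists>Z\<subseteq>Y. \<exists>g'\<ge>b / (4 * card J). con g' \<sigma> V L \<delta> Z"
      if "card (nd \<sigma> V Y) \<le> 0" "hyp b \<sigma> Y L \<delta>" for \<sigma> V Y L \<delta>
    proof -
      have "nd \<sigma> V Y = {}" using that(1) finnd by simp
      then have "\<forall>j\<in>J. \<forall>q\<in>Q. det_by (\<sigma> j) (V q) Y" unfolding nd_def by auto
      then show ?thesis using step[OF that(2) 0, of V] by blast
    qed
    moreover have "b / (4 * card J) > 0" using 0 cJ by simp
    ultimately show ?case by blast
  next
    case (Suc N)
    define b1 where "b1 = b / (4 * card J) / B * b / K"
    have "b1 > 0" unfolding b1_def using Kpos cJ assms(4) Suc.prems by simp
    from Suc.IH[OF this] obtain b2 where b2: "b2 > 0"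
      and IH: "\<And>\<sigma> V Y L \<delta>. card (nd \<sigma> V Y) \<le> N \<Longrightarrow> hyp b1 \<sigma> Y L \<delta> \<Longrightarrow>
        \<exists>Z\<subseteq>Y. \<exists>g\<ge>b2. con g \<sigma> V L \<delta> Z" by blast
    have "\<exists>Z\<subseteq>Y. \<exists>g\<ge>min b2 (b / (4 * card J)). con g \<sigma> V L \<delta> Z"
      if *: "card (nd \<sigma> V Y) \<le> Suc N" "hyp b \<sigma> Y L \<delta>" for \<sigma> V Y L \<delta>
    proof -
      consider (A) j q Z where "j \<in> J" "q \<in> Q" "Z \<subseteq> Y" "\<not> det_by (\<sigma> j) (V q) Y" "det_by (\<sigma> j) (V q) Z"
             "hyp b1 \<sigma> Z L \<delta>"
        | (B) "\<exists>Z\<subseteq>Y. con (b / (4 * card J)) \<sigma> V L \<delta> Z"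
        using step[OF *(2) Suc.prems, of V] unfolding b1_def by blast
      then show ?thesis
      proof cases
        case A
        have "nd \<sigma> V Z \<subset> nd \<sigma> V Y"
          using A det_by_mono[OF _ A(3)] unfolding nd_def by blast
        then have "card (nd \<sigma> V Z) \<le> N" using psubset_card_mono[OF finnd[of \<sigma> V Y], of "nd \<sigma> V Z"] *(1) by linarith
        from IH[OF this A(6)] obtain Z' g' where "Z' \<subseteq> Z" "g' \<ge> b2" "con g' \<sigma> V L \<delta> Z'" by auto
        then show ?thesis using A(3) by (intro exI[of _ Z'] conjI exI[of _ g']) auto
      next
        case B
        then obtain Z where "Z \<subseteq> Y" "con (b / (4 * card J)) \<sigma> V L \<delta> Z" by auto
        then show ?thesis by (intro exI[of _ Z] conjI exI[of _ "b / (4 * card J)"]) auto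
      qed
    qed
    moreover have "min b2 (b / (4 * card J)) > 0" using b2 Suc.prems cJ by simp
    ultimately show ?case by (intro exI[of _ "min b2 (b / (4 * card J))"]) simp
  qed
  obtain b where b: "b > 0" and H: "\<And>\<sigma> V Y L \<delta>. card (nd \<sigma> V Y) \<le> card J * card Q \<Longrightarrow>
      hyp \<beta> \<sigma> Y L \<delta> \<Longrightarrow> \<exists>Z\<subseteq>Y. \<exists>g\<ge>b. con g \<sigma> V L \<delta> Z"
    using main[OF assms(5), of "card J * card Q"] by blast
  have "card (nd \<sigma> V Y) \<le> card J * card Q" for \<sigma> V Y
    unfolding nd_def card_cartesian_product[symmetric] using fin by (intro card_mono) auto
  from H[OF this] have "\<exists>Z\<subseteq>Y. \<exists>g\<ge>b. con g \<sigma> V L \<delta> Z" if "hyp \<beta> \<sigma> Y L \<delta>" for \<sigma> V Y L \<delta>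
    using that .
  then show ?thesis using b unfolding hyp_def con_def by (intro exI[of _ b] conjI allI impI) simp_all
qed

section \<open>Walks, blocks and random labellings\<close>

text \<open>Stars \<open>t\<close> and \<open>Suc t\<close> share the leaf with index
  \<open>Suc t\<close>. Coincidences between attributes of two stars cannot be forbidden outright,
  since determined attributes are passed along the walk; the last condition demands instead that
  each of them is already visible inside the earlier star.\<close>

definition good_walks :: "(nat \<Rightarrow> 'y \<Rightarrow> 'u) \<Rightarrow> ('y \<Rightarrow> 'c) \<Rightarrow> ('q \<Rightarrow> 'y \<Rightarrow> 'v) \<Rightarrow> 'q set \<Rightarrow> 'y set \<Rightarrow> nat \<Rightarrow> 'y list set"
  where "good_walks \<sigma> ctr V Q Z m = {xs. length xs = m \<and> set xs \<subseteq> Z \<and>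
     (\<forall>t. Suc t < m \<longrightarrow> \<sigma> (Suc t) (xs ! t) = \<sigma> (Suc t) (xs ! Suc t)) \<and>
     (\<forall>t<m. \<forall>s<t. ctr (xs ! s) \<noteq> ctr (xs ! t) \<and>
        (\<forall>q\<in>Q. \<forall>q'\<in>Q. V q' (xs ! t) = V q (xs ! s) \<longrightarrow> V q' (xs ! s) = V q (xs ! s)))}"

text \<open>At least \<open>D\<close> candidates share the required leaf with the last star. Each of
  the at most \<open>k\<close> earlier stars forbids one candidate by its centre, in total at most
  \<open>D / 4\<close>. Each triple of a spread attribute, an earlier star and one of its attributes
  forbids at most \<open>D / (4 * k * (card Q)\<close>\<twosuperior>\<open>)\<close> candidates, and
  there are at most \<open>k\<close> times the square of \<open>card Q\<close> such triples. So half
  of the candidates remain.\<close>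

lemma good_walks_extend:
  fixes \<sigma> :: "nat \<Rightarrow> 'y \<Rightarrow> 'u" and V :: "'q \<Rightarrow> 'y \<Rightarrow> 'v" and ctr :: "'y \<Rightarrow> 'c" and D :: real
  assumes fin: "finite Z" "finite Q" and Q: "Q \<noteq> {}"
    and m: "m \<ge> 1" "m \<le> k"
    and deg: "\<And>y. y \<in> Z \<Longrightarrow> card {y'\<in>Z. \<sigma> m y' = \<sigma> m y} \<ge> D"
    and ds: "\<And>q. q \<in> Q \<Longrightarrow> det_by (\<sigma> m) (V q) Z \<or> spread_by (D / (4 * k * (card Q)\<^sup>2)) (\<sigma> m) (V q) Z"
    and inj: "\<And>y y'. y \<in> Z \<Longrightarrow> y' \<in> Z \<Longrightarrow> \<sigma> m y = \<sigma> m y' \<Longrightarrow> ctr y = ctr y' \<Longrightarrow> y = y'"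
    and D: "D \<ge> 4 * k" and xs: "xs \<in> good_walks \<sigma> ctr V Q Z m"
  shows "card {y\<in>Z. xs @ [y] \<in> good_walks \<sigma> ctr V Q Z (Suc m)} \<ge> D / 2"
proof -
  have len: "length xs = m" and sub: "set xs \<subseteq> Z"
    and sh: "\<And>t. Suc t < m \<Longrightarrow> \<sigma> (Suc t) (xs ! t) = \<sigma> (Suc t) (xs ! Suc t)"
    and df: "\<And>t s. t < m \<Longrightarrow> s < t \<Longrightarrow> ctr (xs ! s) \<noteq> ctr (xs ! t)"
    and bk: "\<And>t s q q'. t < m \<Longrightarrow> s < t \<Longrightarrow> q \<in> Q \<Longrightarrow> q' \<in> Q \<Longrightarrow> V q' (xs ! t) = V q (xs ! s) \<Longrightarrow> V q' (xs ! s) = V q (xs ! s)"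
    using xs unfolding good_walks_def by blast+
  define l where "l = xs ! (m - 1)"
  have lZ: "l \<in> Z" using sub len m unfolding l_def by (simp add: subset_iff)
  define cand where "cand = {y\<in>Z. \<sigma> m y = \<sigma> m l}"
  \<comment> \<open>Only attributes in \<open>Qs\<close> have to be steered away from earlier
    values; they are spread by \<open>ds\<close>.\<close>
  define Qs where "Qs = {q\<in>Q. \<not> det_by (\<sigma> m) (V q) Z}"
  define I where "I = Qs \<times> {..<m} \<times> Q"
  define bad1 where "bad1 = (\<Union>s\<in>{..<m}. {y\<in>cand. ctr y = ctr (xs ! s)})"
  define bad2 where "bad2 = (\<Union>(q',s,q)\<in>I. {y\<in>cand. V q' y = V q (xs ! s)})"
  have finc: "finite cand" unfolding cand_def using fin by simp
  have finI: "finite I" unfolding I_def Qs_def using fin by simp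
  have cQ: "card Q \<ge> 1" using fin Q by (simp add: Suc_leI card_gt_0_iff)
  have kpos: "k \<ge> 1" using m by simp
  have "card bad1 \<le> (\<Sum>s<m. card {y\<in>cand. ctr y = ctr (xs ! s)})"
    unfolding bad1_def by (intro card_UN_le) simp
  also have "\<dots> \<le> (\<Sum>s<m. 1)"
  proof (intro sum_mono)
    fix s
    have "\<forall>a\<in>{y\<in>cand. ctr y = ctr (xs ! s)}. \<forall>b\<in>{y\<in>cand. ctr y = ctr (xs ! s)}. a = b"
      unfolding cand_def by (auto intro: inj)
    then show "card {y\<in>cand. ctr y = ctr (xs ! s)} \<le> 1"
      using finc by (simp add: card_le_Suc0_iff_eq)
  qed
  finally have b1: "real (card bad1) \<le> k" using m by simp
  define c where "c = D / (4 * k * (card Q)\<^sup>2)"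
  have Dpos: "D > 0" using D kpos by simp
  have c0: "c \<ge> 0" unfolding c_def using Dpos by simp
  have "card bad2 \<le> (\<Sum>(q',s,q)\<in>I. card {y\<in>cand. V q' y = V q (xs ! s)})"
    unfolding bad2_def using card_UN_le[OF finI, of "\<lambda>(q',s,q). {y\<in>cand. V q' y = V q (xs ! s)}"]
    by (simp add: case_prod_unfold)
  then have "real (card bad2) \<le> (\<Sum>(q',s,q)\<in>I. real (card {y\<in>cand. V q' y = V q (xs ! s)}))"
    by (simp add: case_prod_unfold flip: of_nat_sum)
  also have "\<dots> \<le> (\<Sum>(q',s,q)\<in>I. c)"
  proof (intro sum_mono)
    fix x assume "x \<in> I"
    obtain q' s q where x: "x = (q',s,q)" by (cases x)
    have "q' \<in> Qs" using \<open>x \<in> I\<close> unfolding x I_def by simp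
    then have "spread_by c (\<sigma> m) (V q') Z" using ds unfolding Qs_def c_def by blast
    then have "real (card {y'\<in>Z. \<sigma> m y' = \<sigma> m l \<and> V q' y' = V q (xs ! s)}) \<le> c"
      using lZ unfolding spread_by_def by blast
    moreover have "{y'\<in>Z. \<sigma> m y' = \<sigma> m l \<and> V q' y' = V q (xs ! s)} = {y\<in>cand. V q' y = V q (xs ! s)}"
      unfolding cand_def by auto
    ultimately show "(case x of (q',s,q) \<Rightarrow> real (card {y\<in>cand. V q' y = V q (xs ! s)})) \<le> (case x of (q',s,q) \<Rightarrow> c)"
      unfolding x by simp
  qed
  also have "\<dots> = card I * c" by (simp add: case_prod_unfold)
  also have "\<dots> \<le> (k * (card Q)\<^sup>2) * c"
  proof (intro mult_right_mono c0)
    have "card I = card Qs * (m * card Q)" unfolding I_def by (simp add: card_cartesian_product)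
    also have "\<dots> \<le> card Q * (k * card Q)"
      using m fin unfolding Qs_def by (intro mult_mono card_mono) auto
    finally have "card I \<le> k * (card Q)\<^sup>2" by (simp add: power2_eq_square algebra_simps)
    then show "real (card I) \<le> real (k * (card Q)\<^sup>2)" by (simp only: of_nat_le_iff)
  qed
  also have "\<dots> = D / 4" unfolding c_def using kpos cQ by simp
  finally have b2: "card bad2 \<le> D / 4" .
  have "real (card (cand - bad1 - bad2)) \<ge> card cand - card bad1 - card bad2"
  proof -
    have "cand \<subseteq> (cand - bad1 - bad2) \<union> (bad1 \<union> bad2)" by blast
    moreover have "finite bad1" "finite bad2" unfolding bad1_def bad2_def using finc finI by auto
    ultimately have "card cand \<le> card ((cand - bad1 - bad2) \<union> (bad1 \<union> bad2))"
      using finc by (intro card_mono) auto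
    also have "\<dots> \<le> card (cand - bad1 - bad2) + card (bad1 \<union> bad2)" by (rule card_Un_le)
    also have "\<dots> \<le> card (cand - bad1 - bad2) + (card bad1 + card bad2)"
      by (intro add_left_mono card_Un_le)
    finally show ?thesis by linarith
  qed
  moreover have "card cand \<ge> D" using deg[OF lZ] unfolding cand_def .
  ultimately have big: "card (cand - bad1 - bad2) \<ge> D / 2" using b1 b2 D by linarith
  have "cand - bad1 - bad2 \<subseteq> {y\<in>Z. xs @ [y] \<in> good_walks \<sigma> ctr V Q Z (Suc m)}"
  proof
    fix y assume y: "y \<in> cand - bad1 - bad2"
    then have yZ: "y \<in> Z" and ys: "\<sigma> m y = \<sigma> m l" unfolding cand_def by auto
    have a1: "\<sigma> (Suc t) ((xs @ [y]) ! t) = \<sigma> (Suc t) ((xs @ [y]) ! Suc t)" if "Suc t < Suc m" for t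
    proof (cases "Suc t = m")
      case True
      then show ?thesis using ys len unfolding l_def by (auto simp: nth_append)
    next
      case False
      then show ?thesis using sh[of t] that len by (simp add: nth_append)
    qed
    have a2: "ctr ((xs @ [y]) ! s) \<noteq> ctr ((xs @ [y]) ! t) \<and>
        (\<forall>q\<in>Q. \<forall>q'\<in>Q. V q' ((xs @ [y]) ! t) = V q ((xs @ [y]) ! s) \<longrightarrow> V q' ((xs @ [y]) ! s) = V q ((xs @ [y]) ! s))"
      if "t < Suc m" "s < t" for s t
    proof (cases "t = m")
      case False
      then have "t < m" using that by simp
      then have e: "(xs @ [y]) ! t = xs ! t" "(xs @ [y]) ! s = xs ! s" using that len by (auto simp: nth_append)
      show ?thesis unfolding e using df[OF \<open>t < m\<close> that(2)] bk[OF \<open>t < m\<close> that(2)] by blast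
    next
      case True
      have e: "(xs @ [y]) ! t = y" "(xs @ [y]) ! s = xs ! s" using True that len by (auto simp: nth_append)
      have "ctr (xs ! s) \<noteq> ctr y"
      proof
        assume "ctr (xs ! s) = ctr y"
        then have "y \<in> bad1" unfolding bad1_def using y True that by (auto intro!: bexI[of _ s])
        then show False using y by blast
      qed
      moreover have "V q' (xs ! s) = V q (xs ! s)" if qq: "q \<in> Q" "q' \<in> Q" "V q' y = V q (xs ! s)" for q q'
      proof -
        have "q' \<notin> Qs"
        proof
          assume "q' \<in> Qs"
          then have "(q',s,q) \<in> I" unfolding I_def using qq True \<open>s < t\<close> by simp
          then have "y \<in> bad2" unfolding bad2_def using qq(3) y by blast
          then show False using y by blast
        qed
        \<comment> \<open>A determined attribute has the same value at the last star
          \<open>l\<close>, so the coincidence is one between \<open>l\<close> and star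
          \<open>s\<close>: either \<open>s\<close> is \<open>l\<close> itself, or the walk so far
          already controls it.\<close>
        then have "V q' y = V q' l" using qq ys yZ lZ unfolding Qs_def det_by_def by blast
        then have *: "V q' (xs ! (m - 1)) = V q (xs ! s)" using qq(3) l_def by simp
        show ?thesis
        proof (cases "s = m - 1")
          case True then show ?thesis using * by simp
        next
          case False
          then show ?thesis using bk[OF _ _ qq(1,2) *] \<open>s < t\<close> True m by simp
        qed
      qed
      ultimately show ?thesis unfolding e by blast
    qed
    have "length (xs @ [y]) = Suc m" "set (xs @ [y]) \<subseteq> Z" using len sub yZ by auto
    then have "xs @ [y] \<in> good_walks \<sigma> ctr V Q Z (Suc m)"
      using a1 a2 unfolding good_walks_def mem_Collect_eq by blast
    then show "y \<in> {y\<in>Z. xs @ [y] \<in> good_walks \<sigma> ctr V Q Z (Suc m)}" using yZ by blast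
  qed
  then have "card (cand - bad1 - bad2) \<le> card {y\<in>Z. xs @ [y] \<in> good_walks \<sigma> ctr V Q Z (Suc m)}"
    using fin by (intro card_mono) auto
  then show ?thesis using big by linarith
qed

lemma finite_good_walks: "finite Z \<Longrightarrow> finite (good_walks \<sigma> ctr V Q Z m)"
  by (rule finite_subset[OF _ finite_lists_length_eq[of Z m]]) (auto simp: good_walks_def)

lemma card_good_walks:
  fixes \<sigma> :: "nat \<Rightarrow> 'y \<Rightarrow> 'u" and V :: "'q \<Rightarrow> 'y \<Rightarrow> 'v" and ctr :: "'y \<Rightarrow> 'c" and D :: real
  assumes fin: "finite Z" "finite Q" and Q: "Q \<noteq> {}" and "m < k"
    and deg: "\<And>j y. j < k \<Longrightarrow> y \<in> Z \<Longrightarrow> card {y'\<in>Z. \<sigma> j y' = \<sigma> j y} \<ge> D"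
    and ds: "\<And>j q. j < k \<Longrightarrow> q \<in> Q \<Longrightarrow> det_by (\<sigma> j) (V q) Z \<or> spread_by (D / (4 * k * (card Q)\<^sup>2)) (\<sigma> j) (V q) Z"
    and inj: "\<And>j y y'. j < k \<Longrightarrow> y \<in> Z \<Longrightarrow> y' \<in> Z \<Longrightarrow> \<sigma> j y = \<sigma> j y' \<Longrightarrow> ctr y = ctr y' \<Longrightarrow> y = y'"
    and D: "D \<ge> 4 * k"
  shows "card (good_walks \<sigma> ctr V Q Z (Suc m)) \<ge> card Z * (D / 2) ^ m"
  using \<open>m < k\<close>
proof (induction m)
  case 0
  have "good_walks \<sigma> ctr V Q Z (Suc 0) = (\<lambda>y. [y]) ` Z"
    unfolding good_walks_def by (auto simp: length_Suc_conv)
  then show ?case by (simp add: card_image inj_on_def)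
next
  case (Suc m)
  let ?W = "good_walks \<sigma> ctr V Q Z"
  let ?E = "\<lambda>xs. {y\<in>Z. xs @ [y] \<in> ?W (Suc (Suc m))}"
  have fW: "finite (?W n)" for n by (rule finite_good_walks[OF fin(1)])
  have "(\<lambda>(xs,y). xs @ [y]) ` (SIGMA xs:?W (Suc m). ?E xs) \<subseteq> ?W (Suc (Suc m))" by auto
  then have "card (SIGMA xs:?W (Suc m). ?E xs) \<le> card (?W (Suc (Suc m)))"
    using fW by (intro card_inj_on_le[of "\<lambda>(xs,y). xs @ [y]"]) (auto simp: inj_on_def)
  moreover have "card (SIGMA xs:?W (Suc m). ?E xs) = (\<Sum>xs\<in>?W (Suc m). card (?E xs))"
    using fW fin by (intro card_SigmaI) auto
  moreover have "real (\<Sum>xs\<in>?W (Suc m). card (?E xs)) \<ge> card (?W (Suc m)) * (D / 2)"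
  proof -
    have "(\<Sum>xs\<in>?W (Suc m). D / 2) \<le> (\<Sum>xs\<in>?W (Suc m). real (card (?E xs)))"
    proof (intro sum_mono)
      fix xs assume xs: "xs \<in> ?W (Suc m)"
      show "D / 2 \<le> real (card (?E xs))"
        by (rule good_walks_extend[OF fin Q _ _ _ _ _ D xs]) (use Suc.prems deg ds inj in auto)
    qed
    then show ?thesis by simp
  qed
  ultimately have "card (?W (Suc (Suc m))) \<ge> card (?W (Suc m)) * (D / 2)" by linarith
  moreover have "card (?W (Suc m)) * (D / 2) \<ge> (card Z * (D / 2) ^ m) * (D / 2)"
    using Suc D by (intro mult_right_mono) auto
  ultimately have "card (?W (Suc (Suc m))) \<ge> (card Z * (D / 2) ^ m) * (D / 2)" by linarith
  then show ?case by (simp only: power_Suc ac_simps)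
qed

text \<open>Greedy removal: as long as at least \<open>c\<close> elements remain, another block can
  be split off.\<close>

lemma disjoint_blocks:
  fixes N :: "'a set"
  assumes "finite N" "k \<ge> 1"
    and ex: "\<And>M. M \<subseteq> N \<Longrightarrow> card M \<ge> c \<Longrightarrow> \<exists>us. P us \<and> set us \<subseteq> M \<and> distinct us \<and> length us = k"
  shows "\<exists>F. finite F \<and> (\<forall>us\<in>F. P us \<and> set us \<subseteq> N \<and> distinct us \<and> length us = k) \<and>
     (\<forall>us\<in>F. \<forall>us'\<in>F. us \<noteq> us' \<longrightarrow> set us \<inter> set us' = {}) \<and> card N \<le> k * card F + c"
  using assms(1) ex
proof (induction "card N" arbitrary: N rule: less_induct)
  case less
  show ?case
  proof (cases "card N \<ge> c")
    case False
    then show ?thesis by (intro exI[of _ "{}"]) auto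
  next
    case True
    obtain us where us: "P us" "set us \<subseteq> N" "distinct us" "length us = k"
      using less.prems(2)[OF order_refl True] by blast
    have cus: "card (set us) = k" using us distinct_card by metis
    have cN: "card (N - set us) = card N - k" "k \<le> card N"
      using us less.prems(1) cus by (metis card_Diff_subset finite_set, metis card_mono)
    then have lt: "card (N - set us) < card N" using assms(2) by simp
    have ex': "\<exists>us. P us \<and> set us \<subseteq> M \<and> distinct us \<and> length us = k" if "M \<subseteq> N - set us" "c \<le> card M" for M
      using that by (intro less.prems(2)) auto
    obtain F where F: "finite F"
        "\<forall>us'\<in>F. P us' \<and> set us' \<subseteq> N - set us \<and> distinct us' \<and> length us' = k"
        "\<forall>us\<in>F. \<forall>us'\<in>F. us \<noteq> us' \<longrightarrow> set us \<inter> set us' = {}" "card (N - set us) \<le> k * card F + c"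
      using less.hyps[OF lt finite_Diff[OF less.prems(1)] ex'] by auto
    have "us \<notin> F"
    proof
      assume "us \<in> F"
      then have "set us \<subseteq> N - set us" using F(2) by blast
      then show False using us(4) assms(2) by (cases us) auto
    qed
    then have "card (insert us F) = Suc (card F)" using F(1) by simp
    then have "card N \<le> k * card (insert us F) + c" using F(4) cN by (simp add: algebra_simps)
    moreover have "\<forall>v\<in>insert us F. P v \<and> set v \<subseteq> N \<and> distinct v \<and> length v = k" using us F(2) by blast
    moreover have "\<forall>v\<in>insert us F. \<forall>v'\<in>insert us F. v \<noteq> v' \<longrightarrow> set v \<inter> set v' = {}"
      using F(2,3) by blast
    ultimately show ?thesis using F(1) by (intro exI[of _ "insert us F"]) blast
  qed
qed

section \<open>Balanced random labellings\<close>

lemma exp_half_bound: "exp (- ln 2 * x) = (1/2) powr (x::real)"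
  by (simp add: powr_def ln_div)

text \<open>Chernoff's bound: the weight \<open>(1/2)\<close> to the number of hits of a random function factorises.\<close>

lemma balanced_labelling:
  fixes S :: "'i \<Rightarrow> 'a set" and \<tau> :: "'i \<Rightarrow> nat" and s :: real
  assumes fin: "finite X" "finite I" and k: "k \<ge> 1"
    and S: "\<And>i. i \<in> I \<Longrightarrow> S i \<subseteq> X \<and> real (card (S i)) \<ge> s \<and> \<tau> i \<in> {1..k}"
    and small: "real (card I) < exp ((1 - ln 2) * s / (2 * real k))"
  shows "\<exists>f\<in>X \<rightarrow>\<^sub>E {1..k}. \<forall>i\<in>I. real (card {w\<in>S i. f w = \<tau> i}) \<ge> s / (2 * real k)"
proof (rule ccontr)
  assume neg: "\<not> ?thesis"
  let ?F = "X \<rightarrow>\<^sub>E {1..k}"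
  define h where "h i f = card {w\<in>S i. f w = \<tau> i}" for i f
  have finF: "finite ?F" using fin by (intro finite_PiE) auto
  have cF: "real (card ?F) = k ^ card X" using fin by (simp add: card_PiE)
  have tot: "(\<Sum>f\<in>?F. (1/2::real) ^ h i f) \<le> real k ^ card X * exp (- s / (2 * real k))" if i: "i \<in> I" for i
  proof -
    \<comment> \<open>Each hit costs a factor 1/2, so the weight of \<open>f\<close> is a product
      over the points of \<open>X\<close> and its sum over all \<open>f\<close> factorises; a point
      of \<open>S i\<close> contributes \<open>k - 1/2\<close> instead of \<open>k\<close>.\<close>
    define g where "g w c = (if w \<in> S i \<and> c = \<tau> i then 1/2 else (1::real))" for w c
    have Si: "S i \<subseteq> X" "real (card (S i)) \<ge> s" "\<tau> i \<in> {1..k}" using S[OF i] by auto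
    have "(1/2::real) ^ h i f = (\<Prod>w\<in>X. g w (f w))" for f
    proof -
      have "(\<Prod>w\<in>X. g w (f w)) = (\<Prod>w\<in>{w\<in>S i. f w = \<tau> i}. 1/2)"
        using fin Si(1) unfolding g_def by (intro prod.mono_neutral_cong_right) auto
      then show ?thesis unfolding h_def by simp
    qed
    then have "(\<Sum>f\<in>?F. (1/2::real) ^ h i f) = (\<Sum>f\<in>?F. \<Prod>w\<in>X. g w (f w))" by simp
    also have "\<dots> = (\<Prod>w\<in>X. \<Sum>c\<in>{1..k}. g w c)"
      using fin by (intro prod_sum_PiE[symmetric]) auto
    also have "\<dots> = (\<Prod>w\<in>X. if w \<in> S i then k - 1/2 else real k)"
    proof (intro prod.cong refl)
      fix w
      show "(\<Sum>c\<in>{1..k}. g w c) = (if w \<in> S i then k - 1/2 else real k)"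
      proof (cases "w \<in> S i")
        case True
        then have "(\<Sum>c\<in>{1..k}. g w c) = (\<Sum>c\<in>{1..k}. 1 - (if c = \<tau> i then 1/2 else 0))"
          unfolding g_def by (intro sum.cong) auto
        also have "\<dots> = k - 1/2" using Si(3) by (simp add: sum_subtractf)
        finally show ?thesis using True by simp
      qed (simp add: g_def)
    qed
    also have "\<dots> = (\<Prod>w\<in>X. real k * (if w \<in> S i then 1 - 1 / (2 * real k) else 1))"
      using k by (intro prod.cong refl) (auto simp: field_simps)
    also have "\<dots> = real k ^ card X * (\<Prod>w\<in>X. if w \<in> S i then 1 - 1 / (2 * real k) else 1)"
      by (simp add: prod.distrib)
    also have "(\<Prod>w\<in>X. if w \<in> S i then 1 - 1 / (2 * real k) else 1) = (1 - 1 / (2 * real k)) ^ card (S i)"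
    proof -
      have "(\<Prod>w\<in>X. if w \<in> S i then 1 - 1 / (2 * real k) else 1) = (\<Prod>w\<in>S i. 1 - 1 / (2 * real k))"
        using fin Si(1) by (intro prod.mono_neutral_cong_right) auto
      then show ?thesis by simp
    qed
    finally have A: "(\<Sum>f\<in>?F. (1/2::real) ^ h i f) = real k ^ card X * (1 - 1 / (2 * real k)) ^ card (S i)" .
    have "(1 - 1 / (2 * real k)) ^ card (S i) \<le> exp (- 1 / (2 * real k)) ^ card (S i)"
      using k exp_ge_add_one_self[of "- 1 / (2 * real k)"] by (intro power_mono) (auto simp: field_simps)
    also have "\<dots> = exp (- real (card (S i)) / (2 * real k))"
      by (simp add: exp_of_nat_mult[symmetric])
    also have "\<dots> \<le> exp (- s / (2 * real k))" using Si(2) k by (simp add: divide_right_mono)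
    finally show ?thesis unfolding A by (intro mult_left_mono) auto
  qed
  \<comment> \<open>By assumption every \<open>f\<close> fails for some \<open>i\<close>, and then
    has few hits and hence a large weight there. Summed over all \<open>f\<close> this contradicts
    \<open>tot\<close>, since \<open>small\<close> compares \<open>card I\<close> with exactly the
    quotient of the two exponentials.\<close>
  have "(1/2::real) powr (s / (2 * real k)) \<le> (\<Sum>i\<in>I. (1/2) ^ h i f)" if f: "f \<in> ?F" for f
  proof -
    obtain i where i: "i \<in> I" "real (h i f) < s / (2 * real k)" using neg f unfolding h_def by force
    have "(1/2::real) powr (s / (2 * real k)) \<le> (1/2) powr real (h i f)" using i by (intro powr_mono') auto
    also have "\<dots> = (1/2) ^ h i f" by (simp add: powr_realpow)
    also have "\<dots> \<le> (\<Sum>i\<in>I. (1/2) ^ h i f)" using i fin by (intro member_le_sum) auto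
    finally show ?thesis .
  qed
  then have "(\<Sum>f\<in>?F. (1/2::real) powr (s / (2 * real k))) \<le> (\<Sum>f\<in>?F. \<Sum>i\<in>I. (1/2) ^ h i f)"
    by (intro sum_mono) auto
  also have "\<dots> = (\<Sum>i\<in>I. \<Sum>f\<in>?F. (1/2) ^ h i f)" by (rule sum.swap)
  also have "\<dots> \<le> (\<Sum>i\<in>I. real k ^ card X * exp (- s / (2 * real k)))" using tot by (intro sum_mono) auto
  finally have "real k ^ card X * (1/2::real) powr (s / (2 * real k)) \<le> card I * (real k ^ card X * exp (- s / (2 * real k)))"
    using cF by simp
  then have "(1/2::real) powr (s / (2 * real k)) \<le> card I * exp (- s / (2 * real k))"
    using k by (simp add: mult.left_commute)
  also have "\<dots> < exp ((1 - ln 2) * s / (2 * real k)) * exp (- s / (2 * real k))"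
    using small by (intro mult_strict_right_mono) auto
  also have "\<dots> = (1/2) powr (s / (2 * real k))"
    by (simp add: exp_add[symmetric] exp_half_bound[symmetric] algebra_simps diff_divide_distrib)
  finally show False by simp
qed

section \<open>Recognising linear cycles\<close>

text \<open>A cyclic sequence of \<open>r\<close>-sets is a linear cycle once sets adjacent in the
  cyclic order meet in their joint and all other pairs are disjoint; \<open>jn a\<close> is the
  joint of \<open>e a\<close> with its predecessor. That joints are distinct and every edge has
  exactly \<open>r - 2\<close> further vertices follows.\<close>

lemma linear_cycle_isoI:
  fixes e :: "nat \<Rightarrow> 'a set" and jn :: "nat \<Rightarrow> 'a"
  assumes M: "M \<ge> 4" and r: "r \<ge> 2"
    and card_e: "\<And>a. a < M \<Longrightarrow> card (e a) = r"
    and jn: "\<And>a. a < M \<Longrightarrow> jn a \<in> e a \<and> jn (Suc a mod M) \<in> e a"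
    and meet: "\<And>a b v. a < b \<Longrightarrow> b < M \<Longrightarrow> v \<in> e a \<Longrightarrow> v \<in> e b \<Longrightarrow>
       (b = Suc a \<and> v = jn b) \<or> (a = 0 \<and> b = M - 1 \<and> v = jn 0)"
  shows "hypergraph_iso (linear_cycle r M) (\<Union> (e ` {..<M}), e ` {..<M})"
proof -
  define nxt where "nxt a = Suc a mod M" for a
  have nxtM: "nxt a < M" for a unfolding nxt_def using M by simp
  have jn1: "jn a \<in> e a" and jn2: "jn (nxt a) \<in> e a" if "a < M" for a
    using jn[OF that] unfolding nxt_def by auto
  \<comment> \<open>A joint also lies in the edge before it. Two equal joints would give a vertex
    common to two edges that are not adjacent in the cyclic order, because \<open>M\<close> is at
    least 4.\<close>
  have J1: "jn a \<noteq> jn b" if ab: "a < b" "b < M" for a b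
  proof
    assume eq: "jn a = jn b"
    have "jn a \<in> e a" "jn a \<in> e b" using jn1[of a] jn1[of b] ab eq by auto
    from meet[OF ab this] consider "b = Suc a" | "a = 0" "b = M - 1" by auto
    then show False
    proof cases
      case 1
      show False
      proof (cases a)
        case 0
        then have "jn a \<in> e (M - 1)" using jn2[of "M - 1"] M unfolding nxt_def by simp
        moreover have "jn a \<in> e 1" using jn1[of b] ab eq 0 1 by simp
        ultimately have "M - 1 = Suc 1 \<or> (1::nat) = 0" using meet[of 1 "M - 1" "jn a"] M by fastforce
        then show False using M by linarith
      next
        case (Suc a')
        then have "jn a \<in> e a'" using jn2[of a'] ab unfolding nxt_def by simp
        moreover have "jn a \<in> e b" using jn1[of b] ab eq by simp
        ultimately have "b = Suc a' \<or> (a' = 0 \<and> b = M - 1)" using meet[of a' b "jn a"] Suc 1 ab by fastforce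
        then show False using M Suc 1 by linarith
      qed
    next
      case 2
      have s: "Suc (M - 2) mod M = M - 1" using M by (simp add: Suc_diff_Suc numeral_2_eq_2)
      then have "jn b \<in> e (M - 2)" using jn2[of "M - 2"] M 2 unfolding nxt_def by simp
      moreover have "jn b \<in> e 0" using jn1[of a] ab eq 2 by simp
      ultimately have "M - 2 = Suc 0 \<or> M - 2 = M - 1" using meet[of 0 "M - 2" "jn b"] M by fastforce
      then show False using M by linarith
    qed
  qed
  have J1': "jn a \<noteq> jn b" if "a \<noteq> b" "a < M" "b < M" for a b
    using J1[of a b] J1[of b a] that by (metis nat_neq_iff)
  \<comment> \<open>The vertices of \<open>e a\<close> that lie in no other edge; they become the
    images of the enlarging vertices \<open>(a, j)\<close> with \<open>j\<close> at least 1.\<close>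
  define priv where "priv a = e a - {jn a, jn (nxt a)}" for a
  have J2: "v \<notin> e b" if v: "v \<in> priv a" and ab: "a < M" "b < M" "a \<noteq> b" for a b v
  proof
    assume vb: "v \<in> e b"
    have va: "v \<in> e a" "v \<noteq> jn a" "v \<noteq> jn (nxt a)" using v unfolding priv_def by auto
    show False
    proof (cases "a < b")
      case True
      from meet[OF this ab(2) va(1) vb] show False using va True ab unfolding nxt_def by auto
    next
      case False
      then have "b < a" using ab by simp
      from meet[OF this ab(1) vb va(1)] show False using va ab M unfolding nxt_def by auto
    qed
  qed
  have nx: "nxt a \<noteq> a" if "a < M" for a
  proof (cases "Suc a = M")
    case True then show ?thesis using M unfolding nxt_def by auto
  next
    case False then show ?thesis using that unfolding nxt_def by simp
  qed
  have fin: "finite (e a)" if "a < M" for a using card_e[OF that] r by (metis card.infinite not_numeral_le_zero)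
  have cp: "card (priv a) = r - 2" if "a < M" for a
  proof -
    have "card {jn a, jn (nxt a)} = 2" using J1'[OF nx[OF that] nxtM that] by simp
    then show ?thesis unfolding priv_def using jn1[OF that] jn2[OF that] card_e[OF that]
      by (subst card_Diff_subset) auto
  qed
  have "\<exists>\<phi>. bij_betw \<phi> {1..r-2} (priv a)" if "a < M" for a
    using ex_bij_betw_nat_finite_1[of "priv a"] cp[OF that] fin[OF that] unfolding priv_def by auto
  then obtain \<phi> where \<phi>: "\<And>a. a < M \<Longrightarrow> bij_betw (\<phi> a) {1..r-2} (priv a)" by metis
  define f where "f = (\<lambda>(a,j). if j = 0 then jn a else \<phi> a j)"
  have f0: "f (a,0) = jn a" for a unfolding f_def by simp
  have fp: "f (a,j) \<in> priv a" if "a < M" "j \<in> {1..r-2}" for a j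
    using bij_betwE[OF \<phi>[OF that(1)]] that(2) unfolding f_def by auto
  have fim: "f ` ({a} \<times> {1..r-2}) = priv a" if "a < M" for a
  proof -
    have "f ` ({a} \<times> {1..r-2}) = (\<lambda>j. f (a,j)) ` {1..r-2}" by auto
    also have "\<dots> = \<phi> a ` {1..r-2}" unfolding f_def by (intro image_cong) auto
    finally have "f ` ({a} \<times> {1..r-2}) = \<phi> a ` {1..r-2}" .
    then show ?thesis using \<phi>[OF that] unfolding bij_betw_def by simp
  qed
  have edge: "f ` ({(a, 0), (Suc a mod M, 0)} \<union> {a} \<times> {1..r - 2}) = e a" if "a < M" for a
    unfolding image_Un fim[OF that] using jn1[OF that] jn2[OF that] 
    by (auto simp: f0 priv_def nxt_def)
  have inj: "inj_on f ({..<M} \<times> {0..r-2})"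
  proof (rule inj_onI, clarify)
    fix a j b l assume *: "a < M" "b < M" "j \<in> {0..r-2}" "l \<in> {0..r-2}" "f (a,j) = f (b,l)"
    have npriv: "jn a \<notin> priv b" if "a < M" "b < M" for a b
      using J2[of "jn a" b a] jn1[OF that(1)] that unfolding priv_def by blast
    consider "j = 0" "l = 0" | "j = 0" "l \<in> {1..r-2}" | "j \<in> {1..r-2}" "l = 0" | "j \<in> {1..r-2}" "l \<in> {1..r-2}"
      using * by fastforce
    then show "a = b \<and> j = l"
    proof cases
      case 1 then show ?thesis using * J1'[of a b] f0 by metis
    next
      case 2 then show ?thesis using * npriv[of a b] fp[of b l] f0 by metis
    next
      case 3 then show ?thesis using * npriv[of b a] fp[of a j] f0 by metis
    next
      case 4
      have "a = b"
      proof (rule ccontr)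
        assume "a \<noteq> b"
        then show False using J2[OF fp[OF *(1) 4(1)] *(1,2)] fp[OF *(2) 4(2)] *(5) unfolding priv_def by auto
      qed
      then have "\<phi> a j = \<phi> a l" using *(5) 4 unfolding f_def by simp
      then show ?thesis using \<phi>[OF *(1)] 4 \<open>a = b\<close> unfolding bij_betw_def inj_on_def by blast
    qed
  qed
  have "f ` ({..<M} \<times> {0..r-2}) = \<Union> (e ` {..<M})"
  proof
    show "f ` ({..<M} \<times> {0..r-2}) \<subseteq> \<Union> (e ` {..<M})"
    proof (rule image_subsetI)
      fix x assume x: "x \<in> {..<M} \<times> {0..r-2}"
      obtain a j where xaj: "x = (a,j)" by (cases x)
      have "f (a,j) \<in> e a" using x jn1[of a] fp[of a j] f0[of a] unfolding priv_def xaj by (cases "j = 0") auto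
      then show "f x \<in> \<Union> (e ` {..<M})" using x unfolding xaj by blast
    qed
    show "\<Union> (e ` {..<M}) \<subseteq> f ` ({..<M} \<times> {0..r-2})"
    proof (rule UN_least)
      fix a assume a: "a \<in> {..<M}"
      have "e a = f ` ({(a, 0), (nxt a, 0)} \<union> {a} \<times> {1..r - 2})" using edge[of a] a nxt_def by simp
      moreover have "{(a, 0), (nxt a, 0)} \<union> {a} \<times> {1..r - 2} \<subseteq> {..<M} \<times> {0..r-2}" using a nxtM by auto
      ultimately show "e a \<subseteq> f ` ({..<M} \<times> {0..r-2})" by blast
    qed
  qed
  then have bij: "bij_betw f ({..<M} \<times> {0..r-2}) (\<Union> (e ` {..<M}))" using inj unfolding bij_betw_def by simp
  have "e ` {..<M} = (\<lambda>E. f ` E) ` (\<lambda>i. {(i, 0), (Suc i mod M, 0)} \<union> {i} \<times> {1..r - 2}) ` {..<M}"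
    unfolding image_image using edge by (intro image_cong refl) simp
  then show ?thesis unfolding hypergraph_iso_def linear_cycle_def using bij by (intro exI[of _ f]) simp
qed

section \<open>Levels below a root\<close>

locale linear_partite =
  fixes G :: "'a hypergraph" and A :: "nat \<Rightarrow> 'a set" and r :: nat
  assumes r2: "r \<ge> 2" and unif: "uniform_hypergraph r G" and lin: "linear_hypergraph G"
    and part: "r_partition r G A"
begin

definition U :: "'a set" where "U = A 1 \<union> A 2"

lemma finite_verts: "finite (verts G)"
  using unif unfolding uniform_hypergraph_def by simp

lemma edge_facts:
  assumes "e \<in> edges G"
  shows "card e = r" "finite e" "e \<subseteq> verts G"
  using assms unif r2 unfolding uniform_hypergraph_def by (auto intro: finite_subset)

lemma U_sub: "U \<subseteq> verts G"
  using part r2 unfolding r_partition_def U_def by auto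

lemma finite_U: "finite U"
  using U_sub finite_verts finite_subset by blast

lemma finite_edges: "finite (edges G)"
  using edge_facts(3) finite_verts by (auto intro: finite_subset[of _ "Pow (verts G)"])

lemma edge_eqI:
  assumes "e \<in> edges G" "f \<in> edges G" "v \<in> e" "v \<in> f" "w \<in> e" "w \<in> f" "v \<noteq> w"
  shows "e = f"
proof (rule ccontr)
  assume "e \<noteq> f"
  then have "card (e \<inter> f) \<le> 1" using lin assms unfolding linear_hypergraph_def by blast
  moreover have "card {v, w} \<le> card (e \<inter> f)" using assms edge_facts(2)[of e] by (intro card_mono) auto
  ultimately show False using assms by simp
qed

definition vert :: "nat \<Rightarrow> 'a set \<Rightarrow> 'a" where "vert p e = (THE v. v \<in> e \<inter> A p)"

lemma vert_eq:
  assumes "e \<in> edges G" "p \<in> {1..r}"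
  shows "e \<inter> A p = {vert p e}"
proof -
  have "card (e \<inter> A p) = 1" using part assms unfolding r_partition_def by blast
  then obtain v where v: "e \<inter> A p = {v}" using card_1_singletonE by blast
  then have "vert p e = v" unfolding vert_def by simp
  then show ?thesis using v by simp
qed

lemma vert_in: "e \<in> edges G \<Longrightarrow> p \<in> {1..r} \<Longrightarrow> vert p e \<in> e"
  using vert_eq by blast

lemma vert_unique: "e \<in> edges G \<Longrightarrow> p \<in> {1..r} \<Longrightarrow> v \<in> e \<Longrightarrow> v \<in> A p \<Longrightarrow> vert p e = v"
  by (metis IntI singletonD vert_eq)

lemma part_ex: "e \<in> edges G \<Longrightarrow> v \<in> e \<Longrightarrow> \<exists>p\<in>{1..r}. v \<in> A p"
  using part edge_facts(3) unfolding r_partition_def by blast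

text \<open>Each edge has one vertex in \<open>A 1\<close> and one in \<open>A 2\<close>. The traces
  of the edges on \<open>U\<close> thus form a bipartite graph, in which \<open>other u e\<close> is
  the neighbour of \<open>u\<close> along \<open>e\<close>; linearity makes it simple
  (\<open>other_inj\<close>).\<close>

lemma edge_U:
  assumes "e \<in> edges G" "u \<in> e" "u \<in> U"
  shows "\<exists>v. v \<noteq> u \<and> e \<inter> U = {u, v}"
proof -
  have p: "1 \<in> {1..r}" "2 \<in> {1..r}" using r2 by auto
  have "A 1 \<inter> A 2 = {}"
    using part p unfolding r_partition_def disjoint_family_on_def by (metis numeral_eq_one_iff semiring_norm(85))
  moreover have "e \<inter> U = {vert 1 e, vert 2 e}"
    using vert_eq[OF assms(1) p(1)] vert_eq[OF assms(1) p(2)] unfolding U_def by blast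
  moreover have "vert 1 e \<in> A 1" "vert 2 e \<in> A 2"
    using vert_eq[OF assms(1) p(1)] vert_eq[OF assms(1) p(2)] by blast+
  ultimately have "vert 1 e \<noteq> vert 2 e" "e \<inter> U = {vert 1 e, vert 2 e}" by auto
  moreover from this have "u = vert 1 e \<or> u = vert 2 e" using assms by blast
  ultimately show ?thesis by (elim disjE) (auto intro: exI[of _ "vert 1 e"] exI[of _ "vert 2 e"])
qed

definition other :: "'a \<Rightarrow> 'a set \<Rightarrow> 'a" where "other u e = (THE v. v \<in> e \<inter> U \<and> v \<noteq> u)"

lemma other:
  assumes "e \<in> edges G" "u \<in> e" "u \<in> U"
  shows "other u e \<noteq> u" "e \<inter> U = {u, other u e}"
proof -
  obtain v where v: "v \<noteq> u" "e \<inter> U = {u, v}" using edge_U[OF assms] by blast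
  have "other u e = v" unfolding other_def using v by (intro the_equality) auto
  then show "other u e \<noteq> u" "e \<inter> U = {u, other u e}" using v by auto
qed

lemma edge_U_pair:
  assumes "e \<in> edges G" "u \<in> e" "u \<in> U" "v \<in> e" "v \<in> U" "u \<noteq> v"
  shows "e \<inter> U = {u, v}"
  using other[OF assms(1-3)] assms by auto

lemma other_inj:
  assumes "u \<in> U" "\<And>e. e \<in> E \<Longrightarrow> e \<in> edges G \<and> u \<in> e"
  shows "inj_on (other u) E"
proof (rule inj_onI)
  fix e f assume *: "e \<in> E" "f \<in> E" "other u e = other u f"
  have e: "e \<in> edges G" "u \<in> e" and f: "f \<in> edges G" "u \<in> f" using assms(2) * by auto
  show "e = f"
    using edge_eqI[OF e(1) f(1), of u "other u e"] other[OF e assms(1)] other[OF f assms(1)] e f *(3) by auto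
qed

text \<open>End points of walks of length \<open>g\<close> in the trace graph. They bound the number
  of roots from which a given copy can have been found.\<close>

primrec reach :: "nat \<Rightarrow> 'a \<Rightarrow> 'a set" where
  "reach 0 v = {v}"
| "reach (Suc g) v = (\<Union>w\<in>other v ` {e\<in>edges G. v \<in> e}. reach g w)"

lemma card_reach:
  assumes "v \<in> U" and deg: "\<And>v. v \<in> U \<Longrightarrow> real (card {e\<in>edges G. v \<in> e}) \<le> \<Delta>"
  shows "finite (reach g v) \<and> real (card (reach g v)) \<le> \<Delta> ^ g"
  using assms(1)
proof (induction g arbitrary: v)
  case 0 then show ?case by simp
next
  case (Suc g)
  let ?E = "{e\<in>edges G. v \<in> e}" and ?W = "other v ` {e\<in>edges G. v \<in> e}"
  have fE: "finite ?E" using finite_edges by simp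
  have W: "?W \<subseteq> U"
  proof (rule image_subsetI)
    fix e assume "e \<in> ?E"
    then have "e \<inter> U = {v, other v e}" using other(2)[of e v] Suc.prems by simp
    then show "other v e \<in> U" by blast
  qed
  have \<Delta>0: "\<Delta> \<ge> 0" using deg[OF Suc.prems] by (meson of_nat_0_le_iff order_trans)
  have fin: "finite (reach (Suc g) v)" using Suc.IH W fE by auto
  have "card (reach (Suc g) v) \<le> (\<Sum>w\<in>?W. card (reach g w))"
    unfolding reach.simps using fE by (intro card_UN_le) simp
  then have "real (card (reach (Suc g) v)) \<le> (\<Sum>w\<in>?W. real (card (reach g w)))" by (simp flip: of_nat_sum)
  also have "\<dots> \<le> (\<Sum>w\<in>?W. \<Delta> ^ g)" using Suc.IH W by (intro sum_mono) auto
  also have "\<dots> = card ?W * \<Delta> ^ g" by simp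
  also have "\<dots> \<le> \<Delta> * \<Delta> ^ g"
  proof (intro mult_right_mono)
    have "card ?W \<le> card ?E" using fE by (rule card_image_le)
    then show "real (card ?W) \<le> \<Delta>" using deg[OF Suc.prems] by linarith
  qed (use \<Delta>0 in simp)
  finally show ?case using fin by simp
qed

text \<open>Deleting and inserting \<open>v\<close> are mutually inverse: a set of size
  \<open>r - 1\<close> that contains \<open>v\<close> would itself be the edge, of the wrong
  size.\<close>

lemma card_link:
  "card (link r G v) = card {e\<in>edges G. v \<in> e}"
proof -
  have "bij_betw (\<lambda>e. e - {v}) {e\<in>edges G. v \<in> e} (link r G v)"
  proof (rule bij_betwI[where g = "\<lambda>I. insert v I"])
    show "(\<lambda>e. e - {v}) \<in> {e\<in>edges G. v \<in> e} \<rightarrow> link r G v"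
      using edge_facts unfolding link_def by (auto simp: insert_absorb)
    show "insert v \<in> link r G v \<rightarrow> {e\<in>edges G. v \<in> e}" unfolding link_def by auto
    show "insert v (e - {v}) = e" if "e \<in> {e\<in>edges G. v \<in> e}" for e using that by auto
    show "insert v I - {v} = I" if I: "I \<in> link r G v" for I
    proof -
      have "insert v I \<in> edges G" using I unfolding link_def by simp
      then have "card I = r - 1" "card (insert v I) = r"
        using I edge_facts(1) unfolding link_def by auto
      then have "v \<notin> I" using r2 by (auto simp: insert_absorb)
      then show ?thesis by simp
    qed
  qed
  then show ?thesis by (simp add: bij_betw_same_card)
qed

end

section \<open>Growing levels from a root\<close>

text \<open>\<open>S t u\<close> is a choice of exactly \<open>\<delta>\<close> edges at
  \<open>u\<close>, used to step from level \<open>t - 1\<close> to level \<open>t\<close>. All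
  their vertices except \<open>u\<close> have label \<open>t\<close>, so edges belonging to
  different steps can meet only at their lower end points. The label 0 is reserved for the
  root.\<close>

locale rooted = linear_partite G A r
  for G :: "'a hypergraph" and A :: "nat \<Rightarrow> 'a set" and r :: nat +
  fixes k :: nat and x :: 'a and lev :: "'a \<Rightarrow> nat" and S :: "nat \<Rightarrow> 'a \<Rightarrow> 'a set set" and \<delta> :: nat
  assumes k2: "k \<ge> 2" and xU: "x \<in> U" and lev_x: "lev x = 0"
    and S_sub: "\<And>t u. t \<in> {1..k} \<Longrightarrow> u \<in> U \<Longrightarrow> S t u \<subseteq> {e\<in>edges G. u \<in> e \<and> (\<forall>v\<in>e-{u}. lev v = t)}"
    and S_card: "\<And>t u. t \<in> {1..k} \<Longrightarrow> u \<in> U \<Longrightarrow> card (S t u) = \<delta>"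
begin

primrec L :: "nat \<Rightarrow> 'a set" where
  "L 0 = {x}"
| "L (Suc t) = {y\<in>U. \<exists>u\<in>L t. \<exists>e\<in>S (Suc t) u. y \<in> e \<and> y \<noteq> u}"

lemma L_U: "L t \<subseteq> U"
  using xU by (cases t) auto

lemma finite_L: "finite (L t)"
  using L_U finite_U finite_subset by blast

lemma S_edge:
  assumes "t < k" "u \<in> U" "e \<in> S (Suc t) u"
  shows "e \<in> edges G" "u \<in> e" "v \<in> e \<Longrightarrow> v \<noteq> u \<Longrightarrow> lev v = Suc t"
  using S_sub[of "Suc t" u] assms by auto

lemma L_lev: "t \<le> k \<Longrightarrow> y \<in> L t \<Longrightarrow> lev y = t"
proof (cases t)
  case (Suc t')
  assume *: "t \<le> k" "y \<in> L t"
  then obtain u e where "u \<in> L t'" "e \<in> S (Suc t') u" "y \<in> e" "y \<noteq> u" using Suc by auto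
  then show ?thesis using S_edge(3)[of t' u e y] Suc * L_U by auto
qed (simp add: lev_x)

definition N :: "nat \<Rightarrow> 'a \<Rightarrow> 'a set" where
  "N t y = {u\<in>L t. \<exists>e\<in>S (Suc t) u. y \<in> e \<and> y \<noteq> u}"

lemma nbrs_eq:
  assumes "t < k" "u \<in> L t"
  shows "{y\<in>L (Suc t). \<exists>e\<in>S (Suc t) u. y \<in> e \<and> y \<noteq> u} = other u ` S (Suc t) u"
proof -
  have u: "u \<in> U" using assms L_U by blast
  have "y = other u e" if "e \<in> S (Suc t) u" "y \<in> e" "y \<noteq> u" "y \<in> U" for e y
    using other(2)[of e u] S_edge(1,2)[OF assms(1) u that(1)] u that by blast
  moreover have "other u e \<in> e" "other u e \<noteq> u" "other u e \<in> U" if "e \<in> S (Suc t) u" for e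
    using other[of e u] S_edge(1,2)[OF assms(1) u that] u by blast+
  ultimately show ?thesis (is "?P = ?R")
  proof (intro equalityI subsetI)
    assume o1: "\<And>e y. e \<in> S (Suc t) u \<Longrightarrow> y \<in> e \<Longrightarrow> y \<noteq> u \<Longrightarrow> y \<in> U \<Longrightarrow> y = other u e"
    fix y assume "y \<in> ?P"
    then obtain e where "y \<in> U" "e \<in> S (Suc t) u" "y \<in> e" "y \<noteq> u" by auto
    then show "y \<in> ?R" using o1[of e y] by simp
  next
    assume o2: "\<And>e. e \<in> S (Suc t) u \<Longrightarrow> other u e \<in> e" "\<And>e. e \<in> S (Suc t) u \<Longrightarrow> other u e \<noteq> u"
      "\<And>e. e \<in> S (Suc t) u \<Longrightarrow> other u e \<in> U"
    fix y assume "y \<in> ?R"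
    then obtain e where e: "e \<in> S (Suc t) u" "y = other u e" by blast
    then have "\<exists>e\<in>S (Suc t) u. y \<in> e \<and> y \<noteq> u" "y \<in> U" using o2[OF e(1)] by auto
    then show "y \<in> ?P" using assms(2) by auto
  qed
qed

lemma card_nbrs:
  assumes "t < k" "u \<in> L t"
  shows "card {y\<in>L (Suc t). \<exists>e\<in>S (Suc t) u. y \<in> e \<and> y \<noteq> u} = \<delta>"
proof -
  have u: "u \<in> U" using assms L_U by blast
  have "inj_on (other u) (S (Suc t) u)" using S_edge(1,2)[OF assms(1) u] u by (intro other_inj) auto
  then show ?thesis unfolding nbrs_eq[OF assms] using S_card[of "Suc t" u] u assms by (simp add: card_image)
qed

lemma sum_N:
  assumes "t < k"
  shows "(\<Sum>y\<in>L (Suc t). card (N t y)) = \<delta> * card (L t)"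
proof -
  have "(\<Sum>y\<in>L (Suc t). card {u\<in>L t. \<exists>e\<in>S (Suc t) u. y \<in> e \<and> y \<noteq> u}) = (\<Sum>u\<in>L t. \<delta>)"
    by (rule sum_multicount_gen[OF finite_L finite_L]) (use card_nbrs[OF assms] in blast)
  then show ?thesis unfolding N_def by simp
qed

text \<open>If every step multiplied the size by at least \<open>\<delta> / C\<close>, level
  \<open>k\<close> would be larger than \<open>U\<close>; the first step that fails is the one
  wanted.\<close>

lemma exists_level:
  fixes C :: real
  assumes C: "C \<ge> 1" and big: "(\<delta> / C) ^ k > card U"
  shows "\<exists>i. 1 \<le> i \<and> i < k \<and> card (L i) \<ge> (\<delta> / C) ^ i \<and> C * card (L (Suc i)) < \<delta> * card (L i)"
proof -
  have "\<exists>i<k. card (L i) \<ge> (\<delta> / C) ^ i \<and> C * card (L (Suc i)) < \<delta> * card (L i)"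
  proof (rule ccontr)
    assume neg: "\<not> ?thesis"
    have "t \<le> k \<Longrightarrow> card (L t) \<ge> (\<delta> / C) ^ t" for t
    proof (induction t)
      case (Suc t)
      then have IH: "card (L t) \<ge> (\<delta> / C) ^ t" and t: "t < k" by auto
      then have "C * card (L (Suc t)) \<ge> \<delta> * card (L t)" using neg by force
      then have "card (L (Suc t)) \<ge> \<delta> * card (L t) / C" using C by (simp add: field_simps)
      moreover have "\<delta> / C * card (L t) \<ge> \<delta> / C * (\<delta> / C) ^ t" using IH C by (intro mult_left_mono) auto
      ultimately show ?case by simp
    qed simp
    then have "card (L k) \<ge> (\<delta> / C) ^ k" by simp
    moreover have "card (L k) \<le> card U" using L_U finite_U by (intro card_mono) auto
    ultimately show False using big by linarith
  qed
  then obtain i where i: "i < k" "card (L i) \<ge> (\<delta> / C) ^ i" "C * card (L (Suc i)) < \<delta> * card (L i)" by blast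
  \<comment> \<open>The first step never fails: a vertex of \<open>L 1\<close> has the root as its
    only lower neighbour, so \<open>L 1\<close> has at least \<open>\<delta>\<close> vertices, and
    \<open>C\<close> is at least 1.\<close>
  have "i \<noteq> 0"
  proof
    assume i0: "i = 0"
    have "\<delta> * card (L 0) = (\<Sum>y\<in>L (Suc 0). card (N 0 y))" using sum_N[of 0] k2 by simp
    also have "\<dots> \<le> (\<Sum>y\<in>L (Suc 0). 1)"
    proof (intro sum_mono)
      fix y
      have "card (N 0 y) \<le> card (L 0)" unfolding N_def by (intro card_mono finite_L) auto
      then show "card (N 0 y) \<le> 1" by simp
    qed
    finally have "\<delta> \<le> card (L (Suc 0))" by simp
    moreover have "1 * real (card (L (Suc 0))) \<le> C * card (L (Suc 0))" using C by (intro mult_right_mono) auto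
    ultimately show False using i i0 by simp
  qed
  then show ?thesis using i by (intro exI[of _ i]) auto
qed

text \<open>A fixed choice of lower neighbour together with the edge leading to it. The label
  \<open>lev y\<close> tells in which level \<open>y\<close> lies, so the choice is a function of
  \<open>y\<close> alone.\<close>

definition par :: "'a \<Rightarrow> 'a \<times> 'a set" where
  "par y = (SOME ue. fst ue \<in> L (lev y - 1) \<and> snd ue \<in> S (lev y) (fst ue) \<and> y \<in> snd ue \<and> y \<noteq> fst ue)"
definition pv :: "'a \<Rightarrow> 'a" where "pv y = fst (par y)"
definition pe :: "'a \<Rightarrow> 'a set" where "pe y = snd (par y)"

lemma parent:
  assumes "t < k" "y \<in> L (Suc t)"
  shows "pv y \<in> L t" "pe y \<in> S (Suc t) (pv y)" "y \<in> pe y" "y \<noteq> pv y"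
proof -
  have l: "lev y = Suc t" using L_lev[of "Suc t" y] assms by simp
  obtain u e where "u \<in> L t" "e \<in> S (Suc t) u" "y \<in> e" "y \<noteq> u" using assms(2) by auto
  then have "\<exists>ue. fst ue \<in> L (lev y - 1) \<and> snd ue \<in> S (lev y) (fst ue) \<and> y \<in> snd ue \<and> y \<noteq> fst ue"
    using l by (intro exI[of _ "(u,e)"]) simp
  from someI_ex[OF this] have "fst (par y) \<in> L (lev y - 1) \<and> snd (par y) \<in> S (lev y) (fst (par y)) \<and> y \<in> snd (par y) \<and> y \<noteq> fst (par y)"
    unfolding par_def .
  then show "pv y \<in> L t" "pe y \<in> S (Suc t) (pv y)" "y \<in> pe y" "y \<noteq> pv y" unfolding pv_def pe_def l by auto
qed

definition anc :: "nat \<Rightarrow> 'a \<Rightarrow> 'a" where "anc n u = (pv ^^ n) u"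
definition T :: "nat \<Rightarrow> 'a \<Rightarrow> 'a set" where "T n u = pe (anc n u)"

lemma anc_0 [simp]: "anc 0 u = u" unfolding anc_def by simp
lemma anc_Suc: "anc (Suc n) u = pv (anc n u)" unfolding anc_def by simp

lemma L_reach: "g \<le> k \<Longrightarrow> v \<in> L g \<Longrightarrow> x \<in> reach g v"
proof (induction g arbitrary: v)
  case (Suc g)
  have p: "pv v \<in> L g" "pe v \<in> S (Suc g) (pv v)" "v \<in> pe v" "v \<noteq> pv v" using parent[of g v] Suc.prems by auto
  have pU: "pv v \<in> U" "v \<in> U" using p(1) L_U Suc.prems by blast+
  have e: "pe v \<in> edges G" "pv v \<in> pe v" using S_edge[OF _ pU(1) p(2)] Suc.prems by auto
  then have "pv v \<in> {v, other v (pe v)}" using other(2)[OF e(1) p(3) pU(2)] pU(1) by blast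
  then have o: "other v (pe v) = pv v" using p(4) by simp
  have "x \<in> reach g (other v (pe v))" unfolding o using Suc.IH[OF _ p(1)] Suc.prems by simp
  moreover have "pe v \<in> {e\<in>edges G. v \<in> e}" using e(1) p(3) by simp
  ultimately show ?case unfolding reach.simps by blast
qed simp

end

section \<open>Hyperpaths of ancestors and stars\<close>

locale rooted_level = rooted G A r k x lev S \<delta>
  for G :: "'a hypergraph" and A :: "nat \<Rightarrow> 'a set" and r k :: nat and x :: 'a
    and lev :: "'a \<Rightarrow> nat" and S :: "nat \<Rightarrow> 'a \<Rightarrow> 'a set set" and \<delta> :: nat +
  fixes i :: nat
  assumes i1: "1 \<le> i" and ik: "i < k"
begin

lemma anc_L: "u \<in> L i \<Longrightarrow> n \<le> i \<Longrightarrow> anc n u \<in> L (i - n)"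
proof (induction n)
  case (Suc n)
  then have "anc n u \<in> L (Suc (i - Suc n))" by (simp add: Suc_diff_Suc)
  then show ?case unfolding anc_Suc using parent(1)[of "i - Suc n"] ik by simp
qed simp

lemma anc_U: "u \<in> L i \<Longrightarrow> n \<le> i \<Longrightarrow> anc n u \<in> U"
  using anc_L L_U by blast

lemma anc_lev: "u \<in> L i \<Longrightarrow> n \<le> i \<Longrightarrow> lev (anc n u) = i - n"
  using L_lev[OF _ anc_L] ik by simp

lemma T_facts:
  assumes "u \<in> L i" "n < i"
  shows "T n u \<in> edges G" "anc n u \<in> T n u" "anc (Suc n) u \<in> T n u"
    "v \<in> T n u \<Longrightarrow> v \<noteq> anc (Suc n) u \<Longrightarrow> lev v = i - n"
    "T n u \<inter> U = {anc n u, anc (Suc n) u}"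
proof -
  have "anc n u \<in> L (Suc (i - Suc n))" using anc_L[of u n] assms by (simp add: Suc_diff_Suc)
  from parent[OF _ this] have p: "anc (Suc n) u \<in> L (i - Suc n)" "T n u \<in> S (Suc (i - Suc n)) (anc (Suc n) u)"
      "anc n u \<in> T n u" "anc n u \<noteq> anc (Suc n) u"
    unfolding anc_Suc T_def using ik by auto
  have pU: "anc (Suc n) u \<in> U" using p(1) L_U by blast
  have lt: "i - Suc n < k" using ik by simp
  show e: "T n u \<in> edges G" and "anc n u \<in> T n u" and s: "anc (Suc n) u \<in> T n u"
    using S_edge[OF lt pU p(2)] p(3) by auto
  show "lev v = i - n" if "v \<in> T n u" "v \<noteq> anc (Suc n) u"
    using S_edge(3)[OF lt pU p(2) that] assms by simp
  have "anc n u \<in> U" using anc_U assms by simp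
  then show "T n u \<inter> U = {anc n u, anc (Suc n) u}"
    using edge_U_pair[OF e p(3) _ s pU p(4)] by simp
qed

lemma T_lev: "u \<in> L i \<Longrightarrow> n < i \<Longrightarrow> v \<in> T n u \<Longrightarrow> lev v = i - n \<or> (v = anc (Suc n) u \<and> lev v = i - Suc n)"
  using T_facts(4)[of u n v] anc_lev[of u "Suc n"] by auto

lemma T_U_top: "u \<in> L i \<Longrightarrow> n < i \<Longrightarrow> v \<in> T n u \<Longrightarrow> v \<in> U \<Longrightarrow> lev v = i - n \<Longrightarrow> v = anc n u"
  using T_facts(5)[of u n] anc_lev[of u "Suc n"] by auto

text \<open>\<open>T n u\<close> carries the label \<open>i - n\<close>, except that its end nearer
  the root, \<open>anc (Suc n) u\<close>, has label \<open>i - Suc n\<close>. Comparing labels,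
  edges at different heights can share only an ancestor, and only when the heights are
  consecutive.\<close>

lemma T_cross:
  assumes "u \<in> L i" "u' \<in> L i" "n' < n" "n < i" "v \<in> T n u" "v \<in> T n' u'"
  shows "n = Suc n' \<and> v = anc n u \<and> v = anc n u'"
proof -
  have a: "lev v = i - n \<or> lev v = i - Suc n" using T_lev[OF assms(1,4,5)] by blast
  have "n' < i" using assms by simp
  from T_lev[OF assms(2) this assms(6)] have b: "v = anc (Suc n') u'" "lev v = i - Suc n'"
    using a assms by auto
  then have n: "n = Suc n'" "lev v = i - n" using a assms by auto
  have "v \<in> U" unfolding b(1) using anc_U[OF assms(2), of "Suc n'"] \<open>n' < i\<close> by simp
  then have "v = anc n u" using T_U_top[OF assms(1,4,5)] n by simp
  then show ?thesis using n b by simp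
qed

lemma T_root: "u \<in> L i \<Longrightarrow> x \<in> T (i - 1) u"
  using T_facts(3)[of u "i - 1"] anc_L[of u i] i1 by simp

text \<open>All hyperpaths end in the root, so there is a least height \<open>n\<close> at which the
  two meet. The edges there are different, and linearity then leaves one common vertex.\<close>

lemma first_meeting:
  assumes a: "a \<in> L i" and c: "c \<in> L i" and ne: "a \<noteq> c"
  shows "\<exists>n z. n < i \<and> T n a \<inter> T n c = {z} \<and> (\<forall>n'<n. T n' a \<inter> T n' c = {})"
proof -
  define n where "n = (LEAST n. T n a \<inter> T n c \<noteq> {})"
  have ex: "T (i - 1) a \<inter> T (i - 1) c \<noteq> {}" using T_root a c by blast
  have n1: "T n a \<inter> T n c \<noteq> {}" unfolding n_def by (rule LeastI[of _ "i - 1"]) (rule ex)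
  have ni: "n < i" using Least_le[of "\<lambda>n. T n a \<inter> T n c \<noteq> {}" "i - 1"] ex i1 unfolding n_def by simp
  have low: "T n' a \<inter> T n' c = {}" if "n' < n" for n'
    using not_less_Least[of n' "\<lambda>n. T n a \<inter> T n c \<noteq> {}"] that unfolding n_def by blast
  \<comment> \<open>Equal edges have equal ends of label \<open>i - n\<close>. For
    \<open>n = 0\<close> these are \<open>a\<close> and \<open>c\<close> themselves; otherwise the
    hyperpaths would have met one step earlier.\<close>
  have "T n a \<noteq> T n c"
  proof
    assume eq: "T n a = T n c"
    have "anc n a \<in> T n c" "anc n a \<in> U" "lev (anc n a) = i - n"
      using T_facts(2)[OF a ni] eq anc_U[OF a, of n] anc_lev[OF a, of n] ni by auto
    then have an: "anc n a = anc n c" using T_U_top[OF c ni] by blast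
    show False
    proof (cases n)
      case 0 then show False using an ne by simp
    next
      case (Suc n')
      have "n' < i" using Suc ni by simp
      then have "anc n a \<in> T n' a" "anc n c \<in> T n' c" using T_facts(3)[OF a, of n'] T_facts(3)[OF c, of n'] Suc by auto
      then show False using low[of n'] an Suc by auto
    qed
  qed
  moreover obtain z where "z \<in> T n a" "z \<in> T n c" using n1 by blast
  ultimately have "T n a \<inter> T n c = {z}"
    using edge_eqI[OF T_facts(1)[OF a ni] T_facts(1)[OF c ni]] by blast
  then show ?thesis using ni low by blast
qed

text \<open>The part \<open>p\<close> is recorded because it allows \<open>z\<close> to be recovered
  from any single leaf, as the vertex of \<open>A p\<close> in its edge at height \<open>n\<close>;
  stars sharing a leaf therefore have the same \<open>z\<close>. The first leaf is distinguished:
  its hyperpath will be the closing one of the cycle.\<close>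

definition is_star :: "nat \<Rightarrow> nat \<Rightarrow> 'a list \<Rightarrow> bool" where
  "is_star n p us \<longleftrightarrow> (\<exists>z\<in>A p. (\<forall>j<k. z \<in> T n (us ! j)) \<and>
     (\<forall>j. 1 \<le> j \<longrightarrow> j < k \<longrightarrow> T n (us ! 0) \<inter> T n (us ! j) = {z} \<and> (\<forall>n'<n. T n' (us ! 0) \<inter> T n' (us ! j) = {})))"

text \<open>Fix \<open>a\<close> in \<open>M\<close> and assign to each other \<open>c\<close> the
  height and the vertex of the first meeting with the hyperpath of \<open>a\<close>. At most
  \<open>k * r\<close> pairs occur, so if each occurred at most \<open>k - 2\<close> times,
  \<open>M\<close> would have fewer than \<open>k * k * r\<close> elements. Hence some pair serves
  \<open>k - 1\<close> vertices, which form a star with \<open>a\<close> in front.\<close>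

lemma star_exists:
  assumes M: "M \<subseteq> L i" and big: "card M \<ge> k * k * r"
  shows "\<exists>us. (\<exists>n<i. \<exists>p\<in>{1..r}. is_star n p us) \<and> set us \<subseteq> M \<and> distinct us \<and> length us = k"
proof -
  have finM: "finite M" using M finite_L finite_subset by blast
  have "card M > 0" using big k2 r2 by (metis gr0I mult_is_0 not_numeral_le_zero le_zero_eq)
  then obtain a where a: "a \<in> M" by fastforce
  have aL: "a \<in> L i" using a M by blast
  have "\<forall>c\<in>M - {a}. \<exists>nz. fst nz < i \<and> T (fst nz) a \<inter> T (fst nz) c = {snd nz} \<and> (\<forall>n'<fst nz. T n' a \<inter> T n' c = {})"
  proof
    fix c assume "c \<in> M - {a}"
    then have "c \<in> L i" "a \<noteq> c" using M by auto
    from first_meeting[OF aL this] obtain n z where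
      "n < i" "T n a \<inter> T n c = {z}" "\<forall>n'<n. T n' a \<inter> T n' c = {}" by auto
    then show "\<exists>nz. fst nz < i \<and> T (fst nz) a \<inter> T (fst nz) c = {snd nz} \<and> (\<forall>n'<fst nz. T n' a \<inter> T n' c = {})"
      by (intro exI[of _ "(n,z)"]) simp
  qed
  then obtain f where f: "\<And>c. c \<in> M - {a} \<Longrightarrow> fst (f c) < i \<and> T (fst (f c)) a \<inter> T (fst (f c)) c = {snd (f c)} \<and>
      (\<forall>n'<fst (f c). T n' a \<inter> T n' c = {})" unfolding bchoice_iff by blast
  define B where "B = Sigma {..<i} (\<lambda>n. T n a)"
  have finB: "finite B" unfolding B_def using T_facts(1)[OF aL] edge_facts(2) by (intro finite_SigmaI) auto
  have cB: "card B \<le> k * r"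
  proof -
    have "card B = (\<Sum>n<i. card (T n a))"
      unfolding B_def using T_facts(1)[OF aL] edge_facts(2) by (intro card_SigmaI) auto
    also have "\<dots> = i * r" using T_facts(1)[OF aL] edge_facts(1) by simp
    also have "\<dots> \<le> k * r" using ik by simp
    finally show ?thesis .
  qed
  have fB: "f ` (M - {a}) \<subseteq> B"
  proof
    fix b assume "b \<in> f ` (M - {a})"
    then obtain c where c: "c \<in> M - {a}" "b = f c" by blast
    have "snd (f c) \<in> T (fst (f c)) a" using f[OF c(1)] by blast
    then show "b \<in> B" unfolding B_def c(2) using f[OF c(1)] by (cases "f c") auto
  qed
  have "\<exists>b\<in>B. card {c\<in>M - {a}. f c = b} \<ge> k - 1"
  proof (rule ccontr)
    assume "\<not> ?thesis"
    then have "card {c\<in>M - {a}. f c = b} \<le> k - 2" if "b \<in> B" for b using that by fastforce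
    then have "(\<Sum>b\<in>B. card {c\<in>M - {a}. f c = b}) \<le> (\<Sum>b\<in>B. k - 2)" by (intro sum_mono)
    moreover have "(\<Sum>b\<in>B. card {c\<in>M - {a}. f c = b}) = card (M - {a})"
    proof -
      have "(\<Sum>b\<in>B. \<Sum>c\<in>{c\<in>M - {a}. f c = b}. 1) = (\<Sum>c\<in>M - {a}. (1::nat))"
        using finM finB fB by (intro sum.group) auto
      then show ?thesis by simp
    qed
    ultimately have "card (M - {a}) \<le> card B * (k - 2)" by simp
    also have "\<dots> \<le> k * r * (k - 2)" using cB by (rule mult_right_mono) simp
    finally have "card M \<le> Suc (k * r * (k - 2))" using finM a by (simp add: card_Diff_singleton)
    moreover have "Suc (k * r * (k - 2)) < k * k * r"
    proof -
      have "k * r * (k - 2) + k * r * 2 = k * k * r" 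
      proof -
        have "k * r * (k - 2) + k * r * 2 = k * r * ((k - 2) + 2)" by (simp only: distrib_left)
        also have "(k - 2) + 2 = k" using k2 by (rule le_add_diff_inverse2)
        finally show ?thesis by (simp only: ac_simps)
      qed
      moreover have "2 * 2 \<le> k * r" using k2 r2 by (rule mult_le_mono)
      ultimately show ?thesis by linarith
    qed
    ultimately show False using big by simp
  qed
  then obtain b where b: "b \<in> B" "card {c\<in>M - {a}. f c = b} \<ge> k - 1" by blast
  obtain W where W: "W \<subseteq> {c\<in>M - {a}. f c = b}" "card W = k - 1" "finite W"
    using obtain_subset_with_card_n[OF b(2)] by blast
  obtain ws where ws: "set ws = W" "distinct ws" using finite_distinct_list[OF W(3)] by blast
  have lw: "length ws = k - 1" using ws W distinct_card by metis
  define us where "us = a # ws"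
  define n z where "n = fst b" and "z = snd b"
  have nz: "n < i" "z \<in> T n a" using b(1) unfolding B_def n_def z_def by auto
  have usj: "T n a \<inter> T n (us ! j) = {z} \<and> (\<forall>n'<n. T n' a \<inter> T n' (us ! j) = {})" if "1 \<le> j" "j < k" for j
  proof -
    have "us ! j \<in> W" using that lw ws unfolding us_def by (auto simp: nth_Cons')
    then have "us ! j \<in> M - {a}" "f (us ! j) = b" using W by auto
    then show ?thesis using f unfolding n_def z_def by metis
  qed
  obtain p where p: "p \<in> {1..r}" "z \<in> A p" using part_ex[OF T_facts(1)[OF aL nz(1)] nz(2)] by blast
  have "z \<in> T n (us ! j)" if "j < k" for j
  proof (cases "j = 0")
    case True then show ?thesis using nz unfolding us_def by simp
  next
    case False then show ?thesis using usj[of j] that by auto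
  qed
  moreover have "us ! 0 = a" unfolding us_def by simp
  ultimately have "is_star n p us" unfolding is_star_def using usj p(2) by (intro bexI[of _ z]) auto
  moreover have "set us \<subseteq> M" "distinct us" "length us = k"
    using ws W a lw k2 unfolding us_def by auto
  ultimately show ?thesis using nz(1) p(1) by blast
qed

end

section \<open>The cycle closed by a walk\<close>

context rooted_level
begin

definition h :: "'a \<Rightarrow> 'a \<Rightarrow> 'a set" where "h u y = (SOME e. e \<in> S (Suc i) u \<and> y \<in> e)"

lemma h_facts:
  assumes y: "y \<in> L (Suc i)" and u: "u \<in> N i y"
  shows "u \<in> L i" "h u y \<in> edges G" "u \<in> h u y" "y \<in> h u y" "v \<in> h u y \<Longrightarrow> v \<noteq> u \<Longrightarrow> lev v = Suc i"
    "h u y \<inter> U = {u, y}"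
proof -
  show uL: "u \<in> L i" using u unfolding N_def by simp
  then have uU: "u \<in> U" using L_U by blast
  obtain e where e: "e \<in> S (Suc i) u" "y \<in> e" "y \<noteq> u" using u unfolding N_def by blast
  have "e \<in> S (Suc i) u \<and> y \<in> e" using e by simp
  then have hS: "h u y \<in> S (Suc i) u \<and> y \<in> h u y" unfolding h_def by (rule someI)
  then show eG: "h u y \<in> edges G" and ue: "u \<in> h u y" and ye: "y \<in> h u y"
    using S_edge[OF ik uU] by auto
  show "lev v = Suc i" if "v \<in> h u y" "v \<noteq> u" using S_edge(3)[OF ik uU] hS that by blast
  show "h u y \<inter> U = {u, y}" using edge_U_pair[OF eG ue uU ye] e(3) L_U y by blast
qed

lemma lev_i: "u \<in> L i \<Longrightarrow> lev u = i" using L_lev[of i] ik by simp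
lemma lev_Suc_i: "y \<in> L (Suc i) \<Longrightarrow> lev y = Suc i" using L_lev[of "Suc i"] ik by simp

text \<open>The edges attached to the leaf \<open>j\<close> of the star \<open>Y = (y, us)\<close>: index 0 is the edge joining it to the
  centre \<open>y\<close>, index \<open>Suc n\<close> the edge at height \<open>n\<close> of its hyperpath.\<close>

definition F :: "nat \<Rightarrow> nat \<Rightarrow> 'a \<times> 'a list \<Rightarrow> 'a set" where
  "F j \<tau> Y = (case \<tau> of 0 \<Rightarrow> h (snd Y ! j) (fst Y) | Suc n \<Rightarrow> T n (snd Y ! j))"

definition V :: "nat \<times> nat \<times> nat \<Rightarrow> 'a \<times> 'a list \<Rightarrow> 'a" where
  "V = (\<lambda>(j,\<tau>,p) Y. vert p (F j \<tau> Y))"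

definition stars :: "nat \<Rightarrow> nat \<Rightarrow> ('a \<times> 'a list) set" where
  "stars n p = {(y,us). y \<in> L (Suc i) \<and> set us \<subseteq> N i y \<and> distinct us \<and> length us = k \<and> is_star n p us}"

end

abbreviation role :: "nat \<Rightarrow> 'a \<times> 'b list \<Rightarrow> 'b" where "role j Y \<equiv> snd Y ! j"

text \<open>The edge index runs up to \<open>k\<close> rather than up to the level \<open>i\<close>,
  so that the index set, and with it the constants derived from it, depends on \<open>k\<close> and
  \<open>r\<close> only.\<close>

definition attrs :: "nat \<Rightarrow> nat \<Rightarrow> (nat \<times> nat \<times> nat) set" where
  "attrs k r = {..<k} \<times> {..k} \<times> {1..r}"

locale cycle_walk = rooted_level G A r k x lev S \<delta> i
  for G :: "'a hypergraph" and A :: "nat \<Rightarrow> 'a set" and r k :: nat and x :: 'a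
    and lev :: "'a \<Rightarrow> nat" and S :: "nat \<Rightarrow> 'a \<Rightarrow> 'a set set" and \<delta> i :: nat +
  fixes n p m :: nat and Z :: "('a \<times> 'a list) set" and xs :: "('a \<times> 'a list) list"
  assumes ni: "n < i" and p: "p \<in> {1..r}" and m: "m = k - 1 - n" and Z: "Z \<subseteq> stars n p"
    and xs: "xs \<in> good_walks role fst V (attrs k r) Z m"
begin

abbreviation "yy t \<equiv> fst (xs ! t)"
abbreviation "us t \<equiv> snd (xs ! t)"

text \<open>The leaves through which the walk passes: \<open>u t\<close> is shared by stars
  \<open>t - 1\<close> and \<open>t\<close> when \<open>0 < t < m\<close>, and \<open>u 0\<close>
  and \<open>u m\<close> are the two free ends.\<close>

definition u :: "nat \<Rightarrow> 'a" where "u t = (if t < m then us t ! t else us (m - 1) ! m)"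

lemma m1: "1 \<le> m" "m < k" "m + n + 1 = k"
  using ni ik i1 m by auto

lemma walk: "length xs = m" "Suc t < m \<Longrightarrow> us t ! Suc t = us (Suc t) ! Suc t"
    "s < t \<Longrightarrow> t < m \<Longrightarrow> yy s \<noteq> yy t"
    "s < t \<Longrightarrow> t < m \<Longrightarrow> q \<in> attrs k r \<Longrightarrow> q' \<in> attrs k r \<Longrightarrow> V q' (xs ! t) = V q (xs ! s) \<Longrightarrow> V q' (xs ! s) = V q (xs ! s)"
  using xs unfolding good_walks_def mem_Collect_eq by blast+

lemma star:
  assumes "t < m"
  shows "yy t \<in> L (Suc i)" "j < k \<Longrightarrow> us t ! j \<in> N i (yy t)" "j < k \<Longrightarrow> us t ! j \<in> L i" "is_star n p (us t)"
    "j < k \<Longrightarrow> j' < k \<Longrightarrow> us t ! j = us t ! j' \<Longrightarrow> j = j'"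
proof -
  have "set xs \<subseteq> Z" using xs unfolding good_walks_def by blast
  then have "xs ! t \<in> stars n p" using Z assms walk(1) by (meson nth_mem subsetD)
  then have *: "yy t \<in> L (Suc i)" "set (us t) \<subseteq> N i (yy t)" "distinct (us t)" "length (us t) = k" "is_star n p (us t)"
    unfolding stars_def by (auto simp: case_prod_beta)
  then show "yy t \<in> L (Suc i)" "is_star n p (us t)" by auto
  show a: "us t ! j \<in> N i (yy t)" if "j < k" using * that by (metis nth_mem subsetD)
  then show "us t ! j \<in> L i" if "j < k" using that unfolding N_def by blast
  show "j = j'" if "j < k" "j' < k" "us t ! j = us t ! j'" using * that nth_eq_iff_index_eq by metis
qed

lemma u_in: "t < m \<Longrightarrow> u t = us t ! t" unfolding u_def by simp

lemma u_out: "t < m \<Longrightarrow> u (Suc t) = us t ! Suc t"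
  using walk(2)[of t] m1 unfolding u_def by (auto simp: not_less less_Suc_eq_le dest: le_antisym)

lemma F_0: "F j 0 (xs ! t) = h (us t ! j) (yy t)" unfolding F_def by simp
lemma F_Suc: "F j (Suc b) (xs ! t) = T b (us t ! j)" unfolding F_def by simp

lemma F_edge: "t < m \<Longrightarrow> j < k \<Longrightarrow> \<tau> \<le> i \<Longrightarrow> F j \<tau> (xs ! t) \<in> edges G"
  using h_facts(2)[OF star(1) star(2)] T_facts(1)[OF star(3)] by (cases \<tau>) (auto simp: F_0 F_Suc)

text \<open>A common vertex lies in some part \<open>A p'\<close>, so it is an attribute of both
  stars for this \<open>p'\<close>. The walk condition makes the corresponding attribute of the
  earlier star equal to it, which moves the coincidence inside star \<open>s\<close>.\<close>

lemma pull_back: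
  assumes st: "s < t" "t < m" and j: "j < k" "j' < k" "\<tau> \<le> i" "\<tau>' \<le> i"
    and v: "v \<in> F j' \<tau>' (xs ! t)" "v \<in> F j \<tau> (xs ! s)"
  shows "v \<in> F j' \<tau>' (xs ! s)"
proof -
  have s: "s < m" using st by simp
  note E = F_edge[OF st(2) j(2,4)] F_edge[OF s j(1,3)] F_edge[OF s j(2,4)]
  obtain p' where p': "p' \<in> {1..r}" "v \<in> A p'" using part_ex[OF E(1) v(1)] by blast
  have 1: "V (j',\<tau>',p') (xs ! t) = v" "V (j,\<tau>,p') (xs ! s) = v"
    using vert_unique[OF E(1) p'(1) v(1) p'(2)] vert_unique[OF E(2) p'(1) v(2) p'(2)] unfolding V_def by auto
  have "(j',\<tau>',p') \<in> attrs k r" "(j,\<tau>,p') \<in> attrs k r" using j p' ik unfolding attrs_def by auto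
  then have "V (j',\<tau>',p') (xs ! s) = v" using walk(4)[OF st, of "(j,\<tau>,p')" "(j',\<tau>',p')"] 1 by simp
  then show ?thesis using vert_in[OF E(3) p'(1)] unfolding V_def by simp
qed

lemma u_L: "t \<le> m \<Longrightarrow> u t \<in> L i"
  using star(3)[of t t] star(3)[of "m - 1" m] m1 unfolding u_def by auto

lemma hh: assumes "t < m" "j < k"
  shows "F j 0 (xs ! t) \<inter> U = {us t ! j, yy t}" "v \<in> F j 0 (xs ! t) \<Longrightarrow> v \<noteq> us t ! j \<Longrightarrow> lev v = Suc i"
    "us t ! j \<in> F j 0 (xs ! t)" "yy t \<in> F j 0 (xs ! t)"
  using h_facts[OF star(1)[OF assms(1)] star(2)[OF assms]] unfolding F_0 by blast+

lemma us_U: "t < m \<Longrightarrow> j < k \<Longrightarrow> us t ! j \<in> U \<and> lev (us t ! j) = i"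
  using star(3) L_U lev_i by blast

lemma yy_U: "t < m \<Longrightarrow> yy t \<in> U \<and> lev (yy t) = Suc i"
  using star(1) L_U lev_Suc_i by blast

lemma us_ne_yy: "t < m \<Longrightarrow> j < k \<Longrightarrow> s < m \<Longrightarrow> us t ! j \<noteq> yy s"
  using us_U[of t j] yy_U[of s] by (metis n_not_Suc_n)

lemma HH_same:
  assumes "t < m" "j < k" "j' < k" "j \<noteq> j'" "v \<in> F j 0 (xs ! t)" "v \<in> F j' 0 (xs ! t)"
  shows "v = yy t"
proof (rule ccontr)
  assume "v \<noteq> yy t"
  then have "F j 0 (xs ! t) = F j' 0 (xs ! t)"
    using edge_eqI[OF F_edge F_edge, of t j 0 t j' 0 v "yy t"] hh(4) assms by auto
  then have "us t ! j \<in> {us t ! j', yy t}" using hh(1)[OF assms(1,2)] hh(1)[OF assms(1,3)] by blast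
  then show False using star(5)[OF assms(1-3)] assms(4) us_ne_yy[OF assms(1,2,1)] by blast
qed

text \<open>Pull \<open>v\<close> back to star \<open>s\<close>. For different leaf indices it must
  be the centre of star \<open>s\<close>, and labels then identify it with the centre of star
  \<open>t\<close>. For equal indices the stars are consecutive and share the leaf
  \<open>u t\<close>; a second common vertex would make the two edges, hence the centres,
  equal.\<close>

lemma HH_diff:
  assumes st: "s < t" "t < m" and j: "j = s \<or> j = Suc s" "j' = t \<or> j' = Suc t"
    and v: "v \<in> F j 0 (xs ! s)" "v \<in> F j' 0 (xs ! t)"
  shows "t = Suc s \<and> j = t \<and> j' = t \<and> v = u t"
proof -
  have s: "s < m" using st by simp
  have jk: "j < k" "j' < k" using j st m1 by auto
  have v3: "v \<in> F j' 0 (xs ! s)" using pull_back[OF st jk _ _ v(2,1)] by simp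
  show ?thesis
  proof (cases "j = j'")
    case False
    then have "v = yy s" using HH_same[OF s jk _ v(1) v3] by simp
    then have "v \<in> U" "lev v = Suc i" using yy_U[OF s] by auto
    then have "v \<in> {us t ! j', yy t}" using hh(1)[OF st(2) jk(2)] v(2) by blast
    moreover have "v \<noteq> us t ! j'" using us_ne_yy[OF st(2) jk(2) s] \<open>v = yy s\<close> by simp
    ultimately have "v = yy t" by blast
    then show ?thesis using walk(3)[OF st] \<open>v = yy s\<close> by simp
  next
    case True
    then have jj: "t = Suc s" "j = t" "j' = t" using j st by auto
    have eq: "us s ! t = u t" "us t ! t = u t" using u_out[OF s] u_in[OF st(2)] jj by auto
    have "v = u t"
    proof (rule ccontr)
      assume "v \<noteq> u t"
      then have "F t 0 (xs ! s) = F t 0 (xs ! t)"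
        using edge_eqI[OF F_edge F_edge, of s t 0 t t 0 v "u t"] hh(3)[OF s jk(1)] hh(3)[OF st(2) jk(2)] v jj eq s st jk by auto
      then have "{u t, yy s} = {u t, yy t}" using hh(1)[OF s jk(1)] hh(1)[OF st(2) jk(2)] jj eq by simp
      then show False using walk(3)[OF st] by (metis doubleton_eq_iff)
    qed
    then show ?thesis using jj by simp
  qed
qed

lemma u_inj_less:
  assumes "t < t'" "t' \<le> m"
  shows "u t \<noteq> u t'"
proof
  assume eq: "u t = u t'"
  \<comment> \<open>\<open>u t'\<close> is a leaf of star \<open>s\<close>. If it equalled
    \<open>u t\<close>, pulling back to star \<open>t\<close> would make it the leaf with index
    \<open>t'\<close> there, against the distinctness of leaves within a star.\<close>
  define s where "s = t' - 1"
  have s: "s < m" "t' = Suc s" "t \<le> s" using assms s_def by auto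
  have t: "t < m" "t < k" "t' < k" using assms m1 by auto
  have u2: "us s ! t' = u t'" using u_out[OF s(1)] s(2) by simp
  show False
  proof (cases "t = s")
    case True
    then have "us s ! t = us s ! t'" using eq u2 u_in[OF t(1)] by simp
    then show False using star(5)[OF s(1) t(2,3)] assms by simp
  next
    case False
    then have ts: "t < s" using s by simp
    have 1: "u t \<in> F t' 0 (xs ! s)" using hh(3)[OF s(1) t(3)] u2 eq by simp
    have 2: "u t \<in> F t 0 (xs ! t)" using hh(3)[OF t(1,2)] u_in[OF t(1)] by simp
    have "u t \<in> F t' 0 (xs ! t)" using pull_back[OF ts s(1) t(2,3) _ _ 1 2] by simp
    moreover have "u t \<in> U" "lev (u t) = i" using us_U[OF t(1,2)] u_in[OF t(1)] by auto
    ultimately have "u t \<in> {us t ! t', yy t}" using hh(1)[OF t(1,3)] by blast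
    then have "u t = us t ! t'" using us_ne_yy[OF t(1,2,1)] u_in[OF t(1)] by auto
    then show False using star(5)[OF t(1) t(2,3)] assms u_in[OF t(1)] by simp
  qed
qed

lemma u_inj: "t \<le> m \<Longrightarrow> t' \<le> m \<Longrightarrow> u t = u t' \<Longrightarrow> t = t'"
  using u_inj_less[of t t'] u_inj_less[of t' t] by (metis nat_neq_iff)

text \<open>Labels separate the two kinds of edges: \<open>Suc i\<close> or \<open>i\<close> on one
  side, at most \<open>i\<close> on the other, and on both sides the label \<open>i\<close> at
  height 0 singles out the leaf.\<close>

lemma HT:
  assumes "t < m" "j < k" "w \<in> L i" "b < i" "v \<in> F j 0 (xs ! t)" "v \<in> T b w"
  shows "b = 0 \<and> v = w \<and> w = us t ! j"
proof -
  have "lev v = i \<or> lev v = Suc i" using hh(2)[OF assms(1,2,5)] us_U[OF assms(1,2)] by blast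
  moreover have "lev v = i - b \<or> lev v = i - Suc b" using T_lev[OF assms(3,4,6)] by blast
  ultimately have b: "b = 0" "lev v = i" using i1 by auto
  then have "v = us t ! j" using hh(2)[OF assms(1,2,5)] by auto
  moreover have "v = w" using T_U_top[OF assms(3,4,6)] b us_U[OF assms(1,2)] \<open>v = us t ! j\<close> by simp
  ultimately show ?thesis using b by simp
qed

definition z :: 'a where "z = vert p (T n (u 0))"

text \<open>The meeting vertex is transported along the walk: the edge at height \<open>n\<close> of
  a shared leaf has just one vertex in \<open>A p\<close>.\<close>

lemma z_all: "t < m \<Longrightarrow> j < k \<Longrightarrow> z \<in> T n (us t ! j)"
proof (induction t arbitrary: j)
  case 0
  obtain z' where z': "z' \<in> A p" "\<And>j. j < k \<Longrightarrow> z' \<in> T n (us 0 ! j)"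
    using star(4)[OF 0(1)] unfolding is_star_def by blast
  have "z = z'" unfolding z_def u_in[OF 0(1)]
    using vert_unique[OF T_facts(1)[OF star(3)[OF 0(1), of 0] ni] p z'(2)[of 0] z'(1)] m1 by simp
  then show ?case using z' 0 by simp
next
  case (Suc t)
  obtain z' where z': "z' \<in> A p" "\<And>j. j < k \<Longrightarrow> z' \<in> T n (us (Suc t) ! j)"
    using star(4)[OF Suc.prems(1)] unfolding is_star_def by blast
  have k: "Suc t < k" "t < m" using Suc.prems m1 by auto
  let ?w = "us (Suc t) ! Suc t"
  have "z \<in> T n ?w" using Suc.IH[OF k(2,1)] walk(2)[OF Suc.prems(1)] by simp
  moreover have "z \<in> A p" unfolding z_def
    using vert_eq[OF T_facts(1)[OF u_L[of 0] ni] p] by blast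
  ultimately have "vert p (T n ?w) = z"
    using vert_unique[OF T_facts(1)[OF star(3)[OF Suc.prems(1) k(1)] ni] p] by blast
  moreover have "vert p (T n ?w) = z'"
    using vert_unique[OF T_facts(1)[OF star(3)[OF Suc.prems(1) k(1)] ni] p] z' k(1) by blast
  ultimately show ?case using z' Suc.prems by simp
qed

lemma u_m: "u m = us (m - 1) ! m" unfolding u_def by simp

lemma z_in: "z \<in> T n (u 0)" "z \<in> T n (u m)"
  using z_all[of 0 0] z_all[of "m - 1" m] m1 u_in[of 0] u_m by auto

text \<open>The vertex is pulled back from the last star to the first one, where it lies on the
  hyperpaths of the leaves 0 and \<open>m\<close>. The first-meeting property of that star finishes;
  leaf \<open>m\<close> exists there because \<open>m < k\<close>.\<close>

lemma same_level:
  assumes "b \<le> n" "v \<in> T b (u m)" "v \<in> T b (u 0)"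
  shows "b = n \<and> v = z"
proof -
  have m0: "0 < m" "m < k" "0 < k" using m1 by auto
  have v1: "v \<in> T b (us 0 ! m)"
  proof (cases "m = 1")
    case True then show ?thesis using assms(2) u_m by simp
  next
    case False
    then have lt: "0 < m - 1" "m - 1 < m" using m0 by auto
    have "v \<in> F m (Suc b) (xs ! (m - 1))" "v \<in> F 0 (Suc b) (xs ! 0)"
      using assms u_m u_in[OF m0(1)] unfolding F_Suc by auto
    from pull_back[OF lt m0(3,2) _ _ this] show ?thesis using assms(1) ni unfolding F_Suc by simp
  qed
  have v2: "v \<in> T b (us 0 ! 0)" using assms(3) u_in[OF m0(1)] by simp
  obtain z' where z': "T n (us 0 ! 0) \<inter> T n (us 0 ! m) = {z'}"
      "\<forall>n'<n. T n' (us 0 ! 0) \<inter> T n' (us 0 ! m) = {}"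
    using star(4)[OF m0(1)] m1 unfolding is_star_def by blast
  have zz: "z = z'" using z'(1) z_all[OF m0(1,3)] z_all[OF m0(1,2)] by blast
  have "\<not> b < n" using z'(2) v1 v2 by blast
  then have "b = n" using assms(1) by simp
  then show ?thesis using z'(1) v1 v2 zz by blast
qed

text \<open>At different heights, \<open>T_cross\<close> would produce a common ancestor of
  \<open>u 0\<close> and \<open>u m\<close> that lies in edges of equal height below
  \<open>n\<close>, which \<open>same_level\<close> excludes.\<close>

lemma RL:
  assumes "b \<le> n" "b' \<le> n" "v \<in> T b (u m)" "v \<in> T b' (u 0)"
  shows "b = n \<and> b' = n \<and> v = z"
proof -
  have L0: "u 0 \<in> L i" "u m \<in> L i" using u_L by auto
  have bi: "b < i" "b' < i" using assms ni by auto
  have contra: False if "b1 < n" "anc (Suc b1) (u 0) = anc (Suc b1) (u m)" for b1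
  proof -
    have "b1 < i" using that ni by simp
    then have "anc (Suc b1) (u m) \<in> T b1 (u m)" "anc (Suc b1) (u m) \<in> T b1 (u 0)"
      using T_facts(3)[OF L0(1), of b1] T_facts(3)[OF L0(2), of b1] that by auto
    then show False using same_level[of b1] that by auto
  qed
  consider "b = b'" | "b < b'" | "b' < b" by linarith
  then show ?thesis
  proof cases
    case 1 then show ?thesis using same_level assms by blast
  next
    case 2
    from T_cross[OF L0(1,2) 2 bi(2) assms(4,3)] show ?thesis using contra[of b] assms by auto
  next
    case 3
    from T_cross[OF L0(2,1) 3 bi(1) assms(3,4)] show ?thesis using contra[of b'] assms by auto
  qed
qed

text \<open>The edges in cyclic order: two at each centre of the walk from \<open>u 0\<close> to
  \<open>u m\<close>, then along the hyperpath of \<open>u m\<close> up to height \<open>n\<close>,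
  and back along that of \<open>u 0\<close> from height \<open>n\<close> to 0. In total these are
  \<open>2 * m + 2 * (n + 1) = 2 * k\<close> edges.\<close>

definition ce :: "nat \<Rightarrow> 'a set" where
  "ce a = (if a < 2 * m then F (a div 2 + a mod 2) 0 (xs ! (a div 2))
           else if a \<le> 2 * m + n then T (a - 2 * m) (u m) else T (2 * k - 1 - a) (u 0))"

text \<open>The joint of \<open>ce (a - 1)\<close> and \<open>ce a\<close>, with \<open>jn 0\<close>
  closing the cycle. At the turning point it is \<open>z\<close> and not an ancestor at height
  \<open>Suc n\<close>.\<close>

definition jn :: "nat \<Rightarrow> 'a" where
  "jn a = (if a < 2 * m then (if even a then u (a div 2) else yy (a div 2))
           else if a \<le> 2 * m + n then anc (a - 2 * m) (u m)
           else if a = 2 * m + n + 1 then z else anc (2 * k - a) (u 0))"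

lemma ce_cases:
  assumes "a < 2 * k"
  obtains (H) t \<rho> where "t < m" "\<rho> \<le> 1" "a = 2 * t + \<rho>" "ce a = F (t + \<rho>) 0 (xs ! t)"
  | (R) b where "b \<le> n" "a = 2 * m + b" "ce a = T b (u m)"
  | (L) b where "b \<le> n" "a + b = 2 * k - 1" "ce a = T b (u 0)"
proof (cases "a < 2 * m")
  case True
  show ?thesis by (rule H[of "a div 2" "a mod 2"]) (use True in \<open>auto simp: ce_def\<close>)
next
  case False
  show ?thesis
  proof (cases "a \<le> 2 * m + n")
    case True
    show ?thesis by (rule R[of "a - 2 * m"]) (use True False in \<open>auto simp: ce_def\<close>)
  next
    case F2: False
    show ?thesis by (rule L[of "2 * k - 1 - a"]) (use F2 False assms m1 in \<open>auto simp: ce_def\<close>)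
  qed
qed

lemma role_u: "t < m \<Longrightarrow> \<rho> \<le> 1 \<Longrightarrow> us t ! (t + \<rho>) = u (t + \<rho>)"
  using u_in[of t] u_out[of t] by (cases \<rho>) auto

lemma jn_u: "t \<le> m \<Longrightarrow> jn (2 * t) = u t"
  unfolding jn_def by auto

lemma jn_y: "t < m \<Longrightarrow> jn (2 * t + 1) = yy t"
  unfolding jn_def by auto

lemma jn_R: "b \<le> n \<Longrightarrow> jn (2 * m + b) = anc b (u m)"
  unfolding jn_def by auto

lemma jn_z: "jn (2 * m + n + 1) = z"
  unfolding jn_def by auto

lemma jn_L: "b < n \<Longrightarrow> a + b = 2 * k - 1 \<Longrightarrow> jn a = anc (Suc b) (u 0)"
proof -
  assume *: "b < n" "a + b = 2 * k - 1"
  then have "2 * k - a = Suc b" "\<not> a < 2 * m" "\<not> a \<le> 2 * m + n" "a \<noteq> 2 * m + n + 1" using m1 by auto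
  then show ?thesis unfolding jn_def by simp
qed

lemma ce_edge:
  assumes "a < 2 * k"
  shows "ce a \<in> edges G"
  using assms
proof (cases rule: ce_cases)
  case (H t \<rho>)
  then show ?thesis using F_edge[of t "t + \<rho>" 0] m1 by simp
next
  case (R b)
  then show ?thesis using T_facts(1)[OF u_L[of m], of b] ni by simp
next
  case (L b)
  then show ?thesis using T_facts(1)[OF u_L[of 0], of b] ni by simp
qed

text \<open>By the types of the two edges: \<open>HH_same\<close> and \<open>HH_diff\<close> for two
  centre edges, \<open>HT\<close> for a centre edge and a hyperpath edge, \<open>T_cross\<close>
  within one hyperpath, and \<open>RL\<close> between the two hyperpaths.\<close>

lemma ce_meet:
  assumes ab: "a < b" "b < 2 * k" and v: "v \<in> ce a" "v \<in> ce b"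
  shows "(b = Suc a \<and> v = jn b) \<or> (a = 0 \<and> b = 2 * k - 1 \<and> v = jn 0)"
proof -
  have L0: "u 0 \<in> L i" "u m \<in> L i" using u_L by auto
  have a: "a < 2 * k" using ab by simp
  from ab(2) show ?thesis
  proof (cases rule: ce_cases)
    case b: (H t' \<rho>')
    from a show ?thesis
    proof (cases rule: ce_cases)
      case a: (H t \<rho>)
      have k: "t + \<rho> < k" "t' + \<rho>' < k" using a b m1 by auto
      have "t \<le> t'" using ab a b by auto
      show ?thesis
      proof (cases "t = t'")
        case True
        then have "\<rho> = 0" "\<rho>' = 1" using ab a b by auto
        then show ?thesis using HH_same[OF b(1) k(1), of "t' + \<rho>'" v] k v a b True jn_y[OF b(1)] by auto
      next
        case False
        then have "t < t'" using \<open>t \<le> t'\<close> by simp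
        have "t + \<rho> = t \<or> t + \<rho> = Suc t" "t' + \<rho>' = t' \<or> t' + \<rho>' = Suc t'" using a(2) b(2) by linarith+
        from HH_diff[OF \<open>t < t'\<close> b(1) this] have "t' = Suc t" "t + \<rho> = t'" "t' + \<rho>' = t'" "v = u t'"
          using v a(4) b(4) by auto
        then show ?thesis using a(3) b(1,3) jn_u[of t'] by auto
      qed
    next
      case (R c) then show ?thesis using b ab by auto
    next
      case (L c) then show ?thesis using b ab m1 by auto
    qed
  next
    case b: (R c')
    have c'i: "c' < i" using b ni by simp
    from a show ?thesis
    proof (cases rule: ce_cases)
      case a: (H t \<rho>)
      have k: "t + \<rho> < k" using a m1 by auto
      from HT[OF a(1) k L0(2) c'i] v a b have *: "c' = 0" "v = u m" "u m = us t ! (t + \<rho>)" by auto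
      have "t + \<rho> \<le> m" using a(1,2) by linarith
      moreover have "u (t + \<rho>) = u m" using *(3) role_u[OF a(1,2)] by simp
      ultimately have "t + \<rho> = m" using u_inj by blast
      then have "b = Suc a" using a(1-3) b(2) *(1) by linarith
      then show ?thesis using * b jn_R[of 0] by simp
    next
      case a: (R c)
      then have "c < c'" using b ab by simp
      from T_cross[OF L0(2,2) this c'i] v a b have "c' = Suc c" "v = anc c' (u m)" by auto
      then show ?thesis using a(2) b(1,2) jn_R[of c'] by auto
    next
      case (L c) then show ?thesis using b ab m1 by auto
    qed
  next
    case b: (L c')
    have c'i: "c' < i" using b ni by simp
    from a show ?thesis
    proof (cases rule: ce_cases)
      case a: (H t \<rho>)
      have k: "t + \<rho> < k" using a m1 by auto
      from HT[OF a(1) k L0(1) c'i] v a b have *: "c' = 0" "v = u 0" "u 0 = us t ! (t + \<rho>)" by auto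
      have "t + \<rho> \<le> m" using a(1,2) by linarith
      moreover have "u (t + \<rho>) = u 0" using *(3) role_u[OF a(1,2)] by simp
      ultimately have "t + \<rho> = 0" using u_inj by blast
      then show ?thesis using *(1,2) a(3) b(2) jn_u[of 0] by simp
    next
      case a: (R c)
      from RL[OF a(1) b(1)] v a b have "c = n" "c' = n" "v = z" by auto
      then have "b = 2 * m + n + 1" "b = Suc a" using a(2) b(2) m1 by linarith+
      then show ?thesis using jn_z \<open>v = z\<close> by simp
    next
      case a: (L c)
      then have c: "c' < c" "c < i" using b ab ni by auto
      from T_cross[OF L0(1,1) c] v a b have *: "c = Suc c'" "v = anc c (u 0)" by auto
      then have "c' < n" using a by simp
      then show ?thesis using * a(2) b(2) ab jn_L[of c' b] by auto
    qed
  qed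
qed

lemma ce_jn:
  assumes a: "a < 2 * k"
  shows "jn a \<in> ce a \<and> jn (Suc a mod (2 * k)) \<in> ce a"
proof -
  have L0: "u 0 \<in> L i" "u m \<in> L i" using u_L by auto
  from a show ?thesis
  proof (cases rule: ce_cases)
    case (H t \<rho>)
    have k: "t + \<rho> < k" "Suc a < 2 * k" using H m1 by auto
    note hh3 = hh(3)[OF H(1) k(1)] hh(4)[OF H(1) k(1)]
    show ?thesis
    proof (cases "\<rho> = 0")
      case True
      then show ?thesis using H k hh3 role_u[OF H(1,2)] jn_u[of t] jn_y[OF H(1)] by auto
    next
      case False
      then have "\<rho> = 1" using H by simp
      then have "Suc a = 2 * Suc t" "a = 2 * t + 1" "Suc t \<le> m" using H by auto
      then show ?thesis using H k hh3 role_u[OF H(1,2)] jn_u[of "Suc t"] jn_y[OF H(1)] \<open>\<rho> = 1\<close> by simp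
    qed
  next
    case (R b)
    then have bi: "b < i" using ni by simp
    have s: "Suc a mod (2 * k) = Suc a" using R m1 by simp
    show ?thesis
    proof (cases "b = n")
      case True
      then show ?thesis unfolding s using R jn_R[of b] jn_z z_in T_facts(2)[OF L0(2) bi] by auto
    next
      case False
      then have "jn (Suc a) = anc (Suc b) (u m)" using R jn_R[of "Suc b"] by simp
      then show ?thesis unfolding s using R jn_R[of b] T_facts(2,3)[OF L0(2) bi] by auto
    qed
  next
    case (L b)
    then have bi: "b < i" using ni by simp
    have 1: "jn a \<in> ce a"
    proof (cases "b = n")
      case True
      then have "a = 2 * m + n + 1" using L m1 by auto
      then show ?thesis using jn_z z_in L True by simp
    next
      case False
      then show ?thesis using L jn_L[of b a] T_facts(3)[OF L0(1) bi] by simp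
    qed
    have 2: "jn (Suc a mod (2 * k)) \<in> ce a"
    proof (cases b)
      case 0
      then have "Suc a = 2 * k" using L a by auto
      then have "jn (Suc a mod (2 * k)) = u 0" using jn_u[of 0] by simp
      then show ?thesis using L 0 T_facts(2)[OF L0(1) bi] by simp
    next
      case (Suc b')
      then have "Suc a mod (2 * k) = Suc a" "Suc a + b' = 2 * k - 1" "b' < n" using L a by auto
      then have "jn (Suc a mod (2 * k)) = anc b (u 0)" using jn_L[of b' "Suc a"] Suc by simp
      then show ?thesis using L T_facts(2)[OF L0(1) bi] by simp
    qed
    show ?thesis using 1 2 by blast
  qed
qed

definition cyc :: "'a hypergraph" where "cyc = (\<Union> (ce ` {..<2 * k}), ce ` {..<2 * k})"

lemma cyc_copy: "cyc \<in> copies (linear_cycle r (2 * k)) G"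
proof -
  have "hypergraph_iso (linear_cycle r (2 * k)) cyc"
    unfolding cyc_def
  proof (rule linear_cycle_isoI[of "2 * k" r ce jn])
    show "4 \<le> 2 * k" using k2 by simp
    show "card (ce a) = r" if "a < 2 * k" for a using edge_facts(1)[OF ce_edge[OF that]] .
  qed (use r2 ce_jn ce_meet in auto)
  moreover have "verts cyc \<subseteq> verts G" "edges cyc \<subseteq> edges G"
    unfolding cyc_def using ce_edge edge_facts(3) by auto
  ultimately show ?thesis unfolding copies_def by simp
qed

lemma cyc_card: "card (verts cyc) \<le> 2 * k * r" "finite (verts cyc)"
proof -
  have "card (verts cyc) \<le> (\<Sum>a<2 * k. card (ce a))" unfolding cyc_def fst_conv by (intro card_UN_le) simp
  also have "\<dots> = 2 * k * r" using edge_facts(1)[OF ce_edge] by simp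
  finally show "card (verts cyc) \<le> 2 * k * r" .
  show "finite (verts cyc)" unfolding cyc_def using edge_facts(2)[OF ce_edge] by auto
qed

lemma ce_sub: "a < 2 * k \<Longrightarrow> ce a \<subseteq> verts cyc" unfolding cyc_def by auto

lemma cyc_vertices: "t < m \<Longrightarrow> yy t \<in> verts cyc \<and> us t ! Suc t \<in> verts cyc"
proof -
  assume t: "t < m"
  then have k: "Suc t < k" "2 * t + 1 < 2 * k" "2 * t + 1 < 2 * m" using m1 by auto
  have "ce (2 * t + 1) = F (Suc t) 0 (xs ! t)" unfolding ce_def using k by simp
  then show ?thesis using ce_sub[OF k(2)] hh(3,4)[OF t k(1)] by auto
qed

text \<open>This vertex ties the cycle to its root, which lies within \<open>i - Suc n\<close> steps
  of it.\<close>

lemma cyc_anchor: "anc (Suc n) (u 0) \<in> verts cyc \<inter> L (i - Suc n)"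
proof -
  have a: "2 * m + n + 1 < 2 * k" "2 * k - 1 - (2 * m + n + 1) = n" using m1 by auto
  then have "ce (2 * m + n + 1) = T n (u 0)" unfolding ce_def by simp
  moreover have "u 0 \<in> L i" using u_L by simp
  ultimately have "anc (Suc n) (u 0) \<in> verts cyc" using ce_sub[OF a(1)] T_facts(3)[of "u 0" n] ni by blast
  then show ?thesis using anc_L[OF \<open>u 0 \<in> L i\<close>, of "Suc n"] ni by simp
qed

end

section \<open>Counting\<close>

lemma finite_attrs: "finite (attrs k r)" unfolding attrs_def by simp

lemma attrs_nonempty: "k \<ge> 1 \<Longrightarrow> r \<ge> 1 \<Longrightarrow> attrs k r \<noteq> {}"
  unfolding attrs_def by (auto simp: lessThan_empty_iff)

context rooted_level
begin

declare L.simps(2) [simp del]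

lemma walk_copy:
  assumes "n < i" "p \<in> {1..r}" "m = k - 1 - n" "Z \<subseteq> stars n p"
    "xs \<in> good_walks role fst V (attrs k r) Z m"
  shows "\<exists>K. K \<in> copies (linear_cycle r (2 * k)) G \<and> finite (verts K) \<and> card (verts K) \<le> 2 * k * r \<and>
    (\<forall>t<m. fst (xs ! t) \<in> verts K \<and> snd (xs ! t) ! Suc t \<in> verts K) \<and> verts K \<inter> L (i - Suc n) \<noteq> {}"
proof -
  interpret cycle_walk G A r k x lev S \<delta> i n p m Z xs
    by unfold_locales (use assms in auto)
  show ?thesis using cyc_copy cyc_card cyc_vertices cyc_anchor by blast
qed

text \<open>Cut each neighbourhood \<open>N i y\<close> into disjoint stars. Fewer than half of the
  \<open>\<delta> * card (L i)\<close> incidences are needed for the remainders, or exactly half at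
  worst, by \<open>dense\<close>; the rest is covered by stars with \<open>k\<close> leaves each.
  One of at most \<open>k * r\<close> pairs \<open>(n, p)\<close> then receives its share.\<close>

lemma many_stars:
  assumes dense: "2 * (k * k * r) * card (L (Suc i)) \<le> \<delta> * card (L i)"
  shows "\<exists>n<i. \<exists>p\<in>{1..r}. \<exists>Y\<subseteq>stars n p. finite Y \<and>
     (\<forall>a\<in>Y. \<forall>b\<in>Y. fst a = fst b \<longrightarrow> a \<noteq> b \<longrightarrow> set (snd a) \<inter> set (snd b) = {}) \<and>
     real (card Y) \<ge> 1 / (2 * k * (k * r)) * \<delta> * card (L i)"
proof -
  let ?P = "\<lambda>us. \<exists>n<i. \<exists>p\<in>{1..r}. is_star n p us"
  let ?c = "k * k * r"
  define ok where "ok y F \<longleftrightarrow> finite F \<and> (\<forall>us\<in>F. ?P us \<and> set us \<subseteq> N i y \<and> distinct us \<and> length us = k) \<and>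
     (\<forall>us\<in>F. \<forall>us'\<in>F. us \<noteq> us' \<longrightarrow> set us \<inter> set us' = {}) \<and> card (N i y) \<le> k * card F + ?c" for y F
  have NL: "N i y \<subseteq> L i" for y unfolding N_def by blast
  have "\<exists>F. ok y F" for y
    unfolding ok_def
  proof (rule disjoint_blocks)
    show "finite (N i y)" using NL finite_L finite_subset by blast
    show "1 \<le> k" using k2 by simp
    show "\<exists>us. ?P us \<and> set us \<subseteq> M \<and> distinct us \<and> length us = k" if "M \<subseteq> N i y" "?c \<le> card M" for M
      using star_exists[of M] that NL by blast
  qed
  then obtain F where F: "\<And>y. ok y (F y)" by metis
  define Y where "Y = Sigma (L (Suc i)) F"
  have finF: "finite (F y)" for y using F unfolding ok_def by blast
  have finY: "finite Y" unfolding Y_def using finF finite_L by blast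
  have cY: "card Y = (\<Sum>y\<in>L (Suc i). card (F y))"
    unfolding Y_def using finF finite_L by (intro card_SigmaI) auto
  have "\<delta> * card (L i) = (\<Sum>y\<in>L (Suc i). card (N i y))" using sum_N[OF ik] by simp
  also have "\<dots> \<le> (\<Sum>y\<in>L (Suc i). k * card (F y) + ?c)"
    using F unfolding ok_def by (intro sum_mono) blast
  also have "\<dots> = k * card Y + card (L (Suc i)) * ?c"
    unfolding cY by (simp add: sum.distrib sum_distrib_left)
  finally have "\<delta> * card (L i) \<le> k * card Y + card (L (Suc i)) * ?c" .
  then have half: "\<delta> * card (L i) \<le> 2 * (k * card Y)" using dense by (simp add: algebra_simps)
  let ?I = "{..<i} \<times> {1..r}"
  have "Y \<subseteq> (\<Union>(n,p)\<in>?I. Y \<inter> stars n p)"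
  proof
    fix a assume a: "a \<in> Y"
    then have *: "fst a \<in> L (Suc i)" "snd a \<in> F (fst a)" unfolding Y_def by auto
    then obtain n p where np: "n < i" "p \<in> {1..r}" "is_star n p (snd a)" using F[of "fst a"] unfolding ok_def by blast
    have "a \<in> stars n p" using * np F[of "fst a"] unfolding ok_def stars_def by (auto simp: case_prod_beta)
    then show "a \<in> (\<Union>(n,p)\<in>?I. Y \<inter> stars n p)" using a np by (intro UN_I[of "(n,p)"]) auto
  qed
  then have "card Y \<le> card (\<Union>(n,p)\<in>?I. Y \<inter> stars n p)" using finY by (intro card_mono) auto
  also have "\<dots> \<le> (\<Sum>(n,p)\<in>?I. card (Y \<inter> stars n p))"
    using card_UN_le[of ?I "\<lambda>(n,p). Y \<inter> stars n p"] by (simp add: case_prod_unfold)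
  finally have le: "card Y \<le> (\<Sum>(n,p)\<in>?I. card (Y \<inter> stars n p))" .
  have "\<exists>(n,p)\<in>?I. real (card (Y \<inter> stars n p)) \<ge> card Y / (k * r)"
  proof (rule ccontr)
    assume "\<not> ?thesis"
    then have lt: "real (card (Y \<inter> stars n p)) < card Y / (k * r)" if "(n,p) \<in> ?I" for n p using that by force
    have ne: "?I \<noteq> {}" using i1 r2 by (auto simp: lessThan_empty_iff)
    have "real (card Y) \<le> (\<Sum>(n,p)\<in>?I. real (card (Y \<inter> stars n p)))"
      using le by (simp add: case_prod_unfold flip: of_nat_sum)
    also have "\<dots> < (\<Sum>(n,p)\<in>?I. card Y / (k * r))" using lt ne by (intro sum_strict_mono) auto
    also have "\<dots> = (i * r) * (card Y / (k * r))" by (simp add: case_prod_unfold card_cartesian_product)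
    also have "\<dots> \<le> (k * r) * (card Y / (k * r))"
    proof (rule mult_right_mono)
      have "i * r \<le> k * r" using ik by simp
      then show "real (i * r) \<le> real (k * r)" by (simp only: of_nat_le_iff)
    qed simp
    also have "\<dots> = card Y" using k2 r2 by simp
    finally show False by simp
  qed
  then obtain n p where np: "n < i" "p \<in> {1..r}" "real (card (Y \<inter> stars n p)) \<ge> card Y / (k * r)" by auto
  have "real (\<delta> * card (L i)) \<le> real (2 * (k * card Y))" using half by (simp only: of_nat_le_iff)
  then have "real (card Y) \<ge> \<delta> * card (L i) / (2 * k)" using k2 by (simp add: field_simps)
  then have "card Y / real (k * r) \<ge> \<delta> * card (L i) / (2 * k) / real (k * r)" by (intro divide_right_mono) auto
  moreover have "\<delta> * card (L i) / (2 * k) / real (k * r) \<ge> 1 / (2 * k * (k * r)) * \<delta> * card (L i)"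
    using k2 r2 by (simp add: field_simps)
  ultimately have "real (card (Y \<inter> stars n p)) \<ge> 1 / (2 * k * (k * r)) * \<delta> * card (L i)"
    using np(3) by linarith
  moreover have "set (snd a) \<inter> set (snd b) = {}" if "a \<in> Y" "b \<in> Y" "fst a = fst b" "a \<noteq> b" for a b
  proof -
    have "snd a \<in> F (fst a)" "snd b \<in> F (fst a)" "snd a \<noteq> snd b" using that unfolding Y_def by (auto simp: prod_eq_iff)
    then show ?thesis using F[of "fst a"] unfolding ok_def by blast
  qed
  ultimately show ?thesis using np(1,2) finY
    by (intro exI[of _ n] conjI bexI[of _ p] exI[of _ "Y \<inter> stars n p"]) auto
qed

text \<open>Stars with the same centre have disjoint leaf sets, so the centre and one indexed leaf
  determine the star. As a leaf \<open>u\<close> has \<open>\<delta>\<close> upper neighbours, it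
  has a given index in at most \<open>\<delta>\<close> stars.\<close>

lemma star_degree:
  assumes Y: "Y \<subseteq> stars n p" "finite Y"
    and dj: "\<forall>a\<in>Y. \<forall>b\<in>Y. fst a = fst b \<longrightarrow> a \<noteq> b \<longrightarrow> set (snd a) \<inter> set (snd b) = {}"
    and j: "j < k"
  shows "a \<in> Y \<Longrightarrow> b \<in> Y \<Longrightarrow> fst a = fst b \<Longrightarrow> role j a = role j b \<Longrightarrow> a = b"
    "u \<in> L i \<Longrightarrow> card {a\<in>Y. role j a = u} \<le> \<delta>"
    "a \<in> Y \<Longrightarrow> role j a \<in> L i"
proof -
  have st: "length (snd a) = k" "set (snd a) \<subseteq> N i (fst a)" "fst a \<in> L (Suc i)" if "a \<in> Y" for a
    using subsetD[OF Y(1) that] unfolding stars_def by (auto simp: case_prod_beta)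
  have rj: "role j a \<in> set (snd a)" if "a \<in> Y" for a using st(1)[OF that] j by simp
  show one: "a = b" if "a \<in> Y" "b \<in> Y" "fst a = fst b" "role j a = role j b" for a b
  proof (rule ccontr)
    assume "a \<noteq> b"
    then have "set (snd a) \<inter> set (snd b) = {}" using dj that(1-3) by blast
    then show False using rj[OF that(1)] rj[OF that(2)] that(4) by auto
  qed
  show "role j a \<in> L i" if "a \<in> Y" using rj[OF that] st(2)[OF that] unfolding N_def by blast
  show "card {a\<in>Y. role j a = u} \<le> \<delta>" if u: "u \<in> L i"
  proof -
    have "inj_on fst {a\<in>Y. role j a = u}" using one by (auto intro!: inj_onI)
    moreover have "fst ` {a\<in>Y. role j a = u} \<subseteq> {y\<in>L (Suc i). \<exists>e\<in>S (Suc i) u. y \<in> e \<and> y \<noteq> u}"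
    proof (rule image_subsetI)
      fix a assume a: "a \<in> {a\<in>Y. role j a = u}"
      then have "u \<in> N i (fst a)" "fst a \<in> L (Suc i)" using rj[of a] st[of a] by auto
      then show "fst a \<in> {y\<in>L (Suc i). \<exists>e\<in>S (Suc i) u. y \<in> e \<and> y \<noteq> u}" unfolding N_def by blast
    qed
    ultimately have "card {a\<in>Y. role j a = u} \<le> card {y\<in>L (Suc i). \<exists>e\<in>S (Suc i) u. y \<in> e \<and> y \<noteq> u}"
      using finite_L by (intro card_inj_on_le[of fst]) auto
    then show ?thesis using card_nbrs[OF ik u] by simp
  qed
qed

text \<open>The walk can be read off from the pairs consisting of the centre and the leaf
  \<open>Suc t\<close> of star \<open>t\<close>. All of these are vertices of the copy, so each copy
  comes from at most \<open>(2 * k * r) ^ (2 * m)\<close> walks.\<close>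

lemma walks_copies:
  assumes np: "n < i" "p \<in> {1..r}" and m: "m = k - 1 - n" and Z: "Z \<subseteq> stars n p" "finite Z"
    and dj: "\<forall>a\<in>Z. \<forall>b\<in>Z. fst a = fst b \<longrightarrow> a \<noteq> b \<longrightarrow> set (snd a) \<inter> set (snd b) = {}"
  shows "\<exists>\<K>\<subseteq>copies (linear_cycle r (2 * k)) G. finite \<K> \<and>
     card (good_walks role fst V (attrs k r) Z m) \<le> card \<K> * (2 * k * r) ^ (2 * k) \<and>
     (\<forall>K\<in>\<K>. finite (verts K) \<and> card (verts K) \<le> 2 * k * r \<and> verts K \<inter> L (i - Suc n) \<noteq> {})"
proof -
  let ?W = "good_walks role fst V (attrs k r) Z m"
  define ok where "ok xs K \<longleftrightarrow> K \<in> copies (linear_cycle r (2 * k)) G \<and> finite (verts K) \<and> card (verts K) \<le> 2 * k * r \<and>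
    (\<forall>t<m. fst (xs ! t) \<in> verts K \<and> snd (xs ! t) ! Suc t \<in> verts K) \<and> verts K \<inter> L (i - Suc n) \<noteq> {}" for xs K
  have "\<exists>K. ok xs K" if "xs \<in> ?W" for xs
    unfolding ok_def by (rule walk_copy[OF np m Z(1) that])
  then obtain f where f: "\<And>xs. xs \<in> ?W \<Longrightarrow> ok xs (f xs)" by metis
  have finW: "finite ?W" by (rule finite_good_walks[OF Z(2)])
  have mk: "m < k" using m np ik by simp
  have fiber: "card {xs\<in>?W. f xs = K} \<le> (2 * k * r) ^ (2 * k)" if K: "K \<in> f ` ?W" for K
  proof -
    obtain xs0 where "xs0 \<in> ?W" "K = f xs0" using K by blast
    then have Kf: "finite (verts K)" "card (verts K) \<le> 2 * k * r" using f unfolding ok_def by auto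
    define g where "g xs = map (\<lambda>t. (fst (xs ! t), snd (xs ! t) ! Suc t)) [0..<m]" for xs :: "('a \<times> 'a list) list"
    let ?T = "{ws. set ws \<subseteq> verts K \<times> verts K \<and> length ws = m}"
    have "inj_on g {xs\<in>?W. f xs = K}"
    proof (rule inj_onI)
      fix xs xs' assume *: "xs \<in> {xs\<in>?W. f xs = K}" "xs' \<in> {xs\<in>?W. f xs = K}" "g xs = g xs'"
      then have len: "length xs = m" "length xs' = m" and sub: "set xs \<subseteq> Z" "set xs' \<subseteq> Z"
        unfolding good_walks_def by auto
      show "xs = xs'"
      proof (rule nth_equalityI)
        show "length xs = length xs'" using len by simp
        fix t assume "t < length xs"
        then have t: "t < m" using len by simp
        have "g xs ! t = g xs' ! t" using *(3) by simp
        then have "fst (xs ! t) = fst (xs' ! t)" "role (Suc t) (xs ! t) = role (Suc t) (xs' ! t)"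
          unfolding g_def using t by auto
        moreover have "xs ! t \<in> Z" "xs' ! t \<in> Z" using t len sub nth_mem by (metis subsetD)+
        moreover have "Suc t < k" using t mk by simp
        ultimately show "xs ! t = xs' ! t" using star_degree(1)[OF Z dj] by blast
      qed
    qed
    moreover have "g ` {xs\<in>?W. f xs = K} \<subseteq> ?T"
    proof (rule image_subsetI)
      fix xs assume "xs \<in> {xs\<in>?W. f xs = K}"
      then have "ok xs K" using f by blast
      then show "g xs \<in> ?T" unfolding ok_def g_def by auto
    qed
    moreover have finT: "finite ?T" using Kf by (intro finite_lists_length_eq) auto
    ultimately have "card {xs\<in>?W. f xs = K} \<le> card ?T" by (rule card_inj_on_le)
    also have "\<dots> = (card (verts K) * card (verts K)) ^ m"
      using Kf by (subst card_lists_length_eq) (auto simp: card_cartesian_product)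
    also have "\<dots> \<le> ((2 * k * r) * (2 * k * r)) ^ m" using Kf by (intro power_mono mult_mono) auto
    also have "\<dots> = (2 * k * r) ^ (2 * m)" by (simp add: power_mult power2_eq_square)
    also have "\<dots> \<le> (2 * k * r) ^ (2 * k)" using mk k2 r2 by (intro power_increasing) auto
    finally show ?thesis .
  qed
  have "card ?W = (\<Sum>K\<in>f ` ?W. card {xs\<in>?W. f xs = K})"
  proof -
    have "(\<Sum>K\<in>f ` ?W. \<Sum>xs\<in>{xs\<in>?W. f xs = K}. 1) = (\<Sum>xs\<in>?W. (1::nat))"
      using finW by (intro sum.group) auto
    then show ?thesis by simp
  qed
  also have "\<dots> \<le> (\<Sum>K\<in>f ` ?W. (2 * k * r) ^ (2 * k))" by (intro sum_mono fiber)
  also have "\<dots> = card (f ` ?W) * (2 * k * r) ^ (2 * k)" by simp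
  finally have "card ?W \<le> card (f ` ?W) * (2 * k * r) ^ (2 * k)" .
  moreover have "K \<in> copies (linear_cycle r (2 * k)) G \<and> finite (verts K) \<and> card (verts K) \<le> 2 * k * r \<and>
      verts K \<inter> L (i - Suc n) \<noteq> {}" if "K \<in> f ` ?W" for K
    using that f unfolding ok_def by fast
  ultimately show ?thesis using finW by (intro exI[of _ "f ` ?W"]) blast
qed

text \<open>Choose stars, pass to a canonical subfamily, and extend walks greedily:
  \<open>card Z\<close> is of order \<open>\<delta> * card (L i)\<close> and each of the
  \<open>m - 1\<close> further stars gains a factor of order \<open>\<delta>\<close>. The instance
  of \<open>canonical_subfamily\<close> enters as the hypothesis \<open>can\<close>, so that
  \<open>b\<close> can be fixed before the hypergraph.\<close>

lemma level_cycles: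
  fixes b :: real
  assumes dense: "2 * (k * k * r) * card (L (Suc i)) \<le> \<delta> * card (L i)"
    and can: "\<And>(V :: nat \<times> nat \<times> nat \<Rightarrow> 'a \<times> 'a list \<Rightarrow> 'a) Y. finite Y \<Longrightarrow>
     (\<forall>j\<in>{..<k}. \<forall>y\<in>Y. role j y \<in> L i) \<Longrightarrow>
     (\<forall>j\<in>{..<k}. \<forall>u\<in>L i. real (card {y\<in>Y. role j y = u}) \<le> real \<delta>) \<Longrightarrow>
     real (card Y) \<ge> 1 / (2 * k * (k * r)) * real \<delta> * real (card (L i)) \<Longrightarrow>
     (\<exists>Z\<subseteq>Y. \<exists>g\<ge>b. real (card Z) \<ge> g * real \<delta> * real (card (L i)) \<and>
       (\<forall>j\<in>{..<k}. \<forall>y\<in>Z. real (card {y'\<in>Z. role j y' = role j y}) \<ge> g * real \<delta>) \<and>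
       (\<forall>j\<in>{..<k}. \<forall>q\<in>attrs k r. det_by (role j) (V q) Z \<or>
          spread_by (g / (4 * k * (card (attrs k r))\<^sup>2) * real \<delta>) (role j) (V q) Z))"
    and b: "0 < b" "b \<le> 1" "b * \<delta> \<ge> 4 * k"
  shows "\<exists>g<k. g < i \<and> (\<exists>\<K>\<subseteq>copies (linear_cycle r (2 * k)) G. finite \<K> \<and>
     real (card \<K>) \<ge> b * (b / 2) ^ k / (2 * k * r) ^ (2 * k) * real \<delta> ^ (k + g - i) * card (L i) \<and>
     (\<forall>K\<in>\<K>. finite (verts K) \<and> card (verts K) \<le> 2 * k * r \<and> verts K \<inter> L g \<noteq> {}))"
proof -
  obtain n p Y where np: "n < i" "p \<in> {1..r}" and Y: "Y \<subseteq> stars n p" "finite Y"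
    and dj: "\<forall>a\<in>Y. \<forall>b\<in>Y. fst a = fst b \<longrightarrow> a \<noteq> b \<longrightarrow> set (snd a) \<inter> set (snd b) = {}"
    and big: "real (card Y) \<ge> 1 / (2 * k * (k * r)) * \<delta> * card (L i)"
    using many_stars[OF dense] by blast
  have deg: "\<forall>j\<in>{..<k}. \<forall>u\<in>L i. real (card {y\<in>Y. role j y = u}) \<le> real \<delta>"
  proof (intro ballI)
    fix j u assume "j \<in> {..<k}" "u \<in> L i"
    then have "j < k" by simp
    from star_degree(2)[OF Y dj this \<open>u \<in> L i\<close>]
    show "real (card {y\<in>Y. role j y = u}) \<le> real \<delta>" by simp
  qed
  have rl: "\<forall>j\<in>{..<k}. \<forall>y\<in>Y. role j y \<in> L i"
  proof (intro ballI)
    fix j y assume "j \<in> {..<k}" "y \<in> Y"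
    then have "j < k" by simp
    from star_degree(3)[OF Y dj this \<open>y \<in> Y\<close>] show "role j y \<in> L i" .
  qed
  obtain Z g where Z: "Z \<subseteq> Y" and g: "g \<ge> b" and cZ: "real (card Z) \<ge> g * real \<delta> * real (card (L i))"
    and degZ: "\<forall>j\<in>{..<k}. \<forall>y\<in>Z. real (card {y'\<in>Z. role j y' = role j y}) \<ge> g * real \<delta>"
    and ds: "\<forall>j\<in>{..<k}. \<forall>q\<in>attrs k r. det_by (role j) (V q) Z \<or>
          spread_by (g / (4 * k * (card (attrs k r))\<^sup>2) * real \<delta>) (role j) (V q) Z"
    using can[OF Y(2) rl deg big, of V] by blast
  define D where "D = g * real \<delta>"
  have finZ: "finite Z" using Z Y finite_subset by blast
  have Zs: "Z \<subseteq> stars n p" using Z Y by blast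
  have djZ: "\<forall>a\<in>Z. \<forall>b\<in>Z. fst a = fst b \<longrightarrow> a \<noteq> b \<longrightarrow> set (snd a) \<inter> set (snd b) = {}"
    using dj Z by blast
  have bD: "b * \<delta> \<le> D" unfolding D_def using g by (intro mult_right_mono) auto
  then have D4: "D \<ge> 4 * k" using b by linarith
  define m where "m = k - 1 - n"
  have m1: "m \<ge> 1" "m - 1 < k" "Suc (m - 1) = m" unfolding m_def using np ik by auto
  have "real (card (good_walks role fst V (attrs k r) Z (Suc (m - 1)))) \<ge> card Z * (D / 2) ^ (m - 1)"
  proof (rule card_good_walks[OF finZ finite_attrs attrs_nonempty m1(2)])
    show "1 \<le> k" "1 \<le> r" using k2 r2 by auto
    show "D \<le> real (card {y'\<in>Z. role j y' = role j y})" if "j < k" "y \<in> Z" for j y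
      using degZ that unfolding D_def by blast
    show "det_by (role j) (V q) Z \<or> spread_by (D / (4 * k * (card (attrs k r))\<^sup>2)) (role j) (V q) Z"
      if "j < k" "q \<in> attrs k r" for j q
      using ds that unfolding D_def by (metis lessThan_iff times_divide_eq_left)
    show "y = y'" if "j < k" "y \<in> Z" "y' \<in> Z" "role j y = role j y'" "fst y = fst y'" for j y y'
      using star_degree(1)[OF Zs finZ djZ that(1,2,3,5,4)] .
    show "4 * real k \<le> D" using D4 by simp
  qed
  then have W: "real (card (good_walks role fst V (attrs k r) Z m)) \<ge> card Z * (D / 2) ^ (m - 1)"
    unfolding m1(3) .
  have "card Z * (D / 2) ^ (m - 1) \<ge> (b * \<delta> * card (L i)) * (b * \<delta> / 2) ^ (m - 1)"
  proof (intro mult_mono power_mono)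
    have "b * \<delta> * card (L i) \<le> D * card (L i)" using bD by (intro mult_right_mono) auto
    then show "b * \<delta> * card (L i) \<le> card Z" using cZ unfolding D_def by linarith
  qed (use bD b in auto)
  also have "(b * \<delta> * card (L i)) * (b * \<delta> / 2) ^ (m - 1) = b * (b / 2) ^ (m - 1) * \<delta> ^ m * card (L i)"
  proof -
    have "(b * \<delta> / 2) ^ (m - 1) = (b / 2) ^ (m - 1) * real \<delta> ^ (m - 1)" by (simp add: power_mult_distrib power_divide)
    moreover have "real \<delta> ^ m = \<delta> * real \<delta> ^ (m - 1)" using m1(3) by (metis power_Suc)
    ultimately show ?thesis by (simp add: algebra_simps)
  qed
  finally have W2: "real (card (good_walks role fst V (attrs k r) Z m)) \<ge> b * (b / 2) ^ (m - 1) * real \<delta> ^ m * card (L i)"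
    using W by simp
  have "(b / 2) ^ (m - 1) \<ge> (b / 2) ^ k" using b m1 by (intro power_decreasing) auto
  then have "b * (b / 2) ^ k * (real \<delta> ^ m * card (L i)) \<le> b * (b / 2) ^ (m - 1) * (real \<delta> ^ m * card (L i))"
    using b by (intro mult_right_mono mult_left_mono) auto
  then have W3: "real (card (good_walks role fst V (attrs k r) Z m)) \<ge> b * (b / 2) ^ k * (real \<delta> ^ m * card (L i))"
    using W2 by (simp add: mult.assoc)
  obtain \<K> where \<K>: "\<K> \<subseteq> copies (linear_cycle r (2 * k)) G" "finite \<K>"
     "card (good_walks role fst V (attrs k r) Z m) \<le> card \<K> * (2 * k * r) ^ (2 * k)"
     "\<forall>K\<in>\<K>. finite (verts K) \<and> card (verts K) \<le> 2 * k * r \<and> verts K \<inter> L (i - Suc n) \<noteq> {}"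
    using walks_copies[OF np m_def Zs finZ djZ] by blast
  define M where "M = real (2 * k * r) ^ (2 * k)"
  have Mpos: "M > 0" unfolding M_def using k2 r2 by simp
  have "real (card (good_walks role fst V (attrs k r) Z m)) \<le> real (card \<K> * (2 * k * r) ^ (2 * k))"
    using \<K>(3) by (simp only: of_nat_le_iff)
  then have "real (card \<K>) * M \<ge> b * (b / 2) ^ k * (real \<delta> ^ m * card (L i))" using W3 unfolding M_def by simp
  then have "real (card \<K>) \<ge> b * (b / 2) ^ k / M * real \<delta> ^ m * card (L i)" using Mpos by (simp add: field_simps)
  \<comment> \<open>With \<open>g = i - Suc n\<close> the exponent \<open>m\<close> becomes
    \<open>k + g - i\<close>, which the size of level \<open>i\<close> will complete to
    \<open>k + g\<close>.\<close>
  moreover have "m = k + (i - Suc n) - i" unfolding m_def using np ik by simp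
  ultimately show ?thesis using \<K> np ik unfolding M_def
    by (intro exI[of _ "i - Suc n"] conjI exI[of _ \<K>]) auto
qed

end

context rooted
begin

text \<open>The level from \<open>exists_level\<close> has size at least
  \<open>(\<delta> / C) ^ i\<close>, which turns \<open>level_cycles\<close> into a count of order
  \<open>\<delta> ^ (k + g)\<close>. The excess \<open>\<delta> ^ g\<close> is what the number of
  roots per copy will consume.\<close>

lemma root_cycles:
  fixes b :: real
  assumes can: "\<And>(V :: nat \<times> nat \<times> nat \<Rightarrow> 'a \<times> 'a list \<Rightarrow> 'a) Y L. finite Y \<Longrightarrow> finite L \<Longrightarrow>
     (\<forall>j\<in>{..<k}. \<forall>y\<in>Y. role j y \<in> L) \<Longrightarrow>
     (\<forall>j\<in>{..<k}. \<forall>u\<in>L. real (card {y\<in>Y. role j y = u}) \<le> real \<delta>) \<Longrightarrow>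
     real (card Y) \<ge> 1 / (2 * k * (k * r)) * real \<delta> * real (card L) \<Longrightarrow>
     (\<exists>Z\<subseteq>Y. \<exists>g\<ge>b. real (card Z) \<ge> g * real \<delta> * real (card L) \<and>
       (\<forall>j\<in>{..<k}. \<forall>y\<in>Z. real (card {y'\<in>Z. role j y' = role j y}) \<ge> g * real \<delta>) \<and>
       (\<forall>j\<in>{..<k}. \<forall>q\<in>attrs k r. det_by (role j) (V q) Z \<or>
          spread_by (g / (4 * k * (card (attrs k r))\<^sup>2) * real \<delta>) (role j) (V q) Z))"
    and b: "0 < b" "b \<le> 1" "b * \<delta> \<ge> 4 * k"
    and big: "(\<delta> / (2 * (k * k * r))) ^ k > card U"
  shows "\<exists>g<k. \<exists>\<K>\<subseteq>copies (linear_cycle r (2 * k)) G. finite \<K> \<and>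
     real (card \<K>) \<ge> b * (b / 2) ^ k / (2 * k * r) ^ (2 * k) / (2 * (k * k * r)) ^ k * real \<delta> ^ (k + g) \<and>
     (\<forall>K\<in>\<K>. finite (verts K) \<and> card (verts K) \<le> 2 * k * r \<and> (\<exists>v\<in>verts K \<inter> U. x \<in> reach g v))"
proof -
  define C where "C = real (2 * (k * k * r))"
  have C1: "C \<ge> 1" unfolding C_def using k2 r2 by (simp add: Suc_leI flip: of_nat_mult)
  obtain i where i: "1 \<le> i" "i < k" "card (L i) \<ge> (\<delta> / C) ^ i" "C * card (L (Suc i)) < \<delta> * card (L i)"
    using exists_level[OF C1] big unfolding C_def by auto
  interpret rooted_level G A r k x lev S \<delta> i by unfold_locales (use i in auto)
  have dense: "2 * (k * k * r) * card (L (Suc i)) \<le> \<delta> * card (L i)"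
  proof -
    have "real (2 * (k * k * r) * card (L (Suc i))) \<le> real (\<delta> * card (L i))" using i(4) unfolding C_def by simp
    then show ?thesis by (simp only: of_nat_le_iff)
  qed
  define c0 where "c0 = b * (b / 2) ^ k / (2 * k * r) ^ (2 * k)"
  have c0: "c0 \<ge> 0" unfolding c0_def using b by simp
  obtain g \<K> where g: "g < k" "g < i" and \<K>: "\<K> \<subseteq> copies (linear_cycle r (2 * k)) G" "finite \<K>"
     "real (card \<K>) \<ge> c0 * real \<delta> ^ (k + g - i) * card (L i)"
     "\<forall>K\<in>\<K>. finite (verts K) \<and> card (verts K) \<le> 2 * k * r \<and> verts K \<inter> L g \<noteq> {}"
    using level_cycles[OF dense can[OF _ finite_L] b] unfolding c0_def by blast
  have "c0 * real \<delta> ^ (k + g - i) * card (L i) \<ge> c0 * real \<delta> ^ (k + g - i) * (\<delta> / C) ^ i"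
    using i(3) c0 by (intro mult_left_mono) auto
  also have "c0 * real \<delta> ^ (k + g - i) * (\<delta> / C) ^ i = c0 * real \<delta> ^ (k + g) / C ^ i"
  proof -
    have "k + g = (k + g - i) + i" using i by simp
    then have "real \<delta> ^ (k + g) = real \<delta> ^ (k + g - i) * real \<delta> ^ i" by (metis power_add)
    then show ?thesis by (simp add: power_divide)
  qed
  finally have "real (card \<K>) \<ge> c0 * real \<delta> ^ (k + g) / C ^ i" using \<K>(3) by simp
  moreover have "c0 * real \<delta> ^ (k + g) / C ^ i \<ge> c0 * real \<delta> ^ (k + g) / C ^ k"
    using C1 c0 i by (intro divide_left_mono power_increasing) auto
  ultimately have "real (card \<K>) \<ge> c0 / C ^ k * real \<delta> ^ (k + g)" by simp
  moreover have "\<exists>v\<in>verts K \<inter> U. x \<in> reach g v" if K: "K \<in> \<K>" for K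
  proof -
    obtain v where v: "v \<in> verts K" "v \<in> L g" using \<K>(4) K by blast
    have "x \<in> reach g v" by (rule L_reach[OF less_imp_le[OF g(1)] v(2)])
    moreover have "v \<in> U" using L_U v(2) by blast
    ultimately show ?thesis using v(1) by blast
  qed
  ultimately show ?thesis using \<K> g unfolding c0_def C_def
    by (intro exI[of _ g] conjI exI[of _ \<K>]) auto
qed

end

section \<open>From single roots to the whole hypergraph\<close>

context linear_partite
begin

text \<open>The parts are labelled one after the other, each costing a factor \<open>2 * k\<close>.
  By linearity the edges at \<open>v\<close> meet the next part in distinct vertices, if
  \<open>v\<close> is outside it, so \<open>balanced_labelling\<close> applies to the sets of these
  vertices for all \<open>v\<close> and \<open>t\<close> at once.\<close>

lemma level_labelling:
  fixes d :: real
  assumes k: "k \<ge> 1" and d: "d \<ge> 0"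
    and deg: "\<And>v. v \<in> U \<Longrightarrow> real (card {e\<in>edges G. v \<in> e}) \<ge> d"
    and small: "real (card U * k) < exp ((1 - ln 2) * (d / (2 * real k) ^ r) / (2 * real k))"
  shows "\<exists>lab. \<forall>v\<in>U. \<forall>t\<in>{1..k}.
    real (card {e\<in>edges G. v \<in> e \<and> (\<forall>w\<in>e-{v}. lab w = t)}) \<ge> d / (2 * real k) ^ r"
proof -
  define E where "E lab q v t = {e\<in>edges G. v \<in> e \<and> (\<forall>w\<in>e-{v}. w \<in> (\<Union>p\<in>{1..q}. A p) \<longrightarrow> lab w = t)}"
    for lab :: "'a \<Rightarrow> nat" and q v t
  have finE: "finite (E lab q v t)" for lab q v t unfolding E_def using finite_edges by simp
  have main: "q \<le> r \<Longrightarrow> \<exists>lab. \<forall>v\<in>U. \<forall>t\<in>{1..k}. real (card (E lab q v t)) \<ge> d / (2 * real k) ^ q" for q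
  proof (induction q)
    case 0
    have "E lab 0 v t = {e\<in>edges G. v \<in> e}" for lab v t unfolding E_def by auto
    then show ?case using deg by simp
  next
    case (Suc q)
    then obtain lab where lab: "\<forall>v\<in>U. \<forall>t\<in>{1..k}. real (card (E lab q v t)) \<ge> d / (2 * real k) ^ q" by auto
    define s where "s = d / (2 * real k) ^ q"
    define X where "X = A (Suc q)"
    have pX: "Suc q \<in> {1..r}" using Suc.prems by simp
    define I where "I = (U - X) \<times> {1..k}"
    define Sv where "Sv vt = vert (Suc q) ` E lab q (fst vt) (snd vt)" for vt
    have inj: "inj_on (vert (Suc q)) (E lab q v t)" if "v \<notin> X" for v t
    proof (rule inj_onI)
      fix e f assume ef: "e \<in> E lab q v t" "f \<in> E lab q v t" "vert (Suc q) e = vert (Suc q) f"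
      then have *: "e \<in> edges G" "f \<in> edges G" "v \<in> e" "v \<in> f" unfolding E_def by auto
      have "vert (Suc q) e \<in> e" "vert (Suc q) e \<in> f" using vert_in[OF *(1) pX] vert_in[OF *(2) pX] ef(3) by auto
      moreover have "vert (Suc q) e \<in> X" using vert_eq[OF *(1) pX] unfolding X_def by blast
      ultimately show "e = f" using edge_eqI[OF *(1,2,3,4)] that by metis
    qed
    have finX: "finite X" using part pX finite_verts unfolding r_partition_def X_def by (metis UN_I finite_subset subsetI)
    \<comment> \<open>The numerical hypothesis is stated for the smallest bound, the one after all
      \<open>r\<close> parts, and so covers each stage.\<close>
    have s_mono: "s \<ge> d / (2 * real k) ^ r"
      unfolding s_def using k d Suc.prems by (intro divide_left_mono power_increasing) auto
    have "\<exists>f\<in>X \<rightarrow>\<^sub>E {1..k}. \<forall>vt\<in>I. real (card {w\<in>Sv vt. f w = snd vt}) \<ge> s / (2 * real k)"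
    proof (rule balanced_labelling)
      show "finite X" by (rule finX)
      show "finite I" unfolding I_def using finite_U by simp
      show "1 \<le> k" by (rule k)
      show "Sv vt \<subseteq> X \<and> s \<le> real (card (Sv vt)) \<and> snd vt \<in> {1..k}" if "vt \<in> I" for vt
      proof -
        have vt: "fst vt \<in> U" "fst vt \<notin> X" "snd vt \<in> {1..k}" using that unfolding I_def by auto
        have "Sv vt \<subseteq> X"
        proof
          fix w assume "w \<in> Sv vt"
          then obtain e where "e \<in> edges G" "w = vert (Suc q) e" unfolding Sv_def E_def by blast
          then show "w \<in> X" using vert_eq[OF _ pX] unfolding X_def by blast
        qed
        moreover have "card (Sv vt) = card (E lab q (fst vt) (snd vt))"
          unfolding Sv_def by (rule card_image[OF inj[OF vt(2)]])
        ultimately show ?thesis using lab vt unfolding s_def by auto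
      qed
      have "card I \<le> card (U \<times> {1..k})" unfolding I_def using finite_U by (intro card_mono) auto
      then have "card I \<le> card U * k" by (simp add: card_cartesian_product)
      then have "real (card I) \<le> real (card U * k)" by (simp only: of_nat_le_iff)
      also have "\<dots> < exp ((1 - ln 2) * (d / (2 * real k) ^ r) / (2 * real k))" by (rule small)
      also have "\<dots> \<le> exp ((1 - ln 2) * s / (2 * real k))"
      proof -
        have "(1 - ln 2) * (d / (2 * real k) ^ r) \<le> (1 - ln 2) * s"
          using s_mono ln_le_minus_one[of 2] by (intro mult_left_mono) auto
        then show ?thesis unfolding exp_le_cancel_iff by (rule divide_right_mono) simp
      qed
      finally show "real (card I) < exp ((1 - ln 2) * s / (2 * real k))" .
    qed
    then obtain f where f: "\<And>v t. v \<in> U - X \<Longrightarrow> t \<in> {1..k} \<Longrightarrow> real (card {w\<in>Sv (v,t). f w = t}) \<ge> s / (2 * real k)"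
      unfolding I_def by fastforce
    define lab' where "lab' w = (if w \<in> X then f w else lab w)" for w
    have UNS: "(\<Union>p\<in>{1..Suc q}. A p) = X \<union> (\<Union>p\<in>{1..q}. A p)"
      unfolding X_def by (auto simp: atLeastAtMostSuc_conv)
    have "real (card (E lab' (Suc q) v t)) \<ge> s / (2 * real k)" if v: "v \<in> U" and t: "t \<in> {1..k}" for v t
    proof (cases "v \<in> X")
      case True
      \<comment> \<open>If \<open>v\<close> itself lies in the new part, its edges have no other
        vertex there and nothing is lost.\<close>
      have "E lab q v t \<subseteq> E lab' (Suc q) v t"
      proof
        fix e assume e: "e \<in> E lab q v t"
        then have eG: "e \<in> edges G" "v \<in> e" unfolding E_def by auto
        have "w \<notin> X" if "w \<in> e - {v}" for w
          using vert_unique[OF eG(1) pX, of w] vert_unique[OF eG(1) pX, of v] True eG that unfolding X_def by auto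
        then show "e \<in> E lab' (Suc q) v t" using e unfolding E_def UNS lab'_def by auto
      qed
      then have "card (E lab q v t) \<le> card (E lab' (Suc q) v t)" using finE by (intro card_mono)
      moreover have "real (card (E lab q v t)) \<ge> s" using lab v t unfolding s_def by auto
      moreover have "s / (2 * real k) \<le> s / 1" unfolding s_def using k d by (intro divide_left_mono) auto
      ultimately show ?thesis by linarith
    next
      case False
      let ?E = "{e\<in>E lab q v t. f (vert (Suc q) e) = t}"
      have "?E \<subseteq> E lab' (Suc q) v t"
      proof
        fix e assume e: "e \<in> ?E"
        then have eG: "e \<in> edges G" "v \<in> e" unfolding E_def by auto
        have "w \<in> X \<Longrightarrow> w = vert (Suc q) e" if "w \<in> e - {v}" for w
          using vert_unique[OF eG(1) pX, of w] that unfolding X_def by auto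
        then show "e \<in> E lab' (Suc q) v t" using e unfolding E_def UNS lab'_def by auto
      qed
      then have "card ?E \<le> card (E lab' (Suc q) v t)" using finE by (intro card_mono)
      moreover have "{w\<in>Sv (v,t). f w = t} = vert (Suc q) ` ?E" unfolding Sv_def by auto
      then have "card {w\<in>Sv (v,t). f w = t} \<le> card ?E" using finE by (simp add: card_image_le)
      moreover have "real (card {w\<in>Sv (v,t). f w = t}) \<ge> s / (2 * real k)" using f v t False by blast
      ultimately show ?thesis by linarith
    qed
    moreover have "s / (2 * real k) = d / (2 * real k) ^ Suc q" unfolding s_def by (simp add: ac_simps)
    ultimately show ?case by (intro exI[of _ lab']) simp
  qed
  obtain lab where lab: "\<forall>v\<in>U. \<forall>t\<in>{1..k}. real (card (E lab r v t)) \<ge> d / (2 * real k) ^ r"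
    using main[OF order_refl] by blast
  have "E lab r v t = {e\<in>edges G. v \<in> e \<and> (\<forall>w\<in>e-{v}. lab w = t)}" for v t
    unfolding E_def using part_ex by blast
  then show ?thesis using lab by (intro exI[of _ lab]) simp
qed

lemma finite_copies: "finite (copies H G)"
proof -
  have "copies H G \<subseteq> Pow (verts G) \<times> Pow (edges G)" unfolding copies_def by (auto simp: mem_Times_iff)
  then show ?thesis using finite_verts finite_edges by (meson finite_Pow_iff finite_SigmaI finite_subset)
qed

text \<open>Double counting of pairs of a root and a copy, separately for each value
  \<open>j\<close> of \<open>g\<close>. A copy has at most \<open>M\<close> vertices in
  \<open>U\<close>, each reaching at most \<open>\<Delta> ^ j\<close> roots, against
  \<open>c * \<delta> ^ (k + j)\<close> copies per root; the quotient leaves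
  \<open>\<delta> ^ k\<close> times a power of \<open>\<delta> / \<Delta>\<close>.\<close>

lemma copies_lower_bound:
  fixes c \<Delta> \<delta> :: real
  assumes k: "k \<ge> 1" and fin: "finite C" and deg: "\<And>v. v \<in> U \<Longrightarrow> real (card {e\<in>edges G. v \<in> e}) \<le> \<Delta>"
    and roots: "\<And>x. x \<in> U \<Longrightarrow> \<exists>g<k. \<exists>\<K>\<subseteq>C. c * \<delta> ^ (k + g) \<le> card \<K> \<and>
        (\<forall>K\<in>\<K>. finite (verts K) \<and> card (verts K) \<le> M \<and> (\<exists>v\<in>verts K \<inter> U. x \<in> reach g v))"
    and c: "c \<ge> 0" and \<delta>: "0 < \<delta>" "\<delta> \<le> \<Delta>"
  shows "card U * (c * \<delta> ^ k * (\<delta> / \<Delta>) ^ k) \<le> card C * (real M * k)"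
proof -
  define ok where "ok x g \<K> \<longleftrightarrow> g < k \<and> \<K> \<subseteq> C \<and> c * \<delta> ^ (k + g) \<le> card \<K> \<and>
        (\<forall>K\<in>\<K>. finite (verts K) \<and> card (verts K) \<le> M \<and> (\<exists>v\<in>verts K \<inter> U. x \<in> reach g v))" for x g \<K>
  have "\<forall>x\<in>U. \<exists>g \<K>. ok x g \<K>" using roots unfolding ok_def by meson
  then obtain g \<K> where ok: "\<And>x. x \<in> U \<Longrightarrow> ok x (g x) (\<K> x)" by metis
  have \<Delta>: "\<Delta> > 0" using \<delta> by simp
  define Ug where "Ug j = {x\<in>U. g x = j}" for j
  have finUg: "finite (Ug j)" for j unfolding Ug_def using finite_U by simp
  have each: "card (Ug j) * (c * \<delta> ^ k * (\<delta> / \<Delta>) ^ k) \<le> card C * real M" if j: "j < k" for j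
  proof -
    have "card (Ug j) * (c * \<delta> ^ (k + j)) = (\<Sum>x\<in>Ug j. c * \<delta> ^ (k + j))" by simp
    also have "\<dots> \<le> (\<Sum>x\<in>Ug j. real (card (\<K> x)))"
      using ok unfolding Ug_def ok_def by (intro sum_mono) auto
    also have "\<dots> = real (\<Sum>x\<in>Ug j. card {K\<in>C. K \<in> \<K> x})"
    proof -
      have "{K\<in>C. K \<in> \<K> x} = \<K> x" if "x \<in> Ug j" for x using ok[of x] that unfolding Ug_def ok_def by auto
      then show ?thesis by simp
    qed
    also have "(\<Sum>x\<in>Ug j. card {K\<in>C. K \<in> \<K> x}) = (\<Sum>K\<in>C. card {x\<in>Ug j. K \<in> \<K> x})"
      by (rule sum_multicount_gen[OF finUg fin]) simp
    also have "real (\<Sum>K\<in>C. card {x\<in>Ug j. K \<in> \<K> x}) \<le> (\<Sum>K\<in>C. real M * \<Delta> ^ j)"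
      unfolding of_nat_sum
    proof (rule sum_mono)
      fix K
      show "real (card {x\<in>Ug j. K \<in> \<K> x}) \<le> real M * \<Delta> ^ j"
      proof (cases "{x\<in>Ug j. K \<in> \<K> x} = {}")
        case True
        then show ?thesis using \<Delta> by (simp only: True) simp
      next
        case False
        then obtain x0 where "x0 \<in> Ug j" "K \<in> \<K> x0" by blast
        then have K: "finite (verts K)" "card (verts K) \<le> M" using ok[of x0] unfolding Ug_def ok_def by auto
        have sub: "{x\<in>Ug j. K \<in> \<K> x} \<subseteq> (\<Union>v\<in>verts K \<inter> U. reach j v)"
          using ok unfolding Ug_def ok_def by fast
        have fr: "finite (reach j v)" "real (card (reach j v)) \<le> \<Delta> ^ j" if "v \<in> U" for v
          using card_reach[OF that deg] by auto
        have "card {x\<in>Ug j. K \<in> \<K> x} \<le> card (\<Union>v\<in>verts K \<inter> U. reach j v)"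
          using sub fr K by (intro card_mono) auto
        also have "\<dots> \<le> (\<Sum>v\<in>verts K \<inter> U. card (reach j v))" using K by (intro card_UN_le) simp
        finally have "real (card {x\<in>Ug j. K \<in> \<K> x}) \<le> (\<Sum>v\<in>verts K \<inter> U. real (card (reach j v)))"
          by (simp flip: of_nat_sum)
        also have "\<dots> \<le> (\<Sum>v\<in>verts K \<inter> U. \<Delta> ^ j)" using fr by (intro sum_mono) auto
        also have "\<dots> = card (verts K \<inter> U) * \<Delta> ^ j" by simp
        also have "\<dots> \<le> real M * \<Delta> ^ j"
        proof (rule mult_right_mono)
          have "card (verts K \<inter> U) \<le> card (verts K)" using K by (intro card_mono) auto
          then show "real (card (verts K \<inter> U)) \<le> real M" using K by simp
        qed (use \<Delta> in simp)
        finally show ?thesis .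
      qed
    qed
    also have "\<dots> = card C * real M * \<Delta> ^ j" by simp
    finally have *: "card (Ug j) * (c * \<delta> ^ (k + j)) \<le> card C * real M * \<Delta> ^ j" .
    have "c * \<delta> ^ k * (\<delta> / \<Delta>) ^ k \<le> c * \<delta> ^ k * (\<delta> / \<Delta>) ^ j"
      using c \<delta> \<Delta> j by (intro mult_left_mono power_decreasing) auto
    then have "card (Ug j) * (c * \<delta> ^ k * (\<delta> / \<Delta>) ^ k) \<le> card (Ug j) * (c * \<delta> ^ k * (\<delta> / \<Delta>) ^ j)"
      by (rule mult_left_mono) simp
    also have "\<dots> = card (Ug j) * (c * \<delta> ^ (k + j)) / \<Delta> ^ j" by (simp add: power_divide power_add)
    also have "\<dots> \<le> card C * real M * \<Delta> ^ j / \<Delta> ^ j" using * \<Delta> by (intro divide_right_mono) auto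
    also have "\<dots> = card C * real M" using \<Delta> by simp
    finally show ?thesis .
  qed
  have "card U = (\<Sum>j<k. card (Ug j))"
  proof -
    have "(\<Sum>j<k. \<Sum>x\<in>{x\<in>U. g x = j}. 1) = (\<Sum>x\<in>U. (1::nat))"
      using finite_U ok unfolding ok_def by (intro sum.group) auto
    then show ?thesis unfolding Ug_def by simp
  qed
  then have "card U * (c * \<delta> ^ k * (\<delta> / \<Delta>) ^ k) = (\<Sum>j<k. card (Ug j) * (c * \<delta> ^ k * (\<delta> / \<Delta>) ^ k))"
    by (simp add: sum_distrib_right)
  also have "\<dots> \<le> (\<Sum>j<k. card C * real M)" using each by (intro sum_mono) auto
  also have "\<dots> = card C * (real M * k)" by simp
  finally show ?thesis .
qed

text \<open>Re-rooting a labelling at \<open>x\<close> costs at most the one edge joining \<open>x\<close> to a given vertex.\<close>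

lemma rootedI:
  assumes k: "k \<ge> 2" and x: "x \<in> U"
    and lab: "\<And>v t. v \<in> U \<Longrightarrow> t \<in> {1..k} \<Longrightarrow> card {e\<in>edges G. v \<in> e \<and> (\<forall>w\<in>e-{v}. lab w = t)} \<ge> Suc \<delta>"
  shows "\<exists>S. rooted G A r k x (\<lambda>v. if v = x then 0 else lab v) S \<delta>"
proof -
  let ?lev = "\<lambda>v. if v = x then 0 else lab v"
  let ?E = "\<lambda>t u. {e\<in>edges G. u \<in> e \<and> (\<forall>v\<in>e-{u}. ?lev v = t)}"
  have ex: "\<exists>T. T \<subseteq> ?E t u \<and> card T = \<delta>" if t: "t \<in> {1..k}" and u: "u \<in> U" for t u
  proof -
    let ?B = "{e\<in>edges G. u \<in> e \<and> (\<forall>w\<in>e-{u}. lab w = t)}" and ?X = "{e\<in>edges G. u \<in> e \<and> x \<in> e \<and> x \<noteq> u}"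
    have sub: "?B - ?X \<subseteq> ?E t u" using t by auto
    have "\<forall>a\<in>?X. \<forall>b\<in>?X. a = b" using edge_eqI by blast
    then have cX: "card ?X \<le> 1" using finite_edges by (simp add: card_le_Suc0_iff_eq)
    have "card ?B \<le> card (?B - ?X) + card ?X"
      using card_Un_le[of "?B - ?X" ?X] card_mono[of "(?B - ?X) \<union> ?X" ?B] finite_edges by fastforce
    then have le: "\<delta> \<le> card (?B - ?X)" using lab[OF u t] cX by linarith
    obtain T where "T \<subseteq> ?B - ?X" "card T = \<delta>" by (rule obtain_subset_with_card_n[OF le])
    then show ?thesis using sub by (intro exI[of _ T]) blast
  qed
  define S where "S t u = (SOME T. T \<subseteq> ?E t u \<and> card T = \<delta>)" for t u
  have S: "S t u \<subseteq> ?E t u \<and> card (S t u) = \<delta>" if "t \<in> {1..k}" "u \<in> U" for t u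
    unfolding S_def by (rule someI_ex[OF ex[OF that]])
  have "rooted G A r k x ?lev S \<delta>"
    using k x S by unfold_locales simp_all
  then show ?thesis by blast
qed

end

section \<open>Numerical estimates and the choice of constants\<close>

text \<open>Put \<open>y = n powr (1 / k)\<close>; then \<open>n = y ^ k\<close>, and an exponential
  in \<open>y\<close> outgrows every fixed multiple of \<open>y ^ k\<close>.\<close>

lemma eventually_threshold:
  fixes \<kappa> m0 :: real
  assumes "\<kappa> > 0" "k \<ge> 1"
  shows "\<exists>n0. \<forall>n\<ge>n0. real (n * k) < exp (\<kappa> * real n powr (1 / k)) \<and> real n powr (1 / k) \<ge> m0"
proof -
  have "((\<lambda>y::real. y ^ k / exp y) \<longlongrightarrow> 0) at_top" by (rule tendsto_power_div_exp_0)
  then have "\<forall>\<^sub>F y in at_top. y ^ k / exp y < \<kappa> ^ k / k"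
    using assms by (intro order_tendstoD(2)) auto
  moreover have "filterlim (\<lambda>y::real. \<kappa> * y) at_top at_top"
    using assms by (intro filterlim_tendsto_pos_mult_at_top[OF tendsto_const]) (auto simp: filterlim_ident)
  ultimately have ev: "\<forall>\<^sub>F y in at_top. (\<kappa> * y) ^ k / exp (\<kappa> * y) < \<kappa> ^ k / k"
    by (rule eventually_compose_filterlim)
  obtain Y0 where Y0: "\<And>y. y \<ge> Y0 \<Longrightarrow> (\<kappa> * y) ^ k / exp (\<kappa> * y) < \<kappa> ^ k / k"
    using ev unfolding eventually_at_top_linorder by blast
  define Y where "Y = max 1 (max Y0 m0)"
  have "real (n * k) < exp (\<kappa> * real n powr (1 / k)) \<and> real n powr (1 / k) \<ge> m0"
    if n: "n \<ge> nat \<lceil>Y ^ k\<rceil>" for n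
  proof -
    have Y1: "Y \<ge> 1" unfolding Y_def by simp
    have nY: "real n \<ge> Y ^ k" using n by linarith
    moreover have "Y ^ k \<ge> 1" using Y1 by simp
    ultimately have n1: "real n \<ge> 1" by linarith
    define y where "y = real n powr (1 / k)"
    have "Y = (Y ^ k) powr (1 / k)" using Y1 assms by (simp add: powr_realpow[symmetric] powr_powr)
    also have "\<dots> \<le> y" unfolding y_def using nY Y1 by (intro powr_mono2) auto
    finally have y: "y \<ge> Y" .
    have yk: "y ^ k = real n" unfolding y_def using n1 assms by (simp add: powr_realpow[symmetric] powr_powr)
    have "(\<kappa> * y) ^ k / exp (\<kappa> * y) < \<kappa> ^ k / k" using y unfolding Y_def by (intro Y0) simp
    then have "\<kappa> ^ k * (real n * k) < \<kappa> ^ k * exp (\<kappa> * y)"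
      using assms by (simp add: field_simps power_mult_distrib flip: yk)
    then have "real n * k < exp (\<kappa> * y)" using assms by simp
    then show ?thesis using y unfolding y_def Y_def by simp
  qed
  then show ?thesis by blast
qed

text \<open>Square \<open>2 * k < 4 ^ k\<close>. This is where the factor \<open>16 ^ k\<close> in
  the bound on \<open>D\<close> absorbs the loss \<open>2 * k * k * r\<close> per level.\<close>

lemma four_square_less_power_16: "4 * real k ^ 2 < 16 ^ k"
proof -
  have "2 * k < 4 ^ k"
  proof (induction k)
    case (Suc k) then show ?case by (cases k) auto
  qed simp
  then have "(2 * real k) < 4 ^ k" by (metis of_nat_less_iff of_nat_mult of_nat_numeral of_nat_power)
  then have "(2 * real k) ^ 2 < (4 ^ k) ^ 2" by (intro power_strict_mono) auto
  moreover have "((4::real) ^ k) ^ 2 = 16 ^ k" by (simp add: power_mult[symmetric] mult.commute[of k]) (simp add: power_mult)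
  ultimately show ?thesis by (simp add: power_mult_distrib)
qed

theorem theorem5p7:
  fixes k r :: nat
  assumes "k \<ge> 2" and "r \<ge> 2"
  shows "\<exists>\<alpha> :: real \<Rightarrow> real. (\<forall>l\<ge>1. \<alpha> l > 0) \<and>
    (\<forall>D::real. D \<ge> 2 ^ (r + 1) * real r * real k ^ r * 16 ^ k \<longrightarrow>
      (\<exists>n\<^sub>0::nat. \<forall>l::real. l \<ge> 1 \<longrightarrow>
        (\<forall>(G :: 'a hypergraph) (A :: nat \<Rightarrow> 'a set) (n::nat).
           uniform_hypergraph r G \<and> linear_hypergraph G \<and> r_partition r G A \<and>
           card (A 1 \<union> A 2) = n \<and> n \<ge> n\<^sub>0 \<and>
           (\<forall>v \<in> A 1 \<union> A 2.
              D * real n powr (1 / real k) \<le> real (card (link r G v)) \<and>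
              real (card (link r G v)) \<le> l * D * real n powr (1 / real k))
           \<longrightarrow> real (num_copies (linear_cycle r (2 * k)) G) \<ge> \<alpha> l * (real n)\<^sup>2)))"
proof -
  have k1: "k \<ge> 1" "real k \<ge> 2" "real r \<ge> 2" using assms by auto
  \<comment> \<open>The ratio of degree to spread demanded by \<open>good_walks_extend\<close>;
    \<open>\<beta>\<close> below is the density of stars supplied by \<open>many_stars\<close>.
    Neither depends on \<open>D\<close>, \<open>n\<close> or \<open>G\<close>.\<close>
  define B where "B = 4 * real k * (real (card (attrs k r)))\<^sup>2"
  have "card (attrs k r) > 0" using finite_attrs attrs_nonempty[of k r] assms by (simp add: card_gt_0_iff)
  then have Bpos: "B > 0" unfolding B_def using k1 by simp
  define \<beta> where "\<beta> = 1 / (2 * real k * (real k * real r))"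
  have \<beta>pos: "\<beta> > 0" unfolding \<beta>_def using k1 by simp
  have J: "finite {..<k}" "{..<k} \<noteq> {}" using k1 by (auto simp: lessThan_empty_iff)
  obtain b0 where b0: "b0 > 0" and can0: "\<forall>(\<sigma> :: nat \<Rightarrow> 'a \<times> 'a list \<Rightarrow> 'a) (V :: nat \<times> nat \<times> nat \<Rightarrow> 'a \<times> 'a list \<Rightarrow> 'a) Y L \<delta>.
     finite Y \<longrightarrow> finite L \<longrightarrow> \<delta> \<ge> 0 \<longrightarrow> (\<forall>j\<in>{..<k}. \<forall>y\<in>Y. \<sigma> j y \<in> L) \<longrightarrow>
     (\<forall>j\<in>{..<k}. \<forall>u\<in>L. real (card {y\<in>Y. \<sigma> j y = u}) \<le> \<delta>) \<longrightarrow>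
     real (card Y) \<ge> \<beta> * \<delta> * real (card L) \<longrightarrow>
     (\<exists>Z\<subseteq>Y. \<exists>g\<ge>b0. real (card Z) \<ge> g * \<delta> * real (card L) \<and>
       (\<forall>j\<in>{..<k}. \<forall>y\<in>Z. real (card {y'\<in>Z. \<sigma> j y' = \<sigma> j y}) \<ge> g * \<delta>) \<and>
       (\<forall>j\<in>{..<k}. \<forall>q\<in>attrs k r. det_by (\<sigma> j) (V q) Z \<or> spread_by (g / B * \<delta>) (\<sigma> j) (V q) Z))"
    using canonical_subfamily[OF J(1) finite_attrs[of k r] J(2) Bpos \<beta>pos, where 'y = "'a \<times> 'a list" and 'u = 'a and 'v = 'a]
    by (elim exE conjE) (rule that)
  define b where "b = min b0 1"
  have b: "0 < b" "b \<le> 1" unfolding b_def using b0 by auto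
  define c where "c = b * (b / 2) ^ k / (2 * real k * real r) ^ (2 * k) / (2 * (real k * real k * real r)) ^ k"
  have c: "c > 0" unfolding c_def using b k1 by simp
  \<comment> \<open>A lower bound for \<open>\<delta> / d\<close>: the labelling costs
    \<open>(2 * k) ^ r\<close>, and halving and rounding cost at most 4.\<close>
  define \<rho> where "\<rho> = 1 / (4 * (2 * real k) ^ r)"
  have \<rho>: "\<rho> > 0" unfolding \<rho>_def using k1 by simp
  define \<alpha> where "\<alpha> l = c / (2 * real k * real r * real k) * (\<rho> / l) ^ k" for l :: real
  have \<alpha>pos: "\<forall>l\<ge>1. \<alpha> l > 0" unfolding \<alpha>_def using c \<rho> k1 by simp
  have main: "\<exists>n0::nat. \<forall>l::real. l \<ge> 1 \<longrightarrow>
        (\<forall>(G :: 'a hypergraph) (A :: nat \<Rightarrow> 'a set) (n::nat).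
           uniform_hypergraph r G \<and> linear_hypergraph G \<and> r_partition r G A \<and>
           card (A 1 \<union> A 2) = n \<and> n \<ge> n0 \<and>
           (\<forall>v \<in> A 1 \<union> A 2.
              D * real n powr (1 / real k) \<le> real (card (link r G v)) \<and>
              real (card (link r G v)) \<le> l * D * real n powr (1 / real k))
           \<longrightarrow> real (num_copies (linear_cycle r (2 * k)) G) \<ge> \<alpha> l * (real n)\<^sup>2)"
    if D: "D \<ge> 2 ^ (r + 1) * real r * real k ^ r * 16 ^ k" for D :: real
  proof -
    \<comment> \<open>The lower bound on \<open>D\<close> is exactly
      \<open>P * (2 * r * 16 ^ k)\<close>.\<close>
    define P where "P = (2 * real k) ^ r"
    have P1: "P \<ge> 1" unfolding P_def using k1 by (intro one_le_power) simp
    have DP: "D \<ge> P * (2 * real r * 16 ^ k)" using D unfolding P_def by (simp add: power_mult_distrib mult_ac)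
    have DP1: "D / P \<ge> 2 * real r * 16 ^ k" using DP P1 by (simp add: field_simps)
    have "1 * 1 \<le> 2 * real r * 16 ^ k" using k1 by (intro mult_mono) auto
    then have DP2: "D / P \<ge> 1" using DP1 by linarith
    have Dpos: "D > 0" using DP2 P1 by (simp add: field_simps)
    define \<kappa> where "\<kappa> = (1 - ln 2) * (D / P) / (2 * real k)"
    have "ln 2 < (1::real)" using ln_add_one_self_less_self[of 1] by simp
    then have \<kappa>: "\<kappa> > 0" unfolding \<kappa>_def using Dpos P1 k1 by simp
    \<comment> \<open>The first condition is what the labelling needs; 4 pays for rounding in
      \<open>\<delta>\<close>, and \<open>16 * k / b\<close> gives
      \<open>b * \<delta> \<ge> 4 * k\<close>. None of this involves \<open>l\<close>.\<close>
    obtain n0 where n0: "\<And>n. n \<ge> n0 \<Longrightarrow> real (n * k) < exp (\<kappa> * real n powr (1 / k)) \<and>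
        real n powr (1 / k) \<ge> max 4 (16 * real k / b)"
      using eventually_threshold[OF \<kappa> k1(1), of "max 4 (16 * real k / b)"] by blast
    have "real (num_copies (linear_cycle r (2 * k)) G) \<ge> \<alpha> l * (real n)\<^sup>2"
      if l: "l \<ge> 1" and G: "uniform_hypergraph r G" "linear_hypergraph G" "r_partition r G A"
        "card (A 1 \<union> A 2) = n" "n \<ge> n0"
        "\<forall>v \<in> A 1 \<union> A 2. D * real n powr (1 / real k) \<le> real (card (link r G v)) \<and>
              real (card (link r G v)) \<le> l * D * real n powr (1 / real k)"
      for l and G :: "'a hypergraph" and A n
    proof -
      interpret linear_partite G A r by unfold_locales (use assms G in auto)
      define y where "y = real n powr (1 / real k)"
      define d where "d = D * y"
      have U: "card U = n" using G(4) U_def by simp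
      have y: "y \<ge> 4" "y \<ge> 16 * real k / b" "real (n * k) < exp (\<kappa> * y)" using n0[OF G(5)] unfolding y_def by auto
      have npos: "n > 0" using y(1) unfolding y_def by (cases "n = 0") auto
      have yk: "y ^ k = n" unfolding y_def using npos k1 by (simp add: powr_realpow[symmetric] powr_powr)
      have dpos: "d > 0" unfolding d_def using Dpos y by simp
      have deg: "d \<le> real (card {e\<in>edges G. v \<in> e})" "real (card {e\<in>edges G. v \<in> e}) \<le> l * d" if "v \<in> U" for v
        using G(6) that unfolding U_def card_link d_def y_def by (auto simp: mult.assoc)
      have small: "real (card U * k) < exp ((1 - ln 2) * (d / (2 * real k) ^ r) / (2 * real k))"
      proof -
        have "(1 - ln 2) * (d / (2 * real k) ^ r) / (2 * real k) = \<kappa> * y" unfolding \<kappa>_def d_def P_def by simp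
        then show ?thesis using y(3) U by simp
      qed
      define s0 where "s0 = d / P"
      obtain lab where lab: "\<And>v t. v \<in> U \<Longrightarrow> t \<in> {1..k} \<Longrightarrow>
          real (card {e\<in>edges G. v \<in> e \<and> (\<forall>w\<in>e-{v}. lab w = t)}) \<ge> s0"
        using level_labelling[OF k1(1) less_imp_le[OF dpos] deg(1) small] unfolding s0_def P_def by blast
      have s0y: "s0 = D / P * y" unfolding s0_def d_def by simp
      have s01: "s0 \<ge> 1 * y" unfolding s0y using DP2 y by (intro mult_right_mono) auto
      \<comment> \<open>As \<open>s0\<close> is at least 4, this leaves
        \<open>Suc \<delta> \<le> s0\<close>, the spare edge being spent on re-rooting, and
        \<open>\<delta> \<ge> s0 / 4\<close>.\<close>
      define \<delta> where "\<delta> = nat \<lfloor>s0 / 2\<rfloor>"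
      have \<delta>: "real \<delta> \<le> s0 / 2" "real \<delta> \<ge> s0 / 2 - 1" using s01 y unfolding \<delta>_def by linarith+
      have \<delta>4: "real \<delta> \<ge> s0 / 4" using \<delta> s01 y by linarith
      have lab': "card {e\<in>edges G. v \<in> e \<and> (\<forall>w\<in>e-{v}. lab w = t)} \<ge> Suc \<delta>" if "v \<in> U" "t \<in> {1..k}" for v t
      proof -
        have "real (Suc \<delta>) \<le> s0" using \<delta>(1) s01 y by simp
        then have "real (Suc \<delta>) \<le> real (card {e\<in>edges G. v \<in> e \<and> (\<forall>w\<in>e-{v}. lab w = t)})"
          using lab[OF that] by linarith
        then show ?thesis by (simp only: of_nat_le_iff)
      qed
      have b\<delta>: "b * \<delta> \<ge> 4 * k"
      proof -
        have "s0 / 4 \<ge> 4 * real k / b" using s01 y by simp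
        then have "real \<delta> \<ge> 4 * real k / b" using \<delta>4 by linarith
        then show ?thesis using b by (simp add: field_simps)
      qed
      define C where "C = 2 * (real k * real k * real r)"
      have Cpos: "C \<ge> 1"
      proof -
        have "1 * 1 * 1 \<le> real k * real k * real r" using k1 by (intro mult_mono) auto
        then show ?thesis unfolding C_def by simp
      qed
      \<comment> \<open>\<open>C = 2 * k * k * r\<close> is below \<open>r * 16 ^ k / 2\<close>, and
        a quarter of \<open>D / P\<close> is at least that. Since \<open>y ^ k = n\<close>, the
        levels cannot all expand by \<open>\<delta> / C\<close>.\<close>
      have "\<delta> / C > y"
      proof -
        have "C * y < real r * 16 ^ k / 2 * y"
        proof (rule mult_strict_right_mono)
          have "real r * (4 * real k ^ 2) < real r * 16 ^ k" using four_square_less_power_16[of k] k1 by (intro mult_strict_left_mono) auto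
          then show "C < real r * 16 ^ k / 2" unfolding C_def by (simp add: power2_eq_square mult_ac)
        qed (use y in simp)
        also have "\<dots> = 2 * real r * 16 ^ k * y / 4" by simp
        also have "\<dots> \<le> D / P * y / 4" using DP1 y by (intro divide_right_mono mult_right_mono) auto
        also have "\<dots> \<le> \<delta>" using \<delta>4 s0y by simp
        finally show ?thesis using Cpos by (simp add: field_simps)
      qed
      then have big: "(\<delta> / C) ^ k > card U"
        using power_strict_mono[of y "\<delta> / C" k] y yk U k1 by simp
      have "\<delta> / C \<le> \<delta> / 1" using Cpos by (intro divide_left_mono) auto
      then have \<delta>y: "real \<delta> \<ge> y" using \<open>\<delta> / C > y\<close> by simp
      have can: "\<exists>Z\<subseteq>Y. \<exists>g\<ge>b. real (card Z) \<ge> g * real \<delta> * real (card L) \<and>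
       (\<forall>j\<in>{..<k}. \<forall>y\<in>Z. real (card {y'\<in>Z. role j y' = role j y}) \<ge> g * real \<delta>) \<and>
       (\<forall>j\<in>{..<k}. \<forall>q\<in>attrs k r. det_by (role j) (V q) Z \<or>
          spread_by (g / (4 * k * (card (attrs k r))\<^sup>2) * real \<delta>) (role j) (V q) Z)"
        if h: "finite Y" "finite L" "\<forall>j\<in>{..<k}. \<forall>y\<in>Y. role j y \<in> L"
          "\<forall>j\<in>{..<k}. \<forall>u\<in>L. real (card {y\<in>Y. role j y = u}) \<le> real \<delta>"
          "real (card Y) \<ge> 1 / (2 * k * (k * r)) * real \<delta> * real (card L)"
        for V :: "nat \<times> nat \<times> nat \<Rightarrow> 'a \<times> 'a list \<Rightarrow> 'a" and Y L
      proof -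
        have "\<beta> = 1 / (2 * k * (k * r))" unfolding \<beta>_def by simp
        then have Yb: "real (card Y) \<ge> \<beta> * real \<delta> * real (card L)" using h(5) by simp
        obtain Z g where "Z \<subseteq> Y" "g \<ge> b0" and *: "real (card Z) \<ge> g * real \<delta> * real (card L) \<and>
       (\<forall>j\<in>{..<k}. \<forall>y\<in>Z. real (card {y'\<in>Z. role j y' = role j y}) \<ge> g * real \<delta>) \<and>
       (\<forall>j\<in>{..<k}. \<forall>q\<in>attrs k r. det_by (role j) (V q) Z \<or> spread_by (g / B * real \<delta>) (role j) (V q) Z)"
          using can0[rule_format, where \<sigma>=role and V=V and Y=Y and L=L and \<delta>="real \<delta>"] h(1-4) Yb by auto
        moreover have "B = 4 * k * (card (attrs k r))\<^sup>2" unfolding B_def by simp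
        ultimately show ?thesis unfolding b_def by (intro exI[of _ Z] conjI exI[of _ g]) auto
      qed
      have roots: "\<exists>g<k. \<exists>\<K>\<subseteq>copies (linear_cycle r (2 * k)) G. c * real \<delta> ^ (k + g) \<le> card \<K> \<and>
        (\<forall>K\<in>\<K>. finite (verts K) \<and> card (verts K) \<le> 2 * k * r \<and> (\<exists>v\<in>verts K \<inter> U. x \<in> reach g v))"
        if x: "x \<in> U" for x
      proof -
        obtain S where "rooted G A r k x (\<lambda>v. if v = x then 0 else lab v) S \<delta>"
          using rootedI[OF assms(1) x lab'] by blast
        then interpret R: rooted G A r k x "\<lambda>v. if v = x then 0 else lab v" S \<delta> .
        have "(\<delta> / (2 * (k * k * r))) ^ k > card U" using big unfolding C_def by simp
        from R.root_cycles[OF can b b\<delta> this] show ?thesis unfolding c_def by (simp add: mult.assoc) blast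
      qed
      have "card U * (c * real \<delta> ^ k * (\<delta> / (l * d)) ^ k) \<le>
          card (copies (linear_cycle r (2 * k)) G) * (real (2 * k * r) * k)"
      proof (rule copies_lower_bound[OF k1(1) finite_copies deg(2) roots])
        show "0 \<le> c" using c by simp
        show "0 < real \<delta>" using \<delta>y y by simp
        have "s0 / 2 \<le> d" unfolding s0_def using P1 dpos by (simp add: field_simps)
        moreover have "1 * d \<le> l * d" using l dpos by (intro mult_right_mono) auto
        ultimately show "real \<delta> \<le> l * d" using \<delta>(1) by linarith
      qed
      \<comment> \<open>One factor \<open>n\<close> counts the roots, the other is the lower bound
        \<open>y ^ k\<close> for \<open>\<delta> ^ k\<close>.\<close>
      moreover have "n * (c * n * (\<rho> / l) ^ k) \<le> card U * (c * real \<delta> ^ k * (\<delta> / (l * d)) ^ k)"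
      proof -
        have "real n \<le> real \<delta> ^ k" using \<delta>y y yk power_mono[of y "real \<delta>" k] by simp
        moreover have "\<rho> / l \<le> \<delta> / (l * d)"
        proof -
          have "\<rho> / l = (s0 / 4) / (l * d)" unfolding \<rho>_def s0_def P_def using dpos by simp
          also have "\<dots> \<le> \<delta> / (l * d)" using \<delta>4 l dpos by (intro divide_right_mono) auto
          finally show ?thesis .
        qed
        ultimately show ?thesis unfolding U using c \<rho> l
          by (intro mult_left_mono mult_mono power_mono) auto
      qed
      ultimately have "n * (c * n * (\<rho> / l) ^ k) \<le> num_copies (linear_cycle r (2 * k)) G * (real (2 * k * r) * k)"
        unfolding num_copies_def by linarith
      moreover have "real (2 * k * r) * k > 0" using k1 by simp
      ultimately have "n * (c * n * (\<rho> / l) ^ k) / (real (2 * k * r) * k) \<le> num_copies (linear_cycle r (2 * k)) G"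
        by (simp only: pos_divide_le_eq)
      moreover have "n * (c * n * (\<rho> / l) ^ k) / (real (2 * k * r) * k) = \<alpha> l * (real n)\<^sup>2"
        unfolding \<alpha>_def by (simp add: power2_eq_square)
      ultimately show ?thesis by simp
    qed
    then show ?thesis by (intro exI[of _ n0]) blast
  qed
  show ?thesis using \<alpha>pos main by (intro exI[of _ \<alpha>]) simp
qed

end
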